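(* Let $R$ be an aperiodic vertically unbounded two-step rule, let $x\in(0,\infty)$ and take $y=\tau(x)$. Then the vertical drift $\delta_{\mathbf y}(x,y)$ is exactly $0$. For each step direction $\theta$, the radius of convergence (in $t$) of the half-plane generating function $H_\theta(t;x,y)$ is $\rho(x,y)$; near $t=\rho(x,y)$, $$H_\theta(t;x,y)\underset{t\to\rho(x,y)}{\sim}c^0(x,y)\,(1-t/\rho(x,y))^{-1/2},$$ where $$\begin{aligned}c^0(x,y)=&\sqrt{\frac{2}{\kappa(x)\,\mu^{(0,2)}(x,\tau(x))}}\cdot\frac{1}{\kappa(x)\,B_\theta^{(1,0,0)}(\kappa(x);x,\tau(x))}\\&\times\left(C_\theta^{(0,0,1)}(\kappa(x);x,\tau(x))-D_\theta^{(0,0,1)}(\kappa(x);x,\tau(x))\,\frac{C_\theta(\kappa(x);x,\tau(x))}{D_\theta(\kappa(x);x,\tau(x))}\right).\end{aligned}$$ Thus $$\Theta_m^+(x,y)\sim\frac{c^0(x,y)}{\sqrt{\pi m}}\,\mu(x)^m\qquad\text{as }m\to\infty,$$ where $\mu(x)=1/\kappa(x)=1/\rho(x,\tau(x))$.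
   Context: Steps on $\mathbb Z^2$: east $(1,0)$, north $(0,1)$, west $(-1,0)$, south $(0,-1)$, abbreviated $e,n,w,s$. A two-step rule is a map $R:\{e,n,w,s\}^2\to\{0,1\}$; $R(i,j)=1$ means a step of type $i$ may be immediately followed by one of type $j$. Its transfer matrix is $T=(R(i,j))_{i,j}$. The rule is aperiodic if there is $k\ge1$ with $(T^k)_{ij}>0$ for all $i,j$. A rule is north-bound if there is always a north step between each pair of south steps, south-bound if there is always a south step between each pair of north steps, and vertically unbounded if it is neither. A walk obeying $R$ is a nonempty finite sequence of steps, starting at the origin, with arbitrary first step and with $R(i,j)=1$ for each consecutive pair $(i,j)$. The generating function of a class of walks is $\sum t^m x^a y^b$ over walks in the class, where $m$ is the length and $(a,b)$ the endpoint. $B_\theta$: full-plane walks obeying $R$ whose first step $j$ satisfies $R(\theta,j)=1$, containing exactly one $\theta$ step, which is their last step. $C_\theta$ (resp. $D_\theta$): full-plane walks obeying $R$ which do not (resp. do) start with a south step and contain exactly one $\theta$ step, which is their last step. $B_\theta,C_\theta,D_\theta$ are rational functions of $t,x,y$; a superscript $(i,j,k)$ denotes the partial derivative taken $i$ times in $t$, $j$ in $x$, $k$ in $y$. $H_\theta(t;x,y)=\sum_m\Theta^+_m(x,y)t^m$: walks obeying $R$, starting at the origin, staying in $\{(a,b):b\ge0\}$, with last step $\theta$. For $x,y\in(0,\infty)$, $\rho(x,y)$ is the smallest positive $t$ with $B_\theta(t;x,y)=1$ (it exists and is independent of $\theta$), $\mu(x,y)=1/\rho(x,y)$, and $\mu^{(0,2)}$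 is its second partial derivative in $y$. The vertical drift is $\delta_{\mathbf y}(x,y)=\frac{B_\theta^{(0,0,1)}(\rho;x,y)}{\rho B_\theta^{(1,0,0)}(\rho;x,y)}=\frac{\partial}{\partial y}\log\mu(x,y)$, with $\rho=\rho(x,y)$. For fixed $x$, $\rho(x,\cdot)$ is increasing and then decreasing on $(0,\infty)$; $\tau(x)$ is the unique point where $\partial\rho/\partial y=0$, and $\kappa(x)=\rho(x,\tau(x))$. *)

theory Defs
  imports "HOL-Analysis.Analysis" "HOL-Library.Landau_Symbols"
begin

datatype step = East | North | West | South

instance step :: finite
proof
  have "(UNIV :: step set) \<subseteq> {East, North, West, South}"
    using step.exhaust by blast
  then show "finite (UNIV :: step set)"
    by (rule finite_subset) simp
qed

primrec step_x :: "step \<Rightarrow> int" where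
  "step_x East = 1" | "step_x North = 0" | "step_x West = -1" | "step_x South = 0"

primrec step_y :: "step \<Rightarrow> int" where
  "step_y East = 0" | "step_y North = 1" | "step_y West = 0" | "step_y South = -1"

text \<open>A rule is a predicate \<open>R\<close>, with \<open>R i j\<close> meaning that a step \<open>i\<close> may be
  immediately followed by a step \<open>j\<close>; a walk is the list of its steps.\<close>

type_synonym rule = "step \<Rightarrow> step \<Rightarrow> bool"

type_synonym walk = "step list"

definition transfer_matrix :: "rule \<Rightarrow> nat ^ step ^ step" where
  "transfer_matrix R = (\<chi> i j. of_bool (R i j))"

text \<open>The operator \<open>^\<close> is componentwise on this type, hence the iterated matrix product.\<close>

definition aperiodic :: "rule \<Rightarrow> bool" where
  "aperiodic R \<longleftrightarrow>
     (\<exists>k\<ge>1. \<forall>i j. ((\<lambda>M. M ** transfer_matrix R) ^^ k) (mat 1) $ i $ j > 0)"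

definition walks :: "rule \<Rightarrow> walk set" where
  "walks R = {w. w \<noteq> [] \<and> successively R w}"

definition north_bound :: "rule \<Rightarrow> bool" where
  "north_bound R \<longleftrightarrow>
     (\<forall>w\<in>walks R. \<forall>i j. i < j \<and> j < length w \<and> w ! i = South \<and> w ! j = South
        \<longrightarrow> (\<exists>k. i < k \<and> k < j \<and> w ! k = North))"

definition south_bound :: "rule \<Rightarrow> bool" where
  "south_bound R \<longleftrightarrow>
     (\<forall>w\<in>walks R. \<forall>i j. i < j \<and> j < length w \<and> w ! i = North \<and> w ! j = North
        \<longrightarrow> (\<exists>k. i < k \<and> k < j \<and> w ! k = South))"

definition vertically_unbounded :: "rule \<Rightarrow> bool" where
  "vertically_unbounded R \<longleftrightarrow> \<not> north_bound R \<and> \<not> south_bound R"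

definition end_x :: "walk \<Rightarrow> int" where
  "end_x w = (\<Sum>s\<leftarrow>w. step_x s)"

definition end_y :: "walk \<Rightarrow> int" where
  "end_y w = (\<Sum>s\<leftarrow>w. step_y s)"

text \<open>The generating function of a class of walks, as an unconditional sum. (The value is \<open>0\<close>
  where the sum diverges. For the classes below the sum converges in a neighbourhood of every
  point at which values or derivatives are taken, so there it coincides with the rational
  function that it represents.)\<close>

definition gen_fun :: "walk set \<Rightarrow> real \<Rightarrow> real \<Rightarrow> real \<Rightarrow> real" where
  "gen_fun A t x y = (\<Sum>\<^sub>\<infinity>w\<in>A. t ^ length w * x powi end_x w * y powi end_y w)"

definition first_return :: "step \<Rightarrow> walk \<Rightarrow> bool" where
  "first_return \<theta> w \<longleftrightarrow> count_list w \<theta> = 1 \<and> last w = \<theta>"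

definition B :: "rule \<Rightarrow> step \<Rightarrow> real \<Rightarrow> real \<Rightarrow> real \<Rightarrow> real" where
  "B R \<theta> = gen_fun {w \<in> walks R. R \<theta> (hd w) \<and> first_return \<theta> w}"

definition C :: "rule \<Rightarrow> step \<Rightarrow> real \<Rightarrow> real \<Rightarrow> real \<Rightarrow> real" where
  "C R \<theta> = gen_fun {w \<in> walks R. hd w \<noteq> South \<and> first_return \<theta> w}"

definition D :: "rule \<Rightarrow> step \<Rightarrow> real \<Rightarrow> real \<Rightarrow> real \<Rightarrow> real" where
  "D R \<theta> = gen_fun {w \<in> walks R. hd w = South \<and> first_return \<theta> w}"

definition deriv_t :: "(real \<Rightarrow> real \<Rightarrow> real \<Rightarrow> real) \<Rightarrow> real \<Rightarrow> real \<Rightarrow> real \<Rightarrow> real" where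
  "deriv_t F t x y = deriv (\<lambda>s. F s x y) t"

definition deriv_y :: "(real \<Rightarrow> real \<Rightarrow> real \<Rightarrow> real) \<Rightarrow> real \<Rightarrow> real \<Rightarrow> real \<Rightarrow> real" where
  "deriv_y F t x y = deriv (\<lambda>z. F t x z) y"

definition half_walks :: "rule \<Rightarrow> step \<Rightarrow> walk set" where
  "half_walks R \<theta> = {w \<in> walks R. last w = \<theta> \<and> (\<forall>k\<le>length w. end_y (take k w) \<ge> 0)}"

definition half_coeff :: "rule \<Rightarrow> step \<Rightarrow> real \<Rightarrow> real \<Rightarrow> nat \<Rightarrow> real" where
  "half_coeff R \<theta> x y m =
     (\<Sum>w | w \<in> half_walks R \<theta> \<and> length w = m. x powi end_x w * y powi end_y w)"

definition H :: "rule \<Rightarrow> step \<Rightarrow> complex \<Rightarrow> real \<Rightarrow> real \<Rightarrow> complex" where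
  "H R \<theta> t x y = (\<Sum>m. of_real (half_coeff R \<theta> x y m) * t ^ m)"

text \<open>The number \<open>\<rho>(x,y)\<close> is the least positive solution of \<open>B\<^sub>\<theta>(t;x,y) = 1\<close>, the same for
  every step \<open>\<theta>\<close>.\<close>

definition rho :: "rule \<Rightarrow> real \<Rightarrow> real \<Rightarrow> real" where
  "rho R x y = (THE r. \<forall>\<theta>. 0 < r \<and> B R \<theta> r x y = 1 \<and> (\<forall>t. 0 < t \<and> B R \<theta> t x y = 1 \<longrightarrow> r \<le> t))"

definition mu :: "rule \<Rightarrow> real \<Rightarrow> real \<Rightarrow> real" where
  "mu R x y = 1 / rho R x y"

definition mu_yy :: "rule \<Rightarrow> real \<Rightarrow> real \<Rightarrow> real" where
  "mu_yy R x y = (deriv ^^ 2) (mu R x) y"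

definition drift_y :: "rule \<Rightarrow> step \<Rightarrow> real \<Rightarrow> real \<Rightarrow> real" where
  "drift_y R \<theta> x y =
     deriv_y (B R \<theta>) (rho R x y) x y / (rho R x y * deriv_t (B R \<theta>) (rho R x y) x y)"

definition tau :: "rule \<Rightarrow> real \<Rightarrow> real" where
  "tau R x = (THE y. 0 < y \<and> (rho R x has_real_derivative 0) (at y))"

definition kappa :: "rule \<Rightarrow> real \<Rightarrow> real" where
  "kappa R x = rho R x (tau R x)"

definition c0 :: "rule \<Rightarrow> step \<Rightarrow> real \<Rightarrow> real" where
  "c0 R \<theta> x =
     (let k = kappa R x; y = tau R x in
        sqrt (2 / (k * mu_yy R x y)) * (1 / (k * deriv_t (B R \<theta>) k x y))
        * (deriv_y (C R \<theta>) k x y - deriv_y (D R \<theta>) k x y * (C R \<theta> k x y / D R \<theta> k x y)))"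

end

theory Submission
  imports Defs "HOL-Real_Asymp.Real_Asymp"
begin

text \<open>
Fix \<open>x\<close> and use the logarithmic variables \<open>s = ln t\<close> and \<open>u = ln y\<close>, so that a walk \<open>w\<close> of height
\<open>h\<close> has weight \<open>x^a exp (|w| s + h u)\<close>. Let \<open>M s u\<close> be the matrix of the weights of the second step over
all allowed pairs. Everything rests on its Perron data: for each \<open>u\<close> there is one \<open>s = lnrho u\<close> for which
\<open>M s u\<close> has eigenvalue 1 with positive right and left eigenvectors \<open>v u\<close> and \<open>l u\<close>.

Conjugated by \<open>v u\<close>, the matrix is the transition matrix of a finite irreducible Markov chain, which
reaches every state almost surely. Hence \<open>B\<close> equals 1 there, \<open>rho R x (exp u) = exp (lnrho u)\<close>
(\<open>rho_exp\<close>), and the first-passage generating functions are ratios of entries of \<open>v u\<close>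
(\<open>hit_lnrho\<close>). They still converge slightly beyond (\<open>summable_beyond\<close>), so they are smooth there and the
implicit function theorem gives the derivatives of \<open>lnrho\<close>. Geometric means of eigenvectors show that
\<open>lnrho\<close> is concave, and vertical unboundedness makes it tend to minus infinity in both directions; its
only critical point \<open>u0 = ln (tau R x)\<close> is a maximum with negative second derivative. There the drift is 0.

For half-plane walks, weight the last step by \<open>v u\<close> and multiply by \<open>rho^m\<close>: the resulting \<open>mass u m\<close>
is a survival probability up to a factor. It decreases with \<open>m\<close>, and what it loses at a step is the
weight of the walks that end on the axis and continue with a south step. Such walks have height 0, so up to a
factor their weight depends on \<open>u\<close> only through \<open>t\<close>. If \<open>u < u0\<close>, then the mass tends to 0, hence the losses sum to the initial
mass; this evaluates the excursion series at \<open>t = rho (exp u)\<close> as \<open>exc_gf u = C / D\<close>. Near \<open>u0\<close> the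
function \<open>exc_gf\<close> is differentiable with positive derivative while \<open>rho\<close> has a quadratic maximum, which
makes the excursion series have a square-root singularity and
\<open>\<Sum> mass u0 (n + 1) r^n \<sim> amplitude (1 - r)^(-1/2)\<close> as \<open>r\<close> increases to 1 (\<open>mass_abelian\<close>).

This is information on a real interval only. Because the mass is monotone, it suffices: a Tauberian theorem of
Karamata's type (\<open>monotone_tauberian\<close>) gives \<open>mass u0 (n + 1) \<sim> amplitude / sqrt (pi n)\<close>, and an Abelian
theorem (\<open>monotone_abelian_disc\<close>) then gives the behaviour of the series in the whole complex disc near 1.
Further singularities on the circle, which are possible if for instance the length and the height of every closed
walk have the same parity, need no analysis.

It remains to pass from the mass to a prescribed last step \<open>\<theta>\<close>. By Doeblin's contraction the chain
forgets its past geometrically fast, so \<open>surv u0 m \<theta>\<close> deviates from \<open>inv_law \<theta> * mass u0 m\<close> by an amount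
that is summable and \<open>o (1 / sqrt m)\<close> (\<open>deviation_facts\<close>). Kac's formula, that the mean return length to \<open>\<theta>\<close> is
\<open>1 / inv_law \<theta>\<close> (\<open>mean_return_length\<close>), turns the constant into \<open>c0\<close> (\<open>c0_eq\<close>).
\<close>

section \<open>A Tauberian and an Abelian theorem for monotone coefficients\<close>

lemma mult_power_less_one:
  fixes r :: real assumes "0 < r" "r < 1" shows "r * r ^ k < 1"
  using power_Suc_less_one[of r k] assms by simp

text \<open>The coefficients of \<open>(1 - z)^(-1/2)\<close>. They are the explicit decreasing sequence with which
other sequences are compared below.\<close>

definition inv_sqrt_coeff :: "nat \<Rightarrow> real" where
  "inv_sqrt_coeff n = (-1) ^ n * ((-1/2) gchoose n)"

lemma inv_sqrt_coeff_Suc: "inv_sqrt_coeff (Suc n) = inv_sqrt_coeff n * ((2 * n + 1) / (2 * n + 2))"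
proof -
  have *: "(-1/2 :: real) gchoose Suc n = (-1/2 gchoose n) * ((-1/2 - n) / (n + 1))"
    by (simp add: gbinomial_prod_rev field_simps)
  have "(-1/2 - real n) / real (n + 1) = - ((2 * n + 1) / (2 * n + 2))"
    by (simp add: field_simps)
  then show ?thesis
    unfolding inv_sqrt_coeff_def * by (simp add: add_ac)
qed

lemma inv_sqrt_coeff_pos: "inv_sqrt_coeff n > 0"
  by (induction n) (auto simp: inv_sqrt_coeff_Suc inv_sqrt_coeff_def[of 0])

lemma decseq_inv_sqrt_coeff: "decseq inv_sqrt_coeff"
proof (rule decseq_SucI)
  fix n
  have "inv_sqrt_coeff n * ((2 * n + 1) / (2 * n + 2)) \<le> inv_sqrt_coeff n * 1"
    using inv_sqrt_coeff_pos[of n] by (intro mult_left_mono) auto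
  then show "inv_sqrt_coeff (Suc n) \<le> inv_sqrt_coeff n"
    by (simp add: inv_sqrt_coeff_Suc)
qed

text \<open>Euler's limit for the Gamma function at \<open>1/2\<close>, where \<open>Gamma (1/2) = sqrt pi\<close>.\<close>

lemma inv_sqrt_coeff_asymptotic: "(\<lambda>n. sqrt n * inv_sqrt_coeff n) \<longlonglongrightarrow> 1 / sqrt pi"
proof -
  have "(\<lambda>n. (-1/2 gchoose n) / ((-1)^n / exp ((-1/2+1) * of_real (ln (real n))))) \<longlonglongrightarrow> inverse (Gamma (1/2::real))"
    using gbinomial_asymptotic[of "-1/2::real"] by simp
  then have "(\<lambda>n. (-1/2 gchoose n) / ((-1)^n / exp ((-1/2+1) * of_real (ln (real n))))) \<longlonglongrightarrow> 1 / sqrt pi"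
    by (simp add: Gamma_one_half_real inverse_eq_divide)
  moreover have "eventually (\<lambda>n. (-1/2 gchoose n) / ((-1)^n / exp ((-1/2+1) * of_real (ln (real n))))
     = sqrt n * inv_sqrt_coeff n) sequentially"
    using eventually_gt_at_top[of 0]
  proof eventually_elim
    case (elim n)
    have "exp ((1/2) * ln (real n)) = sqrt n"
      using elim by (simp add: powr_half_sqrt[symmetric] powr_def)
    then show ?case
      by (cases "even n") (simp_all add: inv_sqrt_coeff_def)
  qed
  ultimately show ?thesis
    by (rule Lim_transform_eventually)
qed

lemma inv_sqrt_coeff_sums_complex:
  fixes z :: complex assumes "norm z < 1"
  shows "(\<lambda>n. of_real (inv_sqrt_coeff n) * z ^ n) sums (1 - z) powr (-1/2)"
proof -
  have "(\<lambda>n. ((-1/2) gchoose n) * (-z)^n) sums (1 + (-z)) powr (-1/2)"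
    by (rule gen_binomial_complex) (use assms in simp)
  moreover have "((-1/2) gchoose n) * (-z)^n = of_real (inv_sqrt_coeff n) * z ^ n" for n
  proof -
    have "of_real ((-1/2) gchoose n) = (((-1/2) gchoose n) :: complex)"
      by (simp add: gbinomial_prod_rev)
    then show ?thesis
      unfolding inv_sqrt_coeff_def by (simp add: power_minus[of z])
  qed
  ultimately show ?thesis by simp
qed

lemma inv_sqrt_coeff_sums_real:
  fixes z :: real assumes "\<bar>z\<bar> < 1"
  shows "(\<lambda>n. inv_sqrt_coeff n * z ^ n) sums (1 / sqrt (1 - z))"
proof -
  have "(\<lambda>n. ((-1/2) gchoose n) * (-z)^n) sums (1 + (-z)) powr (-1/2)"
    by (rule gen_binomial_real) (use assms in simp)
  moreover have "((-1/2) gchoose n) * (-z)^n = inv_sqrt_coeff n * z ^ n" for n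
    unfolding inv_sqrt_coeff_def by (simp add: power_minus[of z])
  moreover have "(1 + (-z)) powr (-1/2) = 1 / sqrt (1 - z)"
    using assms by (simp add: powr_minus_divide powr_half_sqrt)
  ultimately show ?thesis by simp
qed

lemma summable_bounded_power:
  fixes a :: "nat \<Rightarrow> real" and z :: "'a :: {real_normed_field, banach}"
  assumes "\<And>n. \<bar>a n\<bar> \<le> K" "norm z < 1"
  shows "summable (\<lambda>n. of_real (a n) * z ^ n)"
proof (rule summable_comparison_test)
  show "\<exists>N. \<forall>n\<ge>N. norm (of_real (a n) * z ^ n) \<le> K * norm z ^ n"
    using assms by (auto simp: norm_mult norm_power intro!: mult_right_mono)
  show "summable (\<lambda>n. K * norm z ^ n)"
    using assms by (intro summable_mult summable_geometric) auto
qed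

lemma summable_bounded_power_real:
  fixes a :: "nat \<Rightarrow> real"
  assumes "\<And>n. \<bar>a n\<bar> \<le> K" "\<bar>z\<bar> < 1"
  shows "summable (\<lambda>n. a n * z ^ n)"
  using summable_bounded_power[of a K z] assms by simp

lemma decseq_nonneg_abs_le:
  assumes "decseq a" "\<And>n. 0 \<le> a n" shows "\<bar>a n\<bar> \<le> (a 0 :: real)"
  using assms by (auto simp: decseq_def)

lemma filterlim_power_at_left_1: 
  "filterlim (\<lambda>r::real. r ^ Suc k) (at_left 1) (at_left 1)"
proof -
  have "((\<lambda>r::real. r ^ Suc k) \<longlongrightarrow> 1 ^ Suc k) (at_left 1)"
    by (intro tendsto_intros)
  moreover have "eventually (\<lambda>r::real. r ^ Suc k \<in> {..<1}) (at_left 1)"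
    using eventually_at_left_real[of 0 1, simplified]
    by eventually_elim (auto simp: mult_power_less_one)
  ultimately show ?thesis
    by (auto simp: filterlim_at elim: eventually_mono)
qed

text \<open>The test functional of Karamata's method: as \<open>r\<close> tends to 1, the values \<open>f (r ^ n)\<close> single out the
indices \<open>n\<close> of order \<open>1 / (1 - r)\<close>, for which \<open>d\<close> must be small in the mean.\<close>

definition abel_negligible :: "(nat \<Rightarrow> real) \<Rightarrow> (real \<Rightarrow> real) \<Rightarrow> bool" where
  "abel_negligible d f \<longleftrightarrow> ((\<lambda>r. sqrt (1 - r) * (\<Sum>n. d n * r ^ n * f (r ^ n))) \<longlongrightarrow> 0) (at_left 1)"

text \<open>A test function \<open>x ^ k\<close> only replaces \<open>r\<close> by \<open>r ^ (k + 1)\<close>, which also tends to 1.\<close>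

lemma abel_negligible_monomial:
  assumes "((\<lambda>r. sqrt (1 - r) * (\<Sum>n. d n * r ^ n)) \<longlongrightarrow> 0) (at_left 1)"
  shows "abel_negligible d (\<lambda>x. x ^ k)"
proof -
  define F where "F r = sqrt (1 - r) * (\<Sum>n. d n * r ^ n)" for r
  have F: "((\<lambda>r. F (r ^ Suc k)) \<longlongrightarrow> 0) (at_left 1)"
    using filterlim_compose[OF assms filterlim_power_at_left_1] unfolding F_def .
  show ?thesis unfolding abel_negligible_def
  proof (rule Lim_null_comparison[OF _ tendsto_norm_zero[OF F]])
    show "eventually (\<lambda>r. norm (sqrt (1 - r) * (\<Sum>n. d n * r ^ n * (r ^ n) ^ k)) \<le> norm (F (r ^ Suc k))) (at_left 1)"
      using eventually_at_left_real[of 0 1, simplified]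
    proof eventually_elim
      case (elim r)
      have *: "r ^ n * (r ^ n) ^ k = (r ^ Suc k) ^ n" for n
        by (simp add: power_mult[symmetric] power_add[symmetric] algebra_simps)
      have "r ^ Suc k \<le> r"
        using elim by (simp add: mult_left_le power_le_one)
      then have "sqrt (1 - r) \<le> sqrt (1 - r ^ Suc k)" by simp
      then show ?case
        using elim unfolding F_def * mult.assoc norm_mult
        by (intro mult_right_mono) (auto intro: order_trans[OF _ abs_ge_self])
    qed
  qed
qed

lemma abel_negligible_polynomial:
  assumes "((\<lambda>r. sqrt (1 - r) * (\<Sum>n. d n * r ^ n)) \<longlongrightarrow> 0) (at_left 1)"
    and bd: "\<And>n. \<bar>d n\<bar> \<le> K"
  shows "abel_negligible d (\<lambda>x. \<Sum>i\<le>m. c i * x ^ i)"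
proof -
  have lim: "((\<lambda>r. \<Sum>i\<le>m. c i * (sqrt (1 - r) * (\<Sum>n. d n * r ^ n * (r ^ n) ^ i))) \<longlongrightarrow> (\<Sum>i\<le>m. c i * 0)) (at_left 1)"
    using abel_negligible_monomial[OF assms(1)] unfolding abel_negligible_def
    by (intro tendsto_intros)
  have "eventually (\<lambda>r. (\<Sum>i\<le>m. c i * (sqrt (1 - r) * (\<Sum>n. d n * r ^ n * (r ^ n) ^ i)))
      = sqrt (1 - r) * (\<Sum>n. d n * r ^ n * (\<Sum>i\<le>m. c i * (r ^ n) ^ i))) (at_left 1)"
    using eventually_at_left_real[of 0 1, simplified]
  proof eventually_elim
    case (elim r)
    have sm: "summable (\<lambda>n. d n * r ^ n * (r ^ n) ^ i)" for i
    proof -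
      have "summable (\<lambda>n. d n * (r ^ Suc i) ^ n)"
        using elim by (intro summable_bounded_power_real[OF bd]) (simp add: mult_power_less_one)
      moreover have "d n * (r ^ Suc i) ^ n = d n * r ^ n * (r ^ n) ^ i" for n
        by (simp add: power_mult[symmetric] power_add[symmetric] algebra_simps)
      ultimately show ?thesis by (simp only:)
    qed
    have "(\<Sum>n. \<Sum>i\<le>m. c i * (d n * r ^ n * (r ^ n) ^ i)) = (\<Sum>i\<le>m. \<Sum>n. c i * (d n * r ^ n * (r ^ n) ^ i))"
      by (intro suminf_sum summable_mult sm)
    moreover have "(\<Sum>n. c i * (d n * r ^ n * (r ^ n) ^ i)) = c i * (\<Sum>n. d n * r ^ n * (r ^ n) ^ i)" for i
      by (rule suminf_mult[OF sm])
    moreover have "d n * r ^ n * (\<Sum>i\<le>m. c i * (r ^ n) ^ i) = (\<Sum>i\<le>m. c i * (d n * r ^ n * (r ^ n) ^ i))" for n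
      by (simp add: sum_distrib_left mult_ac)
    ultimately show ?case
      by (simp add: sum_distrib_left mult_ac)
  qed
  from Lim_transform_eventually[OF lim this] show ?thesis
    by (simp add: abel_negligible_def)
qed

text \<open>By Weierstrass, a continuous test function is a uniform limit of polynomials; the
error is controlled by \<open>\<Sum> (a n + b n) r ^ n\<close>, which is \<open>O ((1 - r) powr (-1/2))\<close>.\<close>

lemma abel_negligible_continuous:
  fixes a b :: "nat \<Rightarrow> real"
  assumes a: "\<And>n. 0 \<le> a n" "\<And>n. a n \<le> K" and b: "\<And>n. 0 \<le> b n" "\<And>n. b n \<le> K"
    and lim: "((\<lambda>r. sqrt (1 - r) * (\<Sum>n. (a n - b n) * r ^ n)) \<longlongrightarrow> 0) (at_left 1)"
    and bdd: "eventually (\<lambda>r. sqrt (1 - r) * (\<Sum>n. b n * r ^ n) \<le> L) (at_left 1)"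
    and f: "continuous_on {0..1} f"
  shows "abel_negligible (\<lambda>n. a n - b n) f"
  unfolding abel_negligible_def
proof (rule tendstoI)
  fix e :: real assume "e > 0"
  define e' where "e' = e / 2 / (2 * \<bar>L\<bar> + 1)"
  have e': "e' > 0" "e' * (2 * \<bar>L\<bar> + 1) = e / 2" using \<open>e > 0\<close> by (auto simp: e'_def add_pos_nonneg divide_simps)
  obtain g where "real_polynomial_function g" and g: "\<And>x. x \<in> {0..1} \<Longrightarrow> \<bar>f x - g x\<bar> < e'"
    using Stone_Weierstrass_real_polynomial_function[OF compact_Icc f e'(1)] by blast
  then obtain c m where gc: "g = (\<lambda>x. \<Sum>i\<le>m. c i * x ^ i)"
    using real_polynomial_function_iff_sum by blast
  define d where "d n = a n - b n" for n
  have dK: "\<bar>d n\<bar> \<le> K" for n using a[of n] b[of n] unfolding d_def by linarith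
  have "abel_negligible d g" unfolding gc
    by (rule abel_negligible_polynomial[OF _ dK]) (use lim d_def in simp)
  then have 1: "eventually (\<lambda>r. \<bar>sqrt (1 - r) * (\<Sum>n. d n * r ^ n * g (r ^ n))\<bar> < e / 2) (at_left 1)"
    using \<open>e > 0\<close> unfolding abel_negligible_def
    by (auto simp: tendsto_iff dist_real_def dest: spec[of _ "e/2"])
  have 2: "eventually (\<lambda>r. \<bar>sqrt (1 - r) * (\<Sum>n. d n * r ^ n)\<bar> < 1) (at_left 1)"
    using lim unfolding d_def by (auto simp: tendsto_iff dist_real_def dest: spec[of _ 1])
  show "eventually (\<lambda>r. dist (sqrt (1 - r) * (\<Sum>n. (a n - b n) * r ^ n * f (r ^ n))) 0 < e) (at_left 1)"
    using 1 2 bdd eventually_at_left_real[of 0 1, simplified]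
  proof eventually_elim
    case (elim r)
    have r: "0 < r" "r < 1" "\<bar>r\<bar> < 1" "r ^ n \<in> {0..1}" for n using elim by (auto simp: power_le_one)
    have sa: "summable (\<lambda>n. a n * r ^ n)" and sb: "summable (\<lambda>n. b n * r ^ n)"
      using a b r by (auto intro!: summable_bounded_power_real[of _ K])
    obtain G where G: "\<And>x. x \<in> {0..1} \<Longrightarrow> \<bar>g x\<bar> \<le> G"
    proof -
      have "continuous_on {0..1} g" unfolding gc by (intro continuous_intros)
      then have "bounded (g ` {0..1})" by (intro compact_imp_bounded compact_continuous_image) auto
      then obtain G' where "\<forall>y\<in>g ` {0..1}. norm y \<le> G'" unfolding bounded_iff by blast
      then show ?thesis using that[of G'] by auto
    qed
    have sg: "summable (\<lambda>n. d n * r ^ n * g (r ^ n))"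
    proof -
      have "\<bar>d n * g (r ^ n)\<bar> \<le> K * G" for n
        unfolding abs_mult using dK[of n] G[OF r(4)] by (intro mult_mono) auto
      then have "summable (\<lambda>n. (d n * g (r ^ n)) * r ^ n)"
        using r by (intro summable_bounded_power_real)
      then show ?thesis by (simp add: mult_ac)
    qed
    have diff: "norm (d n * r ^ n * (f (r ^ n) - g (r ^ n))) \<le> e' * (a n * r ^ n + b n * r ^ n)" for n
    proof -
      have "\<bar>d n\<bar> * r ^ n * \<bar>f (r ^ n) - g (r ^ n)\<bar> \<le> (a n + b n) * r ^ n * e'"
        using g[OF r(4), of n] a(1)[of n] b(1)[of n] r unfolding d_def by (intro mult_mono) auto
      moreover have "norm (d n * r ^ n * (f (r ^ n) - g (r ^ n))) = \<bar>d n\<bar> * r ^ n * \<bar>f (r ^ n) - g (r ^ n)\<bar>"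
        using r by (simp add: abs_mult)
      ultimately show ?thesis by (simp only: algebra_simps)
    qed
    have s3: "summable (\<lambda>n. e' * (a n * r ^ n + b n * r ^ n))"
      by (intro summable_mult summable_add sa sb)
    have sfg: "summable (\<lambda>n. d n * r ^ n * (f (r ^ n) - g (r ^ n)))"
      by (rule summable_comparison_test[OF _ s3]) (use diff in auto)
    have "\<bar>\<Sum>n. d n * r ^ n * (f (r ^ n) - g (r ^ n))\<bar> \<le> (\<Sum>n. e' * (a n * r ^ n + b n * r ^ n))"
      using norm_suminf_le[OF diff s3] by simp
    also have "\<dots> = e' * ((\<Sum>n. d n * r ^ n) + 2 * (\<Sum>n. b n * r ^ n))"
    proof -
      have "(\<Sum>n. d n * r ^ n) = (\<Sum>n. a n * r ^ n) - (\<Sum>n. b n * r ^ n)"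
        using suminf_diff[OF sa sb] by (simp add: d_def algebra_simps)
      then show ?thesis
        using suminf_mult[OF summable_add[OF sa sb], of e'] suminf_add[OF sa sb] by simp
    qed
    finally have A: "\<bar>\<Sum>n. d n * r ^ n * (f (r ^ n) - g (r ^ n))\<bar> \<le> e' * ((\<Sum>n. d n * r ^ n) + 2 * (\<Sum>n. b n * r ^ n))" .
    have "\<bar>sqrt (1 - r) * (\<Sum>n. d n * r ^ n * (f (r ^ n) - g (r ^ n)))\<bar>
        \<le> e' * (sqrt (1 - r) * (\<Sum>n. d n * r ^ n) + 2 * (sqrt (1 - r) * (\<Sum>n. b n * r ^ n)))"
      using mult_left_mono[OF A, of "sqrt (1 - r)"] r by (simp add: abs_mult algebra_simps)
    also have "\<dots> \<le> e' * (2 * \<bar>L\<bar> + 1)"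
      using elim(2,3) e' by (intro mult_left_mono) auto
    finally have B: "\<bar>sqrt (1 - r) * (\<Sum>n. d n * r ^ n * (f (r ^ n) - g (r ^ n)))\<bar> \<le> e / 2"
      using e' by simp
    have "(\<Sum>n. d n * r ^ n * f (r ^ n)) = (\<Sum>n. d n * r ^ n * (f (r ^ n) - g (r ^ n))) + (\<Sum>n. d n * r ^ n * g (r ^ n))"
      using suminf_add[OF sfg sg] by (simp add: algebra_simps)
    then show ?case
      using elim(1) B by (simp add: d_def[symmetric] dist_real_def distrib_left)
  qed
qed

text \<open>If two decreasing sequences have the same Abel means up to
\<open>o ((1 - r) powr (-1/2))\<close>, then \<open>a\<close> at an index beyond \<open>(1 + \<delta>) N\<close> hardly exceeds \<open>b\<close> at \<open>N\<close>: otherwise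
\<open>a\<close> would exceed \<open>b\<close> on the whole window between them, which a bump-shaped test function
detects.\<close>

lemma monotone_abelian_comparison:
  fixes a b :: "nat \<Rightarrow> real" and \<delta> \<epsilon> :: real
  assumes a: "decseq a" "\<And>n. 0 \<le> a n" and b: "decseq b" "\<And>n. 0 \<le> b n"
    and lim: "((\<lambda>r. sqrt (1 - r) * (\<Sum>n. (a n - b n) * r ^ n)) \<longlongrightarrow> 0) (at_left 1)"
    and bdd: "eventually (\<lambda>r. sqrt (1 - r) * (\<Sum>n. b n * r ^ n) \<le> L) (at_left 1)"
    and pos: "\<delta> > 0" "\<epsilon> > 0"
  shows "\<forall>\<^sub>F N in sequentially. \<forall>n. (1 + \<delta>) * N \<le> n \<longrightarrow> sqrt N * (a n - b N) \<le> \<epsilon>"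
proof -
  \<comment> \<open>For \<open>r = exp (- 1 / N)\<close> the bump is supported on the powers \<open>r ^ m\<close> with \<open>N < m < (1 + \<delta>) N\<close>.\<close>
  define f where "f x = max 0 ((exp (-1) - x) * (x - exp (- (1 + \<delta>))))" for x :: real
  define d where "d n = a n - b n" for n
  define r where "r N = exp (- 1 / real N)" for N
  define E where "E N = (\<Sum>n. d n * r N ^ n * f (r N ^ n))" for N
  define X where "X N = (\<Sum>n. r N ^ n * f (r N ^ n))" for N
  define K where "K = max (a 0) (b 0)"
  have K: "a n \<le> K" "b n \<le> K" for n
    using decseqD[OF a(1), of 0 n] decseqD[OF b(1), of 0 n] by (auto simp: K_def)
  have neg: "abel_negligible d f"
    unfolding d_def
    by (rule abel_negligible_continuous[of _ K _ L]) (use a b K lim bdd in \<open>auto simp: f_def intro!: continuous_intros\<close>)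
  have r_lim: "filterlim r (at_left 1) sequentially"
  proof -
    have "r \<longlonglongrightarrow> 1" unfolding r_def by real_asymp
    moreover have "eventually (\<lambda>N. r N \<in> {..<1}) sequentially"
      using eventually_gt_at_top[of 0] by eventually_elim (auto simp: r_def)
    ultimately show ?thesis by (auto simp: filterlim_at elim: eventually_mono)
  qed
  have E_lim: "(\<lambda>N. sqrt (1 - r N) * E N) \<longlonglongrightarrow> 0"
    using filterlim_compose[OF neg[unfolded abel_negligible_def] r_lim] by (simp add: E_def)
  \<comment> \<open>A lower bound of \<open>r ^ m * f (r ^ m)\<close> for \<open>m\<close> in the middle third of the window.\<close>
  define \<eta> where "\<eta> = exp (- (1 + \<delta>)) * ((exp (-1) - exp (- (1 + \<delta>/3))) * (exp (- (1 + 2*\<delta>/3)) - exp (- (1 + \<delta>))))"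
  have "\<eta> > 0" unfolding \<eta>_def using pos by (intro mult_pos_pos) auto
  have f_nonneg: "f x \<ge> 0" for x by (simp add: f_def)
  have f_bd: "\<bar>f x\<bar> \<le> 1" if "x \<in> {0..1}" for x
  proof -
    have "\<bar>exp (-1) - x\<bar> * \<bar>x - exp (- (1 + \<delta>))\<bar> \<le> 1 * 1"
    proof (rule mult_mono)
      have "exp (-1) \<le> (1::real)" "exp (- (1 + \<delta>)) \<le> 1" "exp (-1) > (0::real)" "exp (- (1 + \<delta>)) > 0"
        using pos by auto
      then show "\<bar>exp (-1) - x\<bar> \<le> 1" "\<bar>x - exp (- (1 + \<delta>))\<bar> \<le> 1"
        using that unfolding atLeastAtMost_iff by linarith+
    qed auto
    then have "\<bar>(exp (-1) - x) * (x - exp (- (1 + \<delta>)))\<bar> \<le> 1"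
      by (simp add: abs_mult)
    then show ?thesis unfolding f_def by linarith
  qed
  have rpow: "r N ^ m = exp (- real m / real N)" for N m
    by (simp add: r_def exp_of_nat_mult[symmetric])
  have r01: "r N ^ m \<in> {0..1}" for N m by (simp add: rpow divide_nonneg_nonneg)
  have r_lt: "\<bar>r N\<bar> < 1" if "N > 0" for N using that by (simp add: r_def)
  have sX: "summable (\<lambda>m. r N ^ m * f (r N ^ m))" if "N > 0" for N
    using summable_bounded_power_real[of "\<lambda>m. f (r N ^ m)" 1 "r N"] f_bd[OF r01] r_lt[OF that]
    by (simp add: mult.commute)
  have f_supp: "N < m \<and> m < (1 + \<delta>) * N" if "f (r N ^ m) \<noteq> 0" "N > 0" for N m :: nat
  proof -
    have "(exp (-1) - r N ^ m) * (r N ^ m - exp (- (1 + \<delta>))) > 0"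
      using that(1) unfolding f_def by linarith
    then have "(exp (-1) - r N ^ m > 0 \<and> r N ^ m - exp (- (1 + \<delta>)) > 0) \<or>
        (exp (-1) - r N ^ m < 0 \<and> r N ^ m - exp (- (1 + \<delta>)) < 0)"
      unfolding zero_less_mult_iff .
    moreover have "exp (-(1+\<delta>)) < exp (-1)" using pos by simp
    ultimately have "r N ^ m < exp (-1)" "exp (- (1 + \<delta>)) < r N ^ m"
      by linarith+
    then have "1 < m / N" "m / N < 1 + \<delta>"
      unfolding rpow exp_less_cancel_iff by auto
    then show ?thesis using that by (simp add: field_simps)
  qed
  have X_ge: "X N \<ge> \<eta> * (\<delta>/3 * N - 1)" if "N > 0" for N
  proof -
    define I where "I = {nat \<lceil>(1 + \<delta>/3) * N\<rceil>..nat \<lfloor>(1 + 2*\<delta>/3) * N\<rfloor>}"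
    have "real_of_int \<lfloor>(1 + 2*\<delta>/3) * N\<rfloor> \<ge> (1 + 2*\<delta>/3) * N - 1" "real_of_int \<lceil>(1 + \<delta>/3) * N\<rceil> \<le> (1 + \<delta>/3) * N + 1"
      by linarith+
    moreover have "\<lfloor>(1 + 2*\<delta>/3) * N\<rfloor> \<ge> 0" "\<lceil>(1 + \<delta>/3) * N\<rceil> \<ge> 0"
    proof -
      have "0 \<le> (1 + 2*\<delta>/3) * N" "0 \<le> (1 + \<delta>/3) * N" using pos by auto
      then show "\<lfloor>(1 + 2*\<delta>/3) * N\<rfloor> \<ge> 0" "\<lceil>(1 + \<delta>/3) * N\<rceil> \<ge> 0" by linarith+
    qed
    ultimately have "card I \<ge> \<delta>/3 * N - 1"
      unfolding I_def by (simp add: of_nat_diff algebra_simps nat_le_iff)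
    then have "\<eta> * (\<delta>/3 * N - 1) \<le> \<eta> * card I" using \<open>\<eta> > 0\<close> by simp
    also have "\<dots> = (\<Sum>m\<in>I. \<eta>)" by simp
    also have "\<dots> \<le> (\<Sum>m\<in>I. r N ^ m * f (r N ^ m))"
    proof (rule sum_mono)
      fix m assume "m \<in> I"
      then have "(1 + \<delta>/3) * N \<le> m" "m \<le> (1 + 2*\<delta>/3) * N"
        using pos by (auto simp: I_def nat_le_iff le_nat_iff) linarith+
      then have m: "(1 + \<delta>/3) \<le> m / N" "m / N \<le> 1 + 2*\<delta>/3"
        using that by (auto simp: field_simps)
      have "\<eta> \<le> r N ^ m * ((exp (-1) - r N ^ m) * (r N ^ m - exp (- (1 + \<delta>))))"
        unfolding \<eta>_def rpow using m pos by (intro mult_mono diff_mono mult_nonneg_nonneg) auto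
      also have "\<dots> \<le> r N ^ m * f (r N ^ m)"
        using r01[of N m] by (intro mult_left_mono) (auto simp: f_def)
      finally show "\<eta> \<le> r N ^ m * f (r N ^ m)" .
    qed
    also have "\<dots> \<le> X N" unfolding X_def
      by (rule sum_le_suminf[OF sX[OF that]]) (use r01 f_nonneg in \<open>auto simp: I_def\<close>)
    finally show ?thesis .
  qed
  have key: "(a n - b N) * X N \<le> E N" if "N > 0" "(1 + \<delta>) * N \<le> n" for N n :: nat
  proof -
    have sE: "summable (\<lambda>m. d m * r N ^ m * f (r N ^ m))"
    proof -
      have "\<bar>d m * f (r N ^ m)\<bar> \<le> K * 1" for m
        unfolding abs_mult using a(2)[of m] b(2)[of m] K[of m] f_bd[OF r01, of N m]
        by (intro mult_mono) (auto simp: d_def)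
      then have "summable (\<lambda>m. (d m * f (r N ^ m)) * r N ^ m)"
        using r_lt[OF that(1)] by (intro summable_bounded_power_real)
      then show ?thesis by (simp add: mult_ac)
    qed
    have "(a n - b N) * X N = (\<Sum>m. (a n - b N) * (r N ^ m * f (r N ^ m)))"
      unfolding X_def by (rule suminf_mult[OF sX[OF that(1)], symmetric])
    also have "\<dots> \<le> E N" unfolding E_def
    proof (rule suminf_le[OF _ summable_mult[OF sX[OF that(1)]] sE])
      fix m
      show "(a n - b N) * (r N ^ m * f (r N ^ m)) \<le> d m * r N ^ m * f (r N ^ m)"
      proof (cases "f (r N ^ m) = 0")
        case False
        then have "N < m" "m \<le> n" using f_supp[OF False that(1)] that(2) by linarith+
        then have "a n - b N \<le> d m"
          using decseqD[OF a(1), of m n] decseqD[OF b(1), of N m] by (simp add: d_def)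
        then show ?thesis using f_nonneg[of "r N ^ m"] r01[of N m]
          unfolding mult.assoc by (intro mult_right_mono) auto
      qed simp
    qed
    finally show ?thesis .
  qed
  define c where "c = \<eta> * \<delta> / 6"
  have "c > 0" using \<open>\<eta> > 0\<close> pos by (simp add: c_def)
  have "eventually (\<lambda>N. \<bar>sqrt (1 - r N) * E N\<bar> < \<epsilon> * c / 2) sequentially"
    using E_lim \<open>c > 0\<close> pos unfolding tendsto_iff dist_real_def by (auto dest!: spec[of _ "\<epsilon> * c / 2"])
  moreover have "eventually (\<lambda>N::nat. N \<ge> 6 / \<delta> \<and> N > 0) sequentially"
    using eventually_ge_at_top[of "nat \<lceil>6 / \<delta>\<rceil>"] eventually_gt_at_top[of 0]
    by eventually_elim (auto simp: nat_le_iff ceiling_le_iff)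
  ultimately show ?thesis
  proof eventually_elim
    case (elim N)
    show ?case
    proof (intro allI impI)
      fix n :: nat assume n: "(1 + \<delta>) * N \<le> n"
      show "sqrt N * (a n - b N) \<le> \<epsilon>"
      proof (cases "a n - b N \<le> 0")
        case True
        then have "sqrt N * (a n - b N) \<le> 0" by (intro mult_nonneg_nonpos) auto
        then show ?thesis using pos by linarith
      next
        case False
        have "c * N \<le> X N"
        proof -
          have "1 \<le> \<delta> / 6 * N" using elim pos by (simp add: field_simps)
          then have "\<eta> * (\<delta>/6 * N) \<le> \<eta> * (\<delta>/3 * N - 1)"
            using \<open>\<eta> > 0\<close> by (intro mult_left_mono) auto
          then show ?thesis using X_ge[of N] elim by (simp add: c_def)
        qed
        then have 1: "(a n - b N) * (c * N) \<le> E N"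
          using key[of N n] elim n False mult_left_mono[of "c * N" "X N" "a n - b N"] by linarith
        have 2: "1 / (2 * N) \<le> 1 - r N"
        proof -
          have "1 + 1 / N \<le> exp (1 / N)" by (rule exp_ge_add_one_self)
          then have "r N \<le> 1 / (1 + 1 / N)"
            unfolding r_def using elim by (simp add: exp_minus field_simps)
          also have "\<dots> \<le> 1 - 1 / (2 * N)" using elim by (simp add: field_simps)
          finally show ?thesis by simp
        qed
        then have "sqrt (1 / (2 * N)) \<le> sqrt (1 - r N)" by simp
        moreover have "sqrt (1 / (2 * N)) = 1 / (sqrt 2 * sqrt N)"
          by (simp add: real_sqrt_divide real_sqrt_mult)
        ultimately have "1 / (sqrt 2 * sqrt N) \<le> sqrt (1 - r N)" by (simp only:)
        then have "1 / (sqrt 2 * sqrt N) * ((a n - b N) * (c * N)) \<le> sqrt (1 - r N) * E N"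
          by (rule mult_mono) (use 1 False \<open>c > 0\<close> in \<open>auto simp: r_def\<close>)
        also have "\<dots> \<le> \<epsilon> * c / 2" using elim by linarith
        finally have 3: "1 / (sqrt 2 * sqrt N) * ((a n - b N) * (c * N)) \<le> \<epsilon> * c / 2" .
        have "1 / (sqrt 2 * sqrt N) * ((a n - b N) * (c * N)) = (N / sqrt N * (a n - b N)) * (c / sqrt 2)"
          by (simp add: mult_ac)
        also have "N / sqrt N = sqrt N" by (simp add: real_div_sqrt)
        finally have "1 / (sqrt 2 * sqrt N) * ((a n - b N) * (c * N)) = (sqrt N * (a n - b N)) * (c / sqrt 2)" .
        with 3 have "(sqrt N * (a n - b N)) * (c / sqrt 2) \<le> \<epsilon> * c / 2" by (simp only:)
        then have "((sqrt N * (a n - b N)) / sqrt 2) * c \<le> (\<epsilon> / 2) * c" by simp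
        then have "(sqrt N * (a n - b N)) / sqrt 2 \<le> \<epsilon> / 2"
          using \<open>c > 0\<close> by (rule mult_right_le_imp_le)
        then have "sqrt N * (a n - b N) \<le> \<epsilon> * (sqrt 2 / 2)" by (simp add: field_simps)
        also have "\<dots> \<le> \<epsilon> * 1" using pos sqrt2_less_2 by (intro mult_left_mono) auto
        finally show ?thesis by simp
      qed
    qed
  qed
qed

text \<open>Karamata's Tauberian theorem for the exponent \<open>1/2\<close> and decreasing coefficients. The comparison
lemma is applied in both directions to \<open>a\<close> and to the coefficients of \<open>c (1 - z)^(-1/2)\<close>; letting the
window shrink gives the limit.\<close>

theorem monotone_tauberian:
  fixes a :: "nat \<Rightarrow> real"
  assumes a: "decseq a" "\<And>n. 0 \<le> a n"
    and lim: "((\<lambda>r. sqrt (1 - r) * (\<Sum>n. a n * r ^ n)) \<longlongrightarrow> c) (at_left 1)"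
  shows "(\<lambda>n. sqrt n * a n) \<longlonglongrightarrow> c / sqrt pi"
proof -
  define b where "b n = c * inv_sqrt_coeff n" for n
  define C' where "C' = c / sqrt pi"
  have ev01: "eventually (\<lambda>r::real. 0 < r \<and> r < 1) (at_left 1)"
    using eventually_at_left_real[of 0 1] by simp
  have "c \<ge> 0"
  proof (rule tendsto_lowerbound[OF lim])
    show "eventually (\<lambda>r. 0 \<le> sqrt (1 - r) * (\<Sum>n. a n * r ^ n)) (at_left 1)"
      using ev01
    proof eventually_elim
      case (elim r)
      then have "summable (\<lambda>n. a n * r ^ n)"
        by (intro summable_bounded_power_real[OF decseq_nonneg_abs_le[OF a]]) auto
      then have "0 \<le> (\<Sum>n. a n * r ^ n)" by (rule suminf_nonneg) (use a elim in auto)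
      then show ?case using elim by simp
    qed
  qed simp
  have b: "decseq b" "\<And>n. 0 \<le> b n"
    using \<open>c \<ge> 0\<close> decseq_inv_sqrt_coeff inv_sqrt_coeff_pos[THEN less_imp_le]
    by (auto simp: b_def decseq_def intro!: mult_left_mono mult_nonneg_nonneg)
  have b_sum: "sqrt (1 - r) * (\<Sum>n. b n * r ^ n) = c" if "0 < r" "r < 1" for r
  proof -
    have "(\<lambda>n. c * (inv_sqrt_coeff n * r ^ n)) sums (c * (1 / sqrt (1 - r)))"
      by (intro sums_mult inv_sqrt_coeff_sums_real) (use that in auto)
    then show ?thesis using that by (simp add: b_def sums_iff mult_ac)
  qed
  have diff: "((\<lambda>r. sqrt (1 - r) * (\<Sum>n. (a n - b n) * r ^ n)) \<longlongrightarrow> 0) (at_left 1)"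
  proof -
    have "((\<lambda>r. sqrt (1 - r) * (\<Sum>n. a n * r ^ n) - c) \<longlongrightarrow> c - c) (at_left 1)"
      by (intro tendsto_intros lim)
    moreover have "eventually (\<lambda>r. sqrt (1 - r) * (\<Sum>n. a n * r ^ n) - c = sqrt (1 - r) * (\<Sum>n. (a n - b n) * r ^ n)) (at_left 1)"
      using ev01
    proof eventually_elim
      case (elim r)
      have "summable (\<lambda>n. a n * r ^ n)" "summable (\<lambda>n. b n * r ^ n)"
        using elim by (auto intro!: summable_bounded_power_real[OF decseq_nonneg_abs_le] a b)
      from suminf_diff[OF this] have "(\<Sum>n. (a n - b n) * r ^ n) = (\<Sum>n. a n * r ^ n) - (\<Sum>n. b n * r ^ n)"
        by (simp add: left_diff_distrib)
      then show ?case using b_sum[of r] elim by (simp add: right_diff_distrib)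
    qed
    ultimately show ?thesis by (simp add: Lim_transform_eventually)
  qed
  have diff': "((\<lambda>r. sqrt (1 - r) * (\<Sum>n. (b n - a n) * r ^ n)) \<longlongrightarrow> 0) (at_left 1)"
  proof -
    have "((\<lambda>r. - (sqrt (1 - r) * (\<Sum>n. (a n - b n) * r ^ n))) \<longlongrightarrow> - 0) (at_left 1)"
      by (intro tendsto_intros diff)
    moreover have "eventually (\<lambda>r. - (sqrt (1 - r) * (\<Sum>n. (a n - b n) * r ^ n)) = sqrt (1 - r) * (\<Sum>n. (b n - a n) * r ^ n)) (at_left 1)"
      using ev01
    proof eventually_elim
      case (elim r)
      have "summable (\<lambda>n. a n * r ^ n)" "summable (\<lambda>n. b n * r ^ n)"
        using elim by (auto intro!: summable_bounded_power_real[OF decseq_nonneg_abs_le] a b)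
      then have "summable (\<lambda>n. (a n - b n) * r ^ n)"
        using summable_diff by (fastforce simp: left_diff_distrib)
      from suminf_minus[OF this] show ?case by (simp add: algebra_simps)
    qed
    ultimately show ?thesis by (simp add: Lim_transform_eventually)
  qed
  have bdd_b: "eventually (\<lambda>r. sqrt (1 - r) * (\<Sum>n. b n * r ^ n) \<le> c) (at_left 1)"
    using ev01 by eventually_elim (simp add: b_sum)
  have bdd_a: "eventually (\<lambda>r. sqrt (1 - r) * (\<Sum>n. a n * r ^ n) \<le> c + 1) (at_left 1)"
    using order_tendstoD(2)[OF lim, of "c + 1"] by (auto elim: eventually_mono)
  have b_lim: "(\<lambda>n. sqrt n * b n) \<longlonglongrightarrow> C'"
    using tendsto_mult_left[OF inv_sqrt_coeff_asymptotic, of c] by (simp add: b_def C'_def mult_ac)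
  have upper: "eventually (\<lambda>n. sqrt n * a n \<le> (1 + e) * (C' + 2 * e)) sequentially" if "e > 0" for e
  proof -
    \<comment> \<open>The largest index whose window \<open>(1 + e) N\<close> ends no later than \<open>n\<close>.\<close>
    define N where "N n = nat \<lfloor>n / (1 + e)\<rfloor>" for n :: nat
    have N_real: "real (N n) = of_int \<lfloor>n / (1 + e)\<rfloor>" for n
      using that by (simp add: N_def)
    have N_le: "(1 + e) * N n \<le> n" for n
    proof -
      have "real (N n) \<le> n / (1 + e)" unfolding N_real by (rule of_int_floor_le)
      then show ?thesis using that by (simp add: pos_le_divide_eq mult.commute)
    qed
    have N_lim: "filterlim N at_top sequentially"
      unfolding N_def using that by real_asymp
    have "eventually (\<lambda>n. \<forall>m. (1 + e) * N n \<le> m \<longrightarrow> sqrt (N n) * (a m - b (N n)) \<le> e) sequentially"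
      by (rule eventually_compose_filterlim[OF monotone_abelian_comparison[OF a b diff bdd_b that that] N_lim])
    moreover have "eventually (\<lambda>n. sqrt (N n) * b (N n) < C' + e) sequentially"
      by (rule eventually_compose_filterlim[OF order_tendstoD(2)[OF b_lim] N_lim]) (use that in simp)
    moreover have "eventually (\<lambda>n. real (N n) \<ge> 1 / e) sequentially"
      using eventually_compose_filterlim[OF eventually_ge_at_top N_lim, of "nat \<lceil>1 / e\<rceil>"]
      by eventually_elim (simp add: nat_le_iff ceiling_le_iff)
    ultimately show ?thesis
    proof eventually_elim
      case (elim n)
      have 1: "sqrt (N n) * a n \<le> C' + 2 * e"
        using elim(1)[rule_format, OF N_le] elim(2) by (simp add: algebra_simps)
      have "n / (1 + e) \<le> N n + 1" using N_real[of n] by linarith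
      also have "\<dots> \<le> N n * (1 + e)" using elim(3) that by (simp add: field_simps)
      finally have "real n \<le> (1 + e)\<^sup>2 * N n" using that by (simp add: field_simps power2_eq_square)
      then have "sqrt n \<le> sqrt ((1 + e)\<^sup>2 * N n)" by simp
      also have "\<dots> = (1 + e) * sqrt (N n)" using that by (simp add: real_sqrt_mult)
      finally have "sqrt n * a n \<le> (1 + e) * (sqrt (N n) * a n)"
        using a(2)[of n] mult_right_mono[of "sqrt n" "(1 + e) * sqrt (N n)" "a n"] by (simp add: mult_ac)
      also have "\<dots> \<le> (1 + e) * (C' + 2 * e)" using 1 that by (intro mult_left_mono) auto
      finally show ?case .
    qed
  qed
  have lower: "eventually (\<lambda>n. sqrt n * a n \<ge> (C' - e) / (1 + e) - e) sequentially" if "e > 0" for e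
  proof -
    define N where "N n = nat \<lceil>(1 + e) * n\<rceil>" for n :: nat
    have N_real: "real (N n) = of_int \<lceil>(1 + e) * n\<rceil>" for n
    proof -
      have "\<lceil>(1 + e) * n\<rceil> \<ge> \<lceil>0::real\<rceil>" using that by (intro ceiling_mono) simp
      then show ?thesis by (simp add: N_def)
    qed
    have N_ge: "(1 + e) * n \<le> N n" for n unfolding N_real by linarith
    have N_lim: "filterlim N at_top sequentially"
      unfolding N_def using that by real_asymp
    have "eventually (\<lambda>n. \<forall>m. (1 + e) * n \<le> m \<longrightarrow> sqrt n * (b m - a n) \<le> e) sequentially"
      by (rule monotone_abelian_comparison[OF b a diff' bdd_a that that])
    moreover have "eventually (\<lambda>n. sqrt (N n) * b (N n) > C' - e) sequentially"
      by (rule eventually_compose_filterlim[OF order_tendstoD(1)[OF b_lim] N_lim]) (use that in simp)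
    moreover have "eventually (\<lambda>n. real n \<ge> 1 / e) sequentially"
      using eventually_ge_at_top[of "nat \<lceil>1 / e\<rceil>"]
      by eventually_elim (simp add: nat_le_iff ceiling_le_iff)
    ultimately show ?thesis
    proof eventually_elim
      case (elim n)
      have 1: "sqrt n * a n \<ge> sqrt n * b (N n) - e"
        using elim(1)[rule_format, OF N_ge] by (simp add: algebra_simps)
      have "N n \<le> (1 + e) * n + 1" using N_real[of n] by linarith
      also have "\<dots> \<le> (1 + e) * n + n * e" using elim(3) that by (simp add: field_simps)
      also have "\<dots> \<le> (1 + e)\<^sup>2 * n" using that by (simp add: power2_eq_square algebra_simps)
      finally have "sqrt (N n) \<le> sqrt ((1 + e)\<^sup>2 * n)" by simp
      also have "\<dots> = (1 + e) * sqrt n" using that by (simp add: real_sqrt_mult)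
      finally have "sqrt (N n) * b (N n) \<le> (1 + e) * (sqrt n * b (N n))"
        using b(2)[of "N n"] mult_right_mono[of "sqrt (N n)" "(1 + e) * sqrt n" "b (N n)"] by (simp add: mult_ac)
      then have "(C' - e) \<le> (1 + e) * (sqrt n * b (N n))" using elim(2) by linarith
      then have "(C' - e) / (1 + e) \<le> sqrt n * b (N n)" using that by (simp add: field_simps)
      with 1 show ?case by linarith
    qed
  qed
  have "(\<lambda>n. sqrt n * a n) \<longlonglongrightarrow> C'"
  proof (rule order_tendstoI)
    fix x assume "x < C'"
    have "((\<lambda>e. (C' - e) / (1 + e) - e) \<longlongrightarrow> (C' - 0) / (1 + 0) - 0) (at_right 0)"
      by (intro tendsto_intros) auto
    then have "eventually (\<lambda>e. (C' - e) / (1 + e) - e > x) (at_right 0)"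
      using \<open>x < C'\<close> by (intro order_tendstoD) auto
    with eventually_at_right_less[of 0] have "eventually (\<lambda>e. e > 0 \<and> (C' - e) / (1 + e) - e > x) (at_right 0)"
      by eventually_elim auto
    then obtain e where "e > 0" "(C' - e) / (1 + e) - e > x"
      using eventually_happens[of _ "at_right (0::real)"] by auto
    with lower[of e] show "eventually (\<lambda>n. x < sqrt n * a n) sequentially"
      by (auto elim: eventually_mono)
  next
    fix x assume "C' < x"
    have "((\<lambda>e. (1 + e) * (C' + 2 * e)) \<longlongrightarrow> (1 + 0) * (C' + 2 * 0)) (at_right 0)"
      by (intro tendsto_intros)
    then have "eventually (\<lambda>e. (1 + e) * (C' + 2 * e) < x) (at_right 0)"
      using \<open>C' < x\<close> by (intro order_tendstoD) auto
    with eventually_at_right_less[of 0] have "eventually (\<lambda>e. e > 0 \<and> (1 + e) * (C' + 2 * e) < x) (at_right 0)"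
      by eventually_elim auto
    then obtain e where "e > 0" "(1 + e) * (C' + 2 * e) < x"
      using eventually_happens[of _ "at_right (0::real)"] by auto
    with upper[of e] show "eventually (\<lambda>n. sqrt n * a n < x) sequentially"
      by (auto elim: eventually_mono)
  qed
  then show ?thesis by (simp add: C'_def)
qed

text \<open>Summation by parts: the differences of a decreasing nonnegative sequence sum to at most
its first term. Applied to a shifted sequence, this bounds the tail of the series by a multiple of \<open>1 / |1 - z|\<close>.\<close>

lemma norm_decseq_power_series_le:
  fixes z :: complex
  assumes a: "decseq a" "\<And>n. 0 \<le> a n" and z: "norm z < 1"
  shows "norm ((1 - z) * (\<Sum>n. of_real (a n) * z ^ n)) \<le> 2 * a 0"
proof -
  have s: "summable (\<lambda>n. of_real (a n) * z ^ n)"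
    by (rule summable_bounded_power[OF decseq_nonneg_abs_le[OF a] z])
  have s': "summable (\<lambda>n. of_real (a (Suc n)) * z ^ n)"
    by (rule summable_bounded_power[of "\<lambda>n. a (Suc n)" "a 0" z])
       (use a z decseqD[OF a(1), of 0] in auto)
  obtain l where l: "a \<longlonglongrightarrow> l" using decseq_convergent[OF a(1), of 0] a(2) by blast
  have "0 \<le> l" using l a(2) by (intro LIMSEQ_le_const) auto
  have tel: "(\<lambda>n. a n - a (Suc n)) sums (a 0 - l)" by (rule telescope_sums'[OF l])
  have nn: "norm (of_real (a n - a (Suc n)) * z ^ Suc n) \<le> a n - a (Suc n)" for n
  proof -
    have "norm z ^ Suc n \<le> 1" using z by (intro power_le_one) auto
    then show ?thesis
      using decseqD[OF a(1), of n "Suc n"] unfolding norm_mult norm_power norm_of_real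
      by (simp del: power_Suc add: mult_left_le)
  qed
  have "(\<Sum>n. of_real (a n) * z ^ n) = of_real (a 0) + z * (\<Sum>n. of_real (a (Suc n)) * z ^ n)"
    using suminf_split_head[OF s] suminf_mult[OF s', of z] by (simp add: mult_ac algebra_simps)
  moreover have "(\<Sum>n. of_real (a n - a (Suc n)) * z ^ Suc n)
      = z * (\<Sum>n. of_real (a n) * z ^ n) - z * (\<Sum>n. of_real (a (Suc n)) * z ^ n)"
    using suminf_diff[OF summable_mult[OF s, of z] summable_mult[OF s', of z]]
      suminf_mult[OF s, of z] suminf_mult[OF s', of z] by (simp add: algebra_simps)
  ultimately have eq: "(1 - z) * (\<Sum>n. of_real (a n) * z ^ n) = of_real (a 0) - (\<Sum>n. of_real (a n - a (Suc n)) * z ^ Suc n)"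
    by (simp add: algebra_simps)
  have "norm (\<Sum>n. of_real (a n - a (Suc n)) * z ^ Suc n) \<le> (\<Sum>n. a n - a (Suc n))"
    by (rule norm_suminf_le[OF nn sums_summable[OF tel]])
  also have "\<dots> \<le> a 0" using sums_unique[OF tel] \<open>0 \<le> l\<close> by simp
  finally have "norm (of_real (a 0) - (\<Sum>n. of_real (a n - a (Suc n)) * z ^ Suc n)) \<le> norm (of_real (a 0) :: complex) + a 0"
    by (intro order_trans[OF norm_triangle_ineq4] add_left_mono)
  then show ?thesis unfolding eq using a(2)[of 0] by simp
qed

lemma sum_inverse_sqrt_le: "(\<Sum>n\<le>M. 1 / sqrt (real n)) \<le> 2 * sqrt (real M)"
proof (induction M)
  case (Suc M)
  define p q where "p = sqrt M" and "q = sqrt (Suc M)"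
  have pq: "p \<ge> 0" "q > 0" "p \<le> q" "q * q - p * p = 1" by (auto simp: p_def q_def)
  have "1 = (q - p) * (q + p)" using pq(4) by (simp add: algebra_simps)
  also have "\<dots> \<le> (q - p) * (2 * q)" using pq by (intro mult_left_mono) auto
  finally have "1 / q \<le> 2 * (q - p)" using pq(2) by (simp add: divide_le_eq mult_ac)
  have "(\<Sum>n\<le>Suc M. 1 / sqrt (real n)) = (\<Sum>n\<le>M. 1 / sqrt (real n)) + 1 / q" by (simp add: q_def)
  also have "\<dots> \<le> 2 * p + 2 * (q - p)"
    using Suc \<open>1 / q \<le> 2 * (q - p)\<close> by (intro add_mono) (auto simp: p_def)
  finally show ?case by (simp add: q_def)
qed simp

text \<open>Monotonicity makes the Abelian direction hold in the full disc, tangential approach to 1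
included. The difference to \<open>c (1 - z)^(-1/2)\<close> is split at an index of order \<open>1 / |1 - z|\<close>: the
head is small since the coefficients agree to \<open>o (1 / sqrt n)\<close>, the tail by summation by parts.\<close>

theorem monotone_abelian_disc:
  fixes a :: "nat \<Rightarrow> real"
  assumes a: "decseq a" "\<And>n. 0 \<le> a n" and lim: "(\<lambda>n. sqrt n * a n) \<longlonglongrightarrow> c / sqrt pi"
  shows "((\<lambda>z. (\<Sum>n. of_real (a n) * z ^ n) * (1 - z) powr (1/2)) \<longlongrightarrow> (of_real c :: complex)) (at 1 within ball 0 1)"
proof (rule tendstoI)
  fix e :: real assume "e > 0"
  define b where "b n = c * inv_sqrt_coeff n" for n
  have "c / sqrt pi \<ge> 0" by (rule LIMSEQ_le_const[OF lim]) (use a in auto)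
  then have "c \<ge> 0" using pi_gt_zero by (auto simp: zero_le_divide_iff)
  have b: "decseq b" "\<And>n. 0 \<le> b n"
    using \<open>c \<ge> 0\<close> decseq_inv_sqrt_coeff inv_sqrt_coeff_pos[THEN less_imp_le]
    by (auto simp: b_def decseq_def intro!: mult_left_mono mult_nonneg_nonneg)
  define C' where "C' = c / sqrt pi"
  have b_lim: "(\<lambda>n. sqrt n * b n) \<longlonglongrightarrow> C'"
    using tendsto_mult_left[OF inv_sqrt_coeff_asymptotic, of c] by (simp add: b_def C'_def mult_ac)
  define d where "d n = a n - b n" for n
  have d_lim: "(\<lambda>n. sqrt n * d n) \<longlonglongrightarrow> 0"
    using tendsto_diff[OF lim b_lim] by (simp add: d_def C'_def algebra_simps)
  define Q where "Q = 4 * (C' + 1)"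
  have "Q > 0" using \<open>c \<ge> 0\<close> by (simp add: Q_def C'_def add_nonneg_pos)
  \<comment> \<open>The series is cut at \<open>M = A / |1 - z|\<close>. The constant \<open>A\<close> makes the tail small; \<open>e1\<close> makes the head small after \<open>A\<close> is chosen.\<close>
  define A where "A = (4 * Q / e)\<^sup>2"
  have "A > 0" and sqrtA: "sqrt A = 4 * Q / e" using \<open>Q > 0\<close> \<open>e > 0\<close> by (auto simp: A_def)
  define e1 where "e1 = e / (8 * sqrt A)"
  have "e1 > 0" using \<open>A > 0\<close> \<open>e > 0\<close> by (simp add: e1_def)
  obtain n0 where n0: "\<And>n. n \<ge> n0 \<Longrightarrow> \<bar>sqrt n * d n\<bar> < e1 \<and> sqrt n * a n < C' + 1 \<and> sqrt n * b n < C' + 1"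
  proof -
    have "eventually (\<lambda>n. \<bar>sqrt n * d n\<bar> < e1 \<and> sqrt n * a n < C' + 1 \<and> sqrt n * b n < C' + 1) sequentially"
      using tendstoD[OF d_lim \<open>e1 > 0\<close>] order_tendstoD(2)[OF lim, of "C' + 1"] order_tendstoD(2)[OF b_lim, of "C' + 1"]
      by (auto simp: dist_real_def C'_def elim: eventually_elim2 intro: eventually_conj)
    then show ?thesis using that by (auto simp: eventually_sequentially)
  qed
  define D where "D = (\<Sum>n<n0+1. \<bar>d n\<bar>)"
  have "D \<ge> 0" by (simp add: D_def sum_nonneg)
  have head: "(\<Sum>n<M. \<bar>d n\<bar>) \<le> D + e1 * (2 * sqrt M)" for M
  proof -
    have "(\<Sum>n<M. \<bar>d n\<bar>) \<le> (\<Sum>n\<in>{..<n0+1} \<union> {n0+1..<M}. \<bar>d n\<bar>)" by (rule sum_mono2) auto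
    also have "\<dots> = D + (\<Sum>n\<in>{n0+1..<M}. \<bar>d n\<bar>)"
      unfolding D_def by (rule sum.union_disjoint) auto
    also have "(\<Sum>n\<in>{n0+1..<M}. \<bar>d n\<bar>) \<le> (\<Sum>n\<in>{n0+1..<M}. e1 * (1 / sqrt n))"
    proof (rule sum_mono)
      fix n assume n: "n \<in> {n0+1..<M}"
      with n0[of n] have "sqrt n * \<bar>d n\<bar> < e1" by (simp add: abs_mult)
      then show "\<bar>d n\<bar> \<le> e1 * (1 / sqrt n)" using n by (simp add: field_simps)
    qed
    also have "\<dots> \<le> (\<Sum>n\<le>M. e1 * (1 / sqrt n))" using \<open>e1 > 0\<close> by (intro sum_mono2) auto
    also have "\<dots> \<le> e1 * (2 * sqrt M)"
      unfolding sum_distrib_left[symmetric] using sum_inverse_sqrt_le \<open>e1 > 0\<close> by (intro mult_left_mono) auto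
    finally show ?thesis by simp
  qed
  have ev_z: "eventually (\<lambda>z::complex. norm z < 1) (at 1 within ball 0 1)"
    by (auto simp: eventually_at_filter intro: always_eventually)
  have lim0: "((\<lambda>z::complex. (D + 2 * e1) * sqrt (norm (1 - z))) \<longlongrightarrow> (D + 2 * e1) * sqrt (norm (1 - 1 :: complex))) (at 1 within ball 0 1)"
    by (intro tendsto_intros)
  have ev1: "eventually (\<lambda>z::complex. (D + 2 * e1) * sqrt (norm (1 - z)) < e / 4) (at 1 within ball 0 1)"
    by (rule order_tendstoD(2)[OF lim0]) (use \<open>e > 0\<close> in simp)
  have ev2: "eventually (\<lambda>z::complex. norm (1 - z) < A / (n0 + 1)) (at 1 within ball 0 1)"
  proof -
    have "((\<lambda>z::complex. norm (1 - z)) \<longlongrightarrow> norm (1 - 1 :: complex)) (at 1 within ball 0 1)"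
      by (intro tendsto_intros)
    then show ?thesis by (rule order_tendstoD(2)) (use \<open>A > 0\<close> in simp)
  qed
  show "eventually (\<lambda>z. dist ((\<Sum>n. of_real (a n) * z ^ n) * (1 - z) powr (1/2)) (of_real c :: complex) < e) (at 1 within ball 0 1)"
    using ev_z ev1 ev2
  proof eventually_elim
    case (elim z)
    define \<eta> where "\<eta> = norm (1 - z)"
    have "z \<noteq> 1" using elim by auto
    then have "\<eta> > 0" by (simp add: \<eta>_def)
    define M where "M = nat \<lceil>A / \<eta>\<rceil>"
    have M_ge: "A / \<eta> \<le> M" unfolding M_def by linarith
    have M_le: "M \<le> A / \<eta> + 1"
      unfolding M_def using \<open>A > 0\<close> \<open>\<eta> > 0\<close> divide_pos_pos[of A \<eta>] by linarith
    have "n0 + 1 < A / \<eta>" using elim(3) \<open>\<eta> > 0\<close> unfolding \<eta>_def[symmetric] by (simp add: field_simps)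
    then have "M > n0" using M_ge by linarith
    have sa: "summable (\<lambda>n. of_real (a n) * z ^ n)" and sb: "summable (\<lambda>n. of_real (b n) * z ^ n)"
      by (intro summable_bounded_power[OF decseq_nonneg_abs_le] a b elim)+
    have sqM: "sqrt M > 0" using \<open>M > n0\<close> by simp
    have tail: "norm (\<Sum>n. of_real (f (n + M)) * z ^ (n + M)) \<le> 2 * ((C' + 1) / sqrt M) / \<eta>"
      if f: "decseq f" "\<And>n. 0 \<le> f n" "sqrt M * f M < C' + 1" for f
    proof -
      have sf: "summable (\<lambda>n. of_real (f (n + M)) * z ^ n)"
        by (rule summable_bounded_power[of "\<lambda>n. f (n + M)" "f 0" z])
          (use f elim decseqD[OF f(1), of 0] in auto)
      have "norm ((1 - z) * (\<Sum>n. of_real (f (n + M)) * z ^ n)) \<le> 2 * f (0 + M)"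
        by (rule norm_decseq_power_series_le[of "\<lambda>n. f (n + M)"])
           (use f elim in \<open>auto simp: decseq_def\<close>)
      then have 1: "norm (\<Sum>n. of_real (f (n + M)) * z ^ n) \<le> 2 * f M / \<eta>"
        using \<open>\<eta> > 0\<close> unfolding norm_mult \<eta>_def[symmetric] by (simp add: pos_le_divide_eq mult.commute)
      have "(\<Sum>n. of_real (f (n + M)) * z ^ (n + M)) = z ^ M * (\<Sum>n. of_real (f (n + M)) * z ^ n)"
        by (subst suminf_mult[OF sf, symmetric]) (simp add: power_add mult_ac)
      then have "norm (\<Sum>n. of_real (f (n + M)) * z ^ (n + M)) \<le> 1 * norm (\<Sum>n. of_real (f (n + M)) * z ^ n)"
        using elim by (simp add: norm_mult norm_power mult_right_mono power_le_one mult_left_le_one_le)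
      also note 1
      also have "2 * f M / \<eta> \<le> 2 * ((C' + 1) / sqrt M) / \<eta>"
        using f(3) sqM \<open>\<eta> > 0\<close> by (intro divide_right_mono) (auto simp: field_simps)
      finally show ?thesis by simp
    qed
    have split: "(\<Sum>n. of_real (a n) * z ^ n) - (\<Sum>n. of_real (b n) * z ^ n)
       = (\<Sum>n<M. of_real (d n) * z ^ n) + (\<Sum>n. of_real (a (n + M)) * z ^ (n + M)) - (\<Sum>n. of_real (b (n + M)) * z ^ (n + M))"
      using suminf_split_initial_segment[OF sa, of M] suminf_split_initial_segment[OF sb, of M]
      by (simp add: d_def sum_subtractf left_diff_distrib)
    have "norm (\<Sum>n<M. of_real (d n) * z ^ n) \<le> (\<Sum>n<M. \<bar>d n\<bar>)"
    proof (rule sum_norm_le)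
      fix n
      have "norm z ^ n \<le> 1" using elim by (intro power_le_one) auto
      then show "norm (of_real (d n) * z ^ n) \<le> \<bar>d n\<bar>" by (simp add: norm_mult norm_power mult_left_le)
    qed
    also note head
    finally have hd: "norm (\<Sum>n<M. of_real (d n) * z ^ n) \<le> D + e1 * (2 * sqrt M)" .
    have "norm ((\<Sum>n. of_real (a n) * z ^ n) - (\<Sum>n. of_real (b n) * z ^ n))
        \<le> (D + e1 * (2 * sqrt M)) + 2 * ((C' + 1) / sqrt M) / \<eta> + 2 * ((C' + 1) / sqrt M) / \<eta>"
      unfolding split
      by (intro order_trans[OF norm_triangle_ineq4] order_trans[OF norm_triangle_ineq] add_mono hd tail a b)
         (use n0[of M] \<open>M > n0\<close> in auto)
    also have "\<dots> = D + 2 * e1 * sqrt M + Q / (sqrt M * \<eta>)" by (simp add: Q_def field_simps)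
    finally have bound: "norm ((\<Sum>n. of_real (a n) * z ^ n) - (\<Sum>n. of_real (b n) * z ^ n)) \<le> D + 2 * e1 * sqrt M + Q / (sqrt M * \<eta>)" .
    have s\<eta>: "sqrt \<eta> > 0" "sqrt \<eta> * sqrt \<eta> = \<eta>" using \<open>\<eta> > 0\<close> by auto
    have "sqrt M \<le> sqrt (A / \<eta> + 1)" using M_le by simp
    also have "\<dots> \<le> sqrt (A / \<eta>) + sqrt 1" using \<open>A > 0\<close> \<open>\<eta> > 0\<close> by (intro sqrt_add_le_add_sqrt) auto
    finally have m1: "sqrt M \<le> sqrt A / sqrt \<eta> + 1" by (simp add: real_sqrt_divide)
    have m2: "sqrt A / sqrt \<eta> \<le> sqrt M" using M_ge by (metis real_sqrt_divide real_sqrt_le_mono)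
    have "sqrt \<eta> * (D + 2 * e1 * sqrt M + Q / (sqrt M * \<eta>)) \<le> sqrt \<eta> * (D + 2 * e1 * (sqrt A / sqrt \<eta> + 1) + Q / (sqrt A / sqrt \<eta> * \<eta>))"
      using m1 m2 s\<eta> \<open>A > 0\<close> \<open>Q > 0\<close> \<open>e1 > 0\<close> \<open>\<eta> > 0\<close> \<open>D \<ge> 0\<close> sqM
      by (intro mult_left_mono add_mono divide_left_mono mult_right_mono mult_pos_pos) auto
    also have "\<dots> = (D + 2 * e1) * sqrt \<eta> + 2 * e1 * sqrt A + Q / sqrt A"
      using s\<eta> \<open>A > 0\<close> by (simp add: field_simps)
    also have "2 * e1 * sqrt A = e / 4" using \<open>A > 0\<close> by (simp add: e1_def)
    also have "Q / sqrt A = e / 4" using \<open>Q > 0\<close> by (simp add: sqrtA)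
    also have "(D + 2 * e1) * sqrt \<eta> + e / 4 + e / 4 < e"
      using elim(2) \<open>e > 0\<close> unfolding \<eta>_def[symmetric] by simp
    finally have fin: "sqrt \<eta> * (D + 2 * e1 * sqrt M + Q / (sqrt M * \<eta>)) < e" .
    have npowr: "norm ((1 - z) powr (1/2)) = sqrt \<eta>"
      using \<open>\<eta> > 0\<close> by (simp add: norm_powr_real_powr' \<eta>_def powr_half_sqrt)
    have "(\<lambda>n. of_real c * (of_real (inv_sqrt_coeff n) * z ^ n)) sums (of_real c * (1 - z) powr (-1/2))"
      by (intro sums_mult inv_sqrt_coeff_sums_complex elim)
    then have sumb: "(\<Sum>n. of_real (b n) * z ^ n) = of_real c * (1 - z) powr (-1/2)"
      by (simp add: b_def sums_iff mult_ac)
    have "(1 - z) powr (-1/2) * (1 - z) powr (1/2) = 1"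
      using \<open>z \<noteq> 1\<close> by (simp add: powr_minus)
    then have "(\<Sum>n. of_real (b n) * z ^ n) * (1 - z) powr (1/2) = of_real c"
      unfolding sumb by (simp add: mult.assoc)
    then have "norm ((\<Sum>n. of_real (a n) * z ^ n) * (1 - z) powr (1/2) - of_real c)
       = norm (((\<Sum>n. of_real (a n) * z ^ n) - (\<Sum>n. of_real (b n) * z ^ n))) * sqrt \<eta>"
      unfolding npowr[symmetric] norm_mult[symmetric] by (simp add: algebra_simps)
    also have "\<dots> \<le> (D + 2 * e1 * sqrt M + Q / (sqrt M * \<eta>)) * sqrt \<eta>"
      using s\<eta> by (intro mult_right_mono bound) auto
    also have "\<dots> < e" using fin by (simp add: mult.commute)
    finally show ?case by (simp add: dist_norm)
  qed
qed

section \<open>Nonnegative primitive matrices and Markov chains\<close>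

text \<open>Matrices and vectors are functions on a finite type, so that weights depending on real parameters need
no conversion to vector types.\<close>

definition mat_apply :: "('n::finite \<Rightarrow> 'n \<Rightarrow> real) \<Rightarrow> ('n \<Rightarrow> real) \<Rightarrow> 'n \<Rightarrow> real" where
  "mat_apply N z i = (\<Sum>j\<in>UNIV. N i j * z j)"

lemma mat_apply_nonneg: "(\<And>i j. 0 \<le> N i j) \<Longrightarrow> (\<And>j. 0 \<le> z j) \<Longrightarrow> 0 \<le> mat_apply N z i"
  by (simp add: mat_apply_def sum_nonneg)

lemma mat_apply_pos:
  assumes "\<And>i j. 0 \<le> N i j" "\<And>j. 0 \<le> z j" "N i j > 0" "z j > 0"
  shows "mat_apply N z i > 0"
  unfolding mat_apply_def by (rule sum_pos2[of _ j]) (use assms in auto)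

lemma mat_apply_scale: "mat_apply N (\<lambda>i. c * z i) = (\<lambda>i. c * mat_apply N z i)"
  by (simp add: mat_apply_def sum_distrib_left mult_ac fun_eq_iff)

lemma mat_apply_funpow_pos:
  assumes "\<And>i j. 0 \<le> N i j" "\<And>i j. R i j \<Longrightarrow> N i j > 0"
    and "\<And>j. 0 \<le> z j" "z j > 0" "(R ^^ k) i j"
  shows "(mat_apply N ^^ k) z i > 0"
  using assms(3-)
proof (induction k arbitrary: z j)
  case (Suc k)
  then obtain l where l: "(R ^^ k) i l" "R l j" by auto
  have "mat_apply N z l > 0"
    by (rule mat_apply_pos[of _ _ _ j]) (use l Suc.prems assms in auto)
  then have "(mat_apply N ^^ k) (mat_apply N z) i > 0"
    by (rule Suc.IH[rotated]) (use l Suc.prems assms in \<open>auto intro: mat_apply_nonneg\<close>)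
  then show ?case by (simp only: funpow_Suc_right o_apply)
qed auto

text \<open>A power of the matrix is positive, so it maps a nonzero nonnegative vector to a
positive one; on an eigenvector it acts as a scalar.\<close>

lemma nonneg_eigenvector_pos:
  fixes N :: "'n::finite \<Rightarrow> 'n \<Rightarrow> real"
  assumes N: "\<And>i j. 0 \<le> N i j" "\<And>i j. R i j \<Longrightarrow> N i j > 0"
    and k: "\<And>i j. (R ^^ k) i j" "k \<ge> 1"
    and z: "\<And>j. 0 \<le> z j" "z j > 0" and eig: "\<And>i. (\<Sum>j\<in>UNIV. N i j * z j) = c * z i"
  shows "c > 0" "z i > 0"
proof -
  have m: "mat_apply N z = (\<lambda>i. c * z i)" using eig by (simp add: mat_apply_def fun_eq_iff)
  have pw: "(mat_apply N ^^ n) z = (\<lambda>i. c ^ n * z i)" for n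
  proof (induction n)
    case (Suc n)
    show ?case unfolding funpow.simps o_apply Suc mat_apply_scale m by (simp add: mult_ac)
  qed simp
  have pos: "c ^ k * z i > 0" for i
    using mat_apply_funpow_pos[of N R z j k i, OF N z k(1)] unfolding pw by simp
  have "c * z j \<ge> 0" using mat_apply_nonneg[of N z, OF N(1) z(1)] unfolding m by simp
  then have "c \<ge> 0" using z(2) by (simp add: zero_le_mult_iff)
  moreover have "c \<noteq> 0" using pos[of j] k(2) by (auto simp: power_0_left)
  ultimately show "c > 0" by simp
  show "z i > 0" using pos[of i] z(1)[of i] by (cases "z i = 0") auto
qed

text \<open>Brouwer's theorem for the normalised action of the matrix on the standard simplex.\<close>

lemma perron_right_eigenvector:
  fixes N :: "'n::finite \<Rightarrow> 'n \<Rightarrow> real"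
  assumes N: "\<And>i j. 0 \<le> N i j" "\<And>i j. R i j \<Longrightarrow> N i j > 0"
    and k: "\<And>i j. (R ^^ k) i j" "k \<ge> 1"
  obtains c v where "c > 0" "\<And>i. v i > 0" "\<And>i. (\<Sum>j\<in>UNIV. N i j * v j) = c * v i"
proof -
  define S where "S = {x :: real ^ 'n. (\<forall>i. 0 \<le> x $ i) \<and> (\<Sum>i\<in>UNIV. x $ i) = 1}"
  define G where "G x = (\<chi> i. \<Sum>j\<in>UNIV. N i j * x $ j)" for x :: "real ^ 'n"
  define s where "s x = (\<Sum>i\<in>UNIV. G x $ i)" for x
  have ex_pos: "\<exists>j. x $ j > 0" if "x \<in> S" for x
  proof (rule ccontr)
    assume "\<not> ?thesis"
    then have "(\<Sum>i\<in>UNIV. x $ i) \<le> 0" by (intro sum_nonpos) (auto simp: not_less)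
    then show False using that by (simp add: S_def)
  qed
  have G_nonneg: "0 \<le> G x $ i" if "x \<in> S" for x i
    using that N by (auto simp: S_def G_def intro!: sum_nonneg)
  have s_pos: "s x > 0" if x: "x \<in> S" for x
  proof -
    obtain j where j: "x $ j > 0" using ex_pos[OF x] by blast
    obtain k' where "k = Suc k'" using k(2) by (cases k) auto
    with k(1)[of j j] obtain l where "R l j" by auto
    then have "G x $ l > 0"
      unfolding G_def vec_lambda_beta
      by (intro sum_pos2[of _ j]) (use N x j in \<open>auto simp: S_def\<close>)
    then show ?thesis unfolding s_def by (intro sum_pos2[of _ l]) (use G_nonneg[OF x] in auto)
  qed
  have cont: "continuous_on S (\<lambda>x. (1 / s x) *\<^sub>R G x)"
    unfolding s_def G_def
    by (intro continuous_intros continuous_on_vec_lambda)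
       (use s_pos in \<open>fastforce simp: s_def G_def\<close>)
  have "compact S"
  proof (rule compact_eq_bounded_closed[THEN iffD2], intro conjI)
    show "bounded S"
    proof (rule boundedI)
      fix x assume x: "x \<in> S"
      have "norm x \<le> (\<Sum>i\<in>UNIV. \<bar>x $ i\<bar>)" by (rule norm_le_l1_cart)
      also have "\<dots> = (\<Sum>i\<in>UNIV. x $ i)" by (rule sum.cong) (use x in \<open>auto simp: S_def\<close>)
      finally show "norm x \<le> 1" using x by (simp add: S_def)
    qed
    have "S = (\<Inter>i. {x. 0 \<le> x $ i}) \<inter> {x. (\<Sum>i\<in>UNIV. x $ i) = 1}" by (auto simp: S_def)
    also have "closed \<dots>"
      by (intro closed_Int closed_INT ballI closed_Collect_le closed_Collect_eq continuous_intros)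
    finally show "closed S" .
  qed
  moreover have "convex S"
    unfolding convex_def S_def
    by (auto simp: sum.distrib sum_distrib_left[symmetric] intro!: add_nonneg_nonneg)
  moreover have "S \<noteq> {}"
  proof -
    have "axis (undefined :: 'n) 1 \<in> S" by (auto simp: S_def axis_def)
    then show ?thesis by blast
  qed
  moreover have "(\<lambda>x. (1 / s x) *\<^sub>R G x) \<in> S \<rightarrow> S"
  proof
    fix x assume x: "x \<in> S"
    have "(\<Sum>i\<in>UNIV. G x $ i / s x) = 1"
      unfolding sum_divide_distrib[symmetric] s_def[symmetric] using s_pos[OF x] by simp
    then show "(1 / s x) *\<^sub>R G x \<in> S"
      using s_pos[OF x] G_nonneg[OF x] by (simp add: S_def)
  qed
  ultimately obtain x where x: "x \<in> S" "(1 / s x) *\<^sub>R G x = x"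
    using brouwer[OF _ _ _ cont] by blast
  have "G x = s x *\<^sub>R x" using s_pos[OF x(1)] by (subst (2) x(2)[symmetric]) simp
  then have eig: "(\<Sum>j\<in>UNIV. N i j * x $ j) = s x * x $ i" for i
    by (simp add: G_def vec_eq_iff)
  obtain j where j: "x $ j > 0" using ex_pos[OF x(1)] by blast
  have "x $ i > 0" for i
    by (rule nonneg_eigenvector_pos(2)[of N R k "\<lambda>i. x $ i" j "s x", OF N k]) (use x j eig in \<open>auto simp: S_def\<close>)
  then show ?thesis using that[of "s x" "\<lambda>i. x $ i"] s_pos[OF x(1)] eig by auto
qed

lemma relpowp_conversep:
  fixes R :: "'a \<Rightarrow> 'a \<Rightarrow> bool"
  shows "(R\<inverse>\<inverse> ^^ k) i j \<longleftrightarrow> (R ^^ k) j i"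
proof (induction k arbitrary: i j)
  case (Suc k)
  have "(R\<inverse>\<inverse> ^^ Suc k) i j \<longleftrightarrow> (\<exists>l. (R\<inverse>\<inverse> ^^ k) i l \<and> R j l)" by auto
  also have "\<dots> \<longleftrightarrow> (\<exists>l. (R ^^ k) l i \<and> R j l)" by (simp only: Suc.IH)
  also have "\<dots> \<longleftrightarrow> (R OO (R ^^ k)) j i" by blast
  also have "\<dots> \<longleftrightarrow> (R ^^ Suc k) j i" by (simp only: relpowp_commute relpowp.simps)
  finally show ?case .
qed auto

text \<open>Pairing the left with the right eigenvector shows that the two eigenvalues coincide.\<close>

lemma perron_eigenvectors:
  fixes N :: "'n::finite \<Rightarrow> 'n \<Rightarrow> real"
  assumes N: "\<And>i j. 0 \<le> N i j" "\<And>i j. R i j \<Longrightarrow> N i j > 0"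
    and k: "\<And>i j. (R ^^ k) i j" "k \<ge> 1"
  obtains c v l where "c > 0" "\<And>i. v i > 0" "\<And>i. l i > 0"
    "\<And>i. (\<Sum>j\<in>UNIV. N i j * v j) = c * v i" "\<And>j. (\<Sum>i\<in>UNIV. l i * N i j) = c * l j"
proof -
  obtain c v where c: "c > 0" and v: "\<And>i. v i > 0" "\<And>i. (\<Sum>j\<in>UNIV. N i j * v j) = c * v i"
    using perron_right_eigenvector[of N R k, OF N k] by blast
  obtain c' l where l: "\<And>i. l i > 0" "\<And>i. (\<Sum>j\<in>UNIV. N j i * l j) = c' * l i"
  proof (rule perron_right_eigenvector[of "\<lambda>i j. N j i" "R\<inverse>\<inverse>" k])
    show "(R\<inverse>\<inverse> ^^ k) i j" for i j unfolding relpowp_conversep by (rule k)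
  qed (use N k that in auto)
  have "c * (\<Sum>i\<in>UNIV. l i * v i) = (\<Sum>i\<in>UNIV. l i * (\<Sum>j\<in>UNIV. N i j * v j))"
    unfolding v(2) by (simp add: sum_distrib_left mult_ac)
  also have "\<dots> = (\<Sum>j\<in>UNIV. (\<Sum>i\<in>UNIV. N i j * l i) * v j)"
    unfolding sum_distrib_left sum_distrib_right by (subst sum.swap) (simp add: mult_ac)
  also have "\<dots> = c' * (\<Sum>i\<in>UNIV. l i * v i)" unfolding l(2) by (simp add: sum_distrib_left mult_ac)
  finally have "c = c'"
    using sum_pos[of UNIV "\<lambda>i. l i * v i"] l v by simp
  then show ?thesis using that[of c v l] c v l by (simp add: mult.commute)
qed

definition l1 :: "('n::finite \<Rightarrow> real) \<Rightarrow> real" where "l1 r = (\<Sum>i\<in>UNIV. \<bar>r i\<bar>)"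

definition row_apply :: "('n::finite \<Rightarrow> 'n \<Rightarrow> real) \<Rightarrow> ('n \<Rightarrow> real) \<Rightarrow> 'n \<Rightarrow> real" where
  "row_apply P r j = (\<Sum>i\<in>UNIV. r i * P i j)"

lemma l1_nonneg: "0 \<le> l1 r" by (simp add: l1_def sum_nonneg)

lemma l1_component: "\<bar>r i\<bar> \<le> l1 r" unfolding l1_def by (rule member_le_sum) auto

lemma l1_add_scaled: "l1 (\<lambda>i. r i + c * e i) \<le> l1 r + \<bar>c\<bar> * l1 e"
  unfolding l1_def sum_distrib_left sum.distrib[symmetric]
  by (intro sum_mono) (simp add: abs_mult abs_triangle_ineq[THEN order_trans])

lemma l1_kernel_le:
  fixes Q :: "'n::finite \<Rightarrow> 'n \<Rightarrow> real"
  assumes "\<And>i j. 0 \<le> Q i j" "\<And>i. (\<Sum>j\<in>UNIV. Q i j) = q"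
  shows "l1 (row_apply Q r) \<le> q * l1 r"
proof -
  have "l1 (row_apply Q r) \<le> (\<Sum>j\<in>UNIV. \<Sum>i\<in>UNIV. \<bar>r i\<bar> * Q i j)"
    unfolding l1_def row_apply_def
    by (intro sum_mono order_trans[OF sum_abs]) (use assms in \<open>auto simp: abs_mult\<close>)
  also have "\<dots> = (\<Sum>i\<in>UNIV. \<bar>r i\<bar> * (\<Sum>j\<in>UNIV. Q i j))"
    unfolding sum_distrib_left by (rule sum.swap)
  finally show ?thesis by (simp add: assms l1_def sum_distrib_left mult.commute)
qed

lemma sum_row_apply:
  assumes "\<And>i. (\<Sum>j\<in>UNIV. P i j) = 1"
  shows "sum (row_apply P r) UNIV = sum r UNIV"
proof -
  have "sum (row_apply P r) UNIV = (\<Sum>i\<in>UNIV. r i * (\<Sum>j\<in>UNIV. P i j))"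
    unfolding row_apply_def sum_distrib_left by (rule sum.swap)
  then show ?thesis by (simp add: assms)
qed

lemma row_apply_diff: "row_apply P (\<lambda>i. r i - s i) j = row_apply P r j - row_apply P s j"
  by (simp add: row_apply_def left_diff_distrib sum_subtractf)

text \<open>By linearity the iterated action on row vectors is given by a matrix, whose rows are the
images of the unit vectors.\<close>

lemma row_apply_funpow_linear:
  "(row_apply P ^^ n) r = row_apply (\<lambda>i. (row_apply P ^^ n) (\<lambda>j. of_bool (i = j))) r"
proof (induction n)
  case 0
  then show ?case by (auto simp: row_apply_def fun_eq_iff if_distrib cong: if_cong)
next
  case (Suc n)
  define E where "E i = (row_apply P ^^ n) (\<lambda>j. of_bool (i = j))" for i
  have "row_apply P (row_apply E r) j = (\<Sum>i\<in>UNIV. r i * row_apply P (E i) j)" for j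
    unfolding row_apply_def sum_distrib_left sum_distrib_right mult.assoc by (rule sum.swap)
  moreover have "(row_apply P ^^ Suc n) r = row_apply P (row_apply E r)"
    using Suc by (simp add: E_def[abs_def])
  moreover have "(\<Sum>i\<in>UNIV. r i * row_apply P (E i) j) = row_apply (\<lambda>i. (row_apply P ^^ Suc n) (\<lambda>j. of_bool (i = j))) r j" for j
    by (simp add: E_def row_apply_def[of "\<lambda>i. row_apply P ((row_apply P ^^ n) (\<lambda>j. of_bool (i = j)))" r])
  ultimately show ?case by (simp add: fun_eq_iff)
qed

text \<open>All entries of the \<open>k\<close>-th power exceed some \<open>\<epsilon> > 0\<close>. Subtracting the constant matrix \<open>\<epsilon>\<close> does
not change the action on vectors of total mass 0, but it lowers the row sums below 1.\<close>

lemma doeblin_contraction: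
  fixes P :: "'n::finite \<Rightarrow> 'n \<Rightarrow> real"
  assumes P: "\<And>i j. 0 \<le> P i j" "\<And>i j. R i j \<Longrightarrow> P i j > 0" "\<And>i. (\<Sum>j\<in>UNIV. P i j) = 1"
    and k: "\<And>i j. (R ^^ k) i j"
  obtains q where "0 \<le> q" "q < 1"
    "\<And>r. sum r UNIV = 0 \<Longrightarrow> l1 ((row_apply P ^^ k) r) \<le> q * l1 r"
proof -
  define Q where "Q i = (row_apply P ^^ k) (\<lambda>j. of_bool (i = j))" for i
  have row_mat: "row_apply P = mat_apply (\<lambda>j i. P i j)"
    by (simp add: fun_eq_iff row_apply_def mat_apply_def mult.commute)
  have Qpos: "Q i j > 0" for i j
    unfolding Q_def row_mat
    by (rule mat_apply_funpow_pos[of _ "R\<inverse>\<inverse>" _ i]) (use P k in \<open>auto simp: relpowp_conversep\<close>)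
  have Qsum: "(\<Sum>j\<in>UNIV. Q i j) = 1" for i
  proof -
    have "sum ((row_apply P ^^ n) r) UNIV = sum r UNIV" for n r
      by (induction n) (simp_all add: sum_row_apply[of P, OF P(3)])
    then show ?thesis by (simp add: Q_def)
  qed
  define \<epsilon> where "\<epsilon> = Min (range (\<lambda>(i, j). Q i j))"
  have fin: "finite (range (\<lambda>(i, j). Q i j))" by simp
  have \<epsilon>_pos: "\<epsilon> > 0" unfolding \<epsilon>_def using fin Qpos by (subst Min_gr_iff) auto
  have \<epsilon>_le: "\<epsilon> \<le> Q i j" for i j unfolding \<epsilon>_def by (rule Min_le[OF fin]) (auto intro: rev_image_eqI[of "(i, j)"])
  define q where "q = 1 - CARD('n) * \<epsilon>"
  have qsum: "(\<Sum>j\<in>UNIV. Q i j - \<epsilon>) = q" for i by (simp add: sum_subtractf Qsum q_def)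
  have "0 \<le> q" using qsum[of undefined] \<epsilon>_le by (metis diff_ge_0_iff_ge sum_nonneg)
  moreover have "q < 1" using \<epsilon>_pos by (simp add: q_def)
  moreover have "l1 ((row_apply P ^^ k) r) \<le> q * l1 r" if "sum r UNIV = 0" for r
  proof -
    have "(row_apply P ^^ k) r = row_apply (\<lambda>i j. Q i j - \<epsilon>) r"
      using that unfolding row_apply_funpow_linear[of k P r] Q_def[symmetric]
      by (auto simp: row_apply_def fun_eq_iff right_diff_distrib sum_subtractf sum_distrib_right[symmetric])
    then show ?thesis using l1_kernel_le[of "\<lambda>i j. Q i j - \<epsilon>" q r] \<epsilon>_le qsum by simp
  qed
  ultimately show ?thesis using that by blast
qed

text \<open>Along each residue class modulo \<open>k\<close> the sequence contracts towards a level proportional to the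
perturbation.\<close>

lemma recurrent_decay:
  fixes y :: "nat \<Rightarrow> real"
  assumes q: "0 \<le> q" "q < 1" and "k \<ge> 1" and y: "\<And>m. 0 \<le> y m"
    and rec: "eventually (\<lambda>m. y (m + k) \<le> q * y m + \<delta> m) sequentially" and "\<delta> \<longlonglongrightarrow> 0"
  shows "y \<longlonglongrightarrow> 0"
proof (rule LIMSEQ_I)
  fix e :: real assume "e > 0"
  define L where "L = e / 2"
  have "eventually (\<lambda>m. \<delta> m < (1 - q) * L) sequentially"
    by (rule order_tendstoD(2)[OF \<open>\<delta> \<longlonglongrightarrow> 0\<close>]) (use q \<open>e > 0\<close> in \<open>simp add: L_def\<close>)
  with rec have "eventually (\<lambda>m. y (m + k) - L \<le> q * (y m - L)) sequentially"
    by eventually_elim (simp add: algebra_simps)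
  then obtain M where M: "\<And>m. m \<ge> M \<Longrightarrow> y (m + k) - L \<le> q * (y m - L)"
    by (auto simp: eventually_sequentially)
  have iter: "y (m + j * k) - L \<le> q ^ j * (y m - L)" if "m \<ge> M" for m j
  proof (induction j)
    case (Suc j)
    have "y (m + j * k + k) - L \<le> q * (y (m + j * k) - L)" by (rule M) (use that in simp)
    also have "\<dots> \<le> q * (q ^ j * (y m - L))" using Suc q by (intro mult_left_mono) auto
    finally show ?case by (simp add: algebra_simps)
  qed simp
  define Y where "Y = (\<Sum>m<M+k. y m)"
  have "(\<lambda>j. q ^ j * Y) \<longlonglongrightarrow> 0 * Y" using q by (intro tendsto_intros LIMSEQ_realpow_zero)
  then have "eventually (\<lambda>j. q ^ j * Y < L) sequentially"
    using order_tendstoD(2)[of _ "0::real" sequentially L] \<open>e > 0\<close> by (simp add: L_def)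
  then obtain J where J: "\<And>j. j \<ge> J \<Longrightarrow> q ^ j * Y < L" by (auto simp: eventually_sequentially)
  show "\<exists>no. \<forall>n\<ge>no. norm (y n - 0) < e"
  proof (intro exI[of _ "M + J * k"] allI impI)
    fix n assume n: "n \<ge> M + J * k"
    define j where "j = (n - M) div k"
    define m where "m = M + (n - M) mod k"
    have nm: "n = m + j * k" using n by (simp add: m_def j_def)
    have "j \<ge> J" unfolding j_def using n \<open>k \<ge> 1\<close> by (simp add: div_le_mono less_eq_div_iff_mult_less_eq)
    have "m < M + k" using \<open>k \<ge> 1\<close> by (simp add: m_def)
    then have "y m \<le> Y" unfolding Y_def by (intro member_le_sum) (use y in auto)
    have "y n - L \<le> q ^ j * (y m - L)" unfolding nm by (rule iter) (simp add: m_def)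
    also have "\<dots> \<le> q ^ j * Y" using \<open>y m \<le> Y\<close> q \<open>e > 0\<close> by (intro mult_left_mono) (auto simp: L_def)
    also have "\<dots> < L" by (rule J[OF \<open>j \<ge> J\<close>])
    finally show "norm (y n - 0) < e" using y[of n] by (simp add: L_def)
  qed
qed

lemma sum_lessThan_shift:
  fixes f :: "nat \<Rightarrow> real"
  shows "(\<Sum>m<n + k. f m) = (\<Sum>m<k. f m) + (\<Sum>m<n. f (m + k))"
  by (induction n) (simp_all add: add.assoc)

text \<open>A sequence of vectors of total mass 0 that is driven by \<open>P\<close> and perturbed at each step by at most twice the
decrement of \<open>S\<close>. In the application \<open>r\<close> is the deviation of a chain with killing from the invariant
distribution and \<open>S\<close> is the surviving mass.\<close>

context
  fixes P :: "'n::finite \<Rightarrow> 'n \<Rightarrow> real" and R k r S e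
  assumes P: "\<And>i j. 0 \<le> P i j" "\<And>i j. R i j \<Longrightarrow> P i j > 0" "\<And>i. (\<Sum>j\<in>UNIV. P i j) = 1"
    and k: "\<And>i j. (R ^^ k) i j" "k \<ge> 1"
    and S: "decseq S" "\<And>m. 0 \<le> S m"
    and e: "l1 e \<le> 2"
    and r_sum: "\<And>m. sum (r m) UNIV = 0"
    and r_Suc: "\<And>m j. r (Suc m) j = row_apply P (r m) j - (S m - S (Suc m)) * e j"
begin

text \<open>Over \<open>k\<close> steps the unperturbed chain contracts, and the perturbations add up to at
most \<open>2 (S m - S (m + k))\<close>, since the chain does not increase the norm.\<close>

lemma perturbed_contraction:
  obtains q where "0 \<le> q" "q < 1" "\<And>m. l1 (r (m + k)) \<le> q * l1 (r m) + 2 * (S m - S (m + k))"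
proof -
  obtain q where q: "0 \<le> q" "q < 1" "\<And>r. sum r UNIV = 0 \<Longrightarrow> l1 ((row_apply P ^^ k) r) \<le> q * l1 r"
    using doeblin_contraction[of P R k, OF P k(1)] by blast
  have dev: "l1 (\<lambda>j. r (m + n) j - (row_apply P ^^ n) (r m) j) \<le> 2 * (S m - S (m + n))" for m n
  proof (induction n)
    case (Suc n)
    define s where "s j = r (m + n) j - (row_apply P ^^ n) (r m) j" for j
    have "r (m + Suc n) j - (row_apply P ^^ Suc n) (r m) j = row_apply P s j + (S (m + Suc n) - S (m + n)) * e j" for j
      using row_apply_diff[of P "r (m + n)" "(row_apply P ^^ n) (r m)" j]
      by (simp add: r_Suc s_def[abs_def] algebra_simps)
    then have "l1 (\<lambda>j. r (m + Suc n) j - (row_apply P ^^ Suc n) (r m) j)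
        \<le> l1 (row_apply P s) + \<bar>S (m + Suc n) - S (m + n)\<bar> * l1 e"
      using l1_add_scaled[of "row_apply P s"] by simp
    also have "\<bar>S (m + Suc n) - S (m + n)\<bar> = S (m + n) - S (m + Suc n)"
      using decseqD[OF S(1), of "m + n" "m + Suc n"] by simp
    also have "(S (m + n) - S (m + Suc n)) * l1 e \<le> (S (m + n) - S (m + Suc n)) * 2"
      using decseqD[OF S(1), of "m + n" "m + Suc n"] e by (intro mult_left_mono) auto
    also have "l1 (row_apply P s) \<le> 1 * l1 s" by (rule l1_kernel_le[of P, OF P(1,3)])
    also have "l1 s \<le> 2 * (S m - S (m + n))" using Suc by (simp add: s_def[abs_def])
    finally show ?case by simp
  qed (simp add: l1_def)
  have "l1 (r (m + k)) \<le> q * l1 (r m) + 2 * (S m - S (m + k))" for m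
  proof -
    have "l1 (r (m + k)) \<le> l1 ((row_apply P ^^ k) (r m)) + 1 * l1 (\<lambda>j. r (m + k) j - (row_apply P ^^ k) (r m) j)"
      using l1_add_scaled[of "(row_apply P ^^ k) (r m)" 1 "\<lambda>j. r (m + k) j - (row_apply P ^^ k) (r m) j"] by simp
    then show ?thesis using q(3)[OF r_sum, of m] dev[of m k] by linarith
  qed
  then show ?thesis using q that by blast
qed

text \<open>The perturbations have finite total size \<open>S 0\<close>, and a contraction keeps summability.\<close>

lemma perturbed_chain_summable: "summable (\<lambda>m. l1 (r m))"
proof -
  obtain q where q: "0 \<le> q" "q < 1" "\<And>m. l1 (r (m + k)) \<le> q * l1 (r m) + 2 * (S m - S (m + k))"
    using perturbed_contraction by blast
  define A where "A = (\<Sum>m<k. l1 (r m)) + 2 * (k * S 0)"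
  have tele: "(\<Sum>m<n. S m - S (m + k)) \<le> k * S 0" for n
  proof -
    have "(\<Sum>m<n. S m) \<le> (\<Sum>m<n + k. S m)" using S by (intro sum_mono2) auto
    also have "\<dots> = (\<Sum>m<k. S m) + (\<Sum>m<n. S (m + k))"
      by (rule sum_lessThan_shift)
    also have "(\<Sum>m<k. S m) \<le> (\<Sum>m<k. S 0)" by (intro sum_mono decseqD[OF S(1)]) auto
    finally show ?thesis by (simp add: sum_subtractf)
  qed
  have "(\<Sum>m<n. l1 (r m)) \<le> A / (1 - q)" for n
  proof -
    have "(\<Sum>m<n. l1 (r m)) \<le> (\<Sum>m<n + k. l1 (r m))" using l1_nonneg by (intro sum_mono2) auto
    also have "\<dots> = (\<Sum>m<k. l1 (r m)) + (\<Sum>m<n. l1 (r (m + k)))"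
      by (rule sum_lessThan_shift)
    also have "(\<Sum>m<n. l1 (r (m + k))) \<le> (\<Sum>m<n. q * l1 (r m) + 2 * (S m - S (m + k)))"
      by (intro sum_mono q)
    also have "\<dots> = q * (\<Sum>m<n. l1 (r m)) + 2 * (\<Sum>m<n. S m - S (m + k))"
      by (simp add: sum.distrib sum_distrib_left)
    finally have "(1 - q) * (\<Sum>m<n. l1 (r m)) \<le> A"
      using tele[of n] by (simp add: A_def algebra_simps)
    then show ?thesis using q by (simp add: field_simps)
  qed
  then show ?thesis by (intro summableI_nonneg_bounded[of _ "A / (1 - q)"]) (auto simp: l1_nonneg)
qed

text \<open>If \<open>S m\<close> is of order \<open>1 / sqrt m\<close> with a limit, then its increments over \<open>k\<close> steps are of
smaller order, and so is the perturbed chain.\<close>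

lemma perturbed_chain_negligible:
  assumes lim: "(\<lambda>m. sqrt m * S m) \<longlonglongrightarrow> c"
  shows "(\<lambda>m. sqrt m * l1 (r m)) \<longlonglongrightarrow> 0"
proof -
  obtain q where q: "0 \<le> q" "q < 1" "\<And>m. l1 (r (m + k)) \<le> q * l1 (r m) + 2 * (S m - S (m + k))"
    using perturbed_contraction by blast
  define q' where "q' = (1 + q) / 2"
  have q': "0 \<le> q'" "q' < 1" "q < q'" using q by (auto simp: q'_def)
  define \<delta> where "\<delta> m = 2 * (sqrt (m + k) * S m - sqrt (m + k) * S (m + k))" for m
  have ratio: "(\<lambda>m. sqrt (real (m + k)) / sqrt (real m)) \<longlonglongrightarrow> 1" by real_asymp
  have 1: "(\<lambda>m. sqrt (m + k) * S m) \<longlonglongrightarrow> 1 * c"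
  proof (rule Lim_transform_eventually[OF tendsto_mult[OF ratio lim]])
    show "eventually (\<lambda>m. sqrt (real (m + k)) / sqrt (real m) * (sqrt (real m) * S m) = sqrt (real (m + k)) * S m) sequentially"
      using eventually_gt_at_top[of 0] by eventually_elim simp
  qed
  have "(\<lambda>m. sqrt (m + k) * S (m + k)) \<longlonglongrightarrow> c"
    using LIMSEQ_ignore_initial_segment[OF lim, of k] by simp
  then have "\<delta> \<longlonglongrightarrow> 2 * (1 * c - c)" unfolding \<delta>_def by (intro tendsto_intros 1)
  then have \<delta>: "\<delta> \<longlonglongrightarrow> 0" by simp
  have "(\<lambda>m. q * (sqrt (real (m + k)) / sqrt (real m))) \<longlonglongrightarrow> q * 1" by (intro tendsto_intros ratio)
  then have ev: "eventually (\<lambda>m. q * (sqrt (real (m + k)) / sqrt (real m)) < q') sequentially"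
    by (rule order_tendstoD(2)) (use q' in simp)
  show ?thesis
  proof (rule recurrent_decay[OF q'(1,2) k(2) _ _ \<delta>])
    show "eventually (\<lambda>m. sqrt (real (m + k)) * l1 (r (m + k)) \<le> q' * (sqrt (real m) * l1 (r m)) + \<delta> m) sequentially"
      using ev eventually_gt_at_top[of 0]
    proof eventually_elim
      case (elim m)
      have "sqrt (real (m + k)) * l1 (r (m + k)) \<le> sqrt (real (m + k)) * (q * l1 (r m) + 2 * (S m - S (m + k)))"
        by (intro mult_left_mono q) auto
      also have "\<dots> = q * (sqrt (real (m + k)) / sqrt (real m)) * (sqrt (real m) * l1 (r m)) + \<delta> m"
        using elim by (simp add: \<delta>_def algebra_simps)
      also have "q * (sqrt (real (m + k)) / sqrt (real m)) * (sqrt (real m) * l1 (r m)) \<le> q' * (sqrt (real m) * l1 (r m))"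
        using elim l1_nonneg[of "r m"] by (intro mult_right_mono) auto
      finally show ?case by simp
    qed
  qed (auto simp: l1_nonneg)
qed

end

section \<open>Exponential series in two variables\<close>

text \<open>With \<open>a\<close> and \<open>c\<close> the length and the height of a walk, this is a generating function in the logarithmic
variables; partial derivatives only multiply the coefficient \<open>b\<close> by \<open>a\<close> or \<open>c\<close>.\<close>

definition dseries :: "'a set \<Rightarrow> ('a \<Rightarrow> real) \<Rightarrow> ('a \<Rightarrow> real) \<Rightarrow> ('a \<Rightarrow> real) \<Rightarrow> real \<Rightarrow> real \<Rightarrow> real" where
  "dseries A a c b s u = (\<Sum>\<^sub>\<infinity>w\<in>A. b w * exp (a w * s + c w * u))"

text \<open>Convergence slightly to the right in the first variable. If \<open>|c| \<le> a\<close>, this yields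
convergence in a neighbourhood, in both variables.\<close>

definition dconv :: "'a set \<Rightarrow> ('a \<Rightarrow> real) \<Rightarrow> ('a \<Rightarrow> real) \<Rightarrow> ('a \<Rightarrow> real) \<Rightarrow> real \<Rightarrow> real \<Rightarrow> bool" where
  "dconv A a c b s u \<longleftrightarrow> (\<exists>e>0. (\<lambda>w. \<bar>b w\<bar> * exp (a w * (s + e) + c w * u)) summable_on A)"

text \<open>A factor of size \<open>a w\<close> is absorbed by \<open>exp (a w * e / 2)\<close>; hence all derivatives converge as well.\<close>

lemma dconv_mult:
  assumes "dconv A a c b s u" and g: "\<And>w. w \<in> A \<Longrightarrow> \<bar>g w\<bar> \<le> a w"
  shows "dconv A a c (\<lambda>w. g w * b w) s u"
proof -
  obtain e where e: "e > 0" and sm: "(\<lambda>w. \<bar>b w\<bar> * exp (a w * (s + e) + c w * u)) summable_on A"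
    using assms by (auto simp: dconv_def)
  have "(\<lambda>w. \<bar>g w * b w\<bar> * exp (a w * (s + e/2) + c w * u)) summable_on A"
  proof (rule summable_on_comparison_test[OF summable_on_cmult_right[OF sm, of "2 / e"]])
    fix w assume w: "w \<in> A"
    have "a w * e / 2 \<le> exp (a w * e / 2)" using exp_ge_add_one_self[of "a w * e / 2"] by linarith
    then have "a w \<le> 2 / e * exp (a w * e / 2)" using e by (simp add: field_simps)
    then have "\<bar>g w\<bar> \<le> 2 / e * exp (a w * e / 2)" using g[OF w] by linarith
    then have "\<bar>g w\<bar> * (\<bar>b w\<bar> * exp (a w * (s + e/2) + c w * u))
      \<le> (2 / e * exp (a w * e / 2)) * (\<bar>b w\<bar> * exp (a w * (s + e/2) + c w * u))"
      by (intro mult_right_mono) auto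
    also have "\<dots> = 2 / e * (\<bar>b w\<bar> * (exp (a w * e / 2) * exp (a w * (s + e/2) + c w * u)))" by (simp add: mult_ac)
    also have "exp (a w * e / 2) * exp (a w * (s + e/2) + c w * u) = exp (a w * (s + e) + c w * u)"
      unfolding exp_add[symmetric] by (simp add: field_simps)
    finally show "\<bar>g w * b w\<bar> * exp (a w * (s + e/2) + c w * u) \<le> 2 / e * (\<bar>b w\<bar> * exp (a w * (s + e) + c w * u))"
      by (simp add: abs_mult mult_ac)
  qed auto
  with e show ?thesis by (auto simp: dconv_def intro!: exI[of _ "e/2"])
qed

lemma exp_taylor_remainder: "\<bar>exp z - 1 - z\<bar> \<le> z\<^sup>2 * exp \<bar>z\<bar>" for z :: real
proof -
  obtain t where t: "\<bar>t\<bar> \<le> \<bar>z\<bar>" "exp z = (\<Sum>m<2. z ^ m / fact m) + exp t / fact 2 * z ^ 2"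
    using Maclaurin_exp_le[of z 2] by blast
  have "exp z - 1 - z = exp t / 2 * z\<^sup>2" using t(2) by (simp add: numeral_2_eq_2)
  then have "\<bar>exp z - 1 - z\<bar> = \<bar>exp t / 2 * z\<^sup>2\<bar>" by (simp only:)
  also have "\<dots> = exp t / 2 * z\<^sup>2" by (simp add: abs_mult)
  also have "\<dots> \<le> exp \<bar>z\<bar> * z\<^sup>2"
  proof (intro mult_right_mono)
    have "exp t \<le> exp \<bar>z\<bar>" using t(1) by simp
    then show "exp t / 2 \<le> exp \<bar>z\<bar>" using exp_gt_zero[of t] by linarith
  qed auto
  finally show ?thesis by (simp add: mult.commute)
qed

lemma dconv_summable:
  assumes "dconv A a c b s u" and a: "\<And>w. w \<in> A \<Longrightarrow> 0 \<le> a w"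
  shows "(\<lambda>w. b w * exp (a w * s + c w * u)) summable_on A"
proof -
  obtain e where e: "e > 0" and sm: "(\<lambda>w. \<bar>b w\<bar> * exp (a w * (s + e) + c w * u)) summable_on A"
    using assms by (auto simp: dconv_def)
  have "(\<lambda>w. norm (b w * exp (a w * s + c w * u))) summable_on A"
    by (rule summable_on_comparison_test[OF sm])
       (use a e in \<open>auto simp: abs_mult intro!: mult_left_mono\<close>)
  then show ?thesis by (rule summable_on_iff_abs_summable_on_real[THEN iffD2])
qed

text \<open>The second-order Taylor remainder of each exponential is dominated by a fixed multiple of the
term of the series at \<open>s + e\<close>, so the remainders sum to a quadratic error.\<close>

theorem dseries_has_derivative:
  assumes conv: "dconv A a c b s u" and c: "\<And>w. w \<in> A \<Longrightarrow> \<bar>c w\<bar> \<le> a w"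
  shows "((\<lambda>p. dseries A a c b (fst p) (snd p)) has_derivative
    (\<lambda>p. dseries A a c (\<lambda>w. a w * b w) s u * fst p + dseries A a c (\<lambda>w. c w * b w) s u * snd p)) (at (s, u))"
proof -
  obtain e where e: "e > 0" and sm: "(\<lambda>w. \<bar>b w\<bar> * exp (a w * (s + e) + c w * u)) summable_on A"
    using conv by (auto simp: dconv_def)
  define E where "E w = \<bar>b w\<bar> * exp (a w * (s + e) + c w * u)" for w
  define f where "f w p = b w * exp (a w * fst p + c w * snd p)" for w and p :: "real \<times> real"
  define K where "K = 16 / e\<^sup>2 * infsum E A"
  have a: "0 \<le> a w" if "w \<in> A" for w using c[OF that] by linarith
  have sE: "E summable_on A" using sm by (simp add: E_def[abs_def])
  have E_nonneg: "0 \<le> E w" for w by (simp add: E_def)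
  have sa: "(\<lambda>w. a w * b w * exp (a w * s + c w * u)) summable_on A"
    by (intro dconv_summable dconv_mult conv) (use a in auto)
  have sc: "(\<lambda>w. c w * b w * exp (a w * s + c w * u)) summable_on A"
    by (intro dconv_summable dconv_mult conv) (use a c in auto)
  have s0: "f w (s, u) = b w * exp (a w * s + c w * u)" for w by (simp add: f_def)
  have sf0: "(\<lambda>w. f w (s, u)) summable_on A"
    unfolding s0 by (intro dconv_summable conv) (use a in auto)
  have near: "\<bar>a w * ds + c w * du\<bar> \<le> a w * (\<bar>ds\<bar> + \<bar>du\<bar>)" if "w \<in> A" for w ds du
  proof -
    have "\<bar>c w * du\<bar> \<le> a w * \<bar>du\<bar>" unfolding abs_mult using c[OF that] by (intro mult_right_mono) auto
    moreover have "\<bar>a w * ds\<bar> = a w * \<bar>ds\<bar>" using a[OF that] by (simp add: abs_mult)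
    ultimately show ?thesis by (simp add: distrib_left)
  qed
  show ?thesis
  proof (rule has_derivativeI_sandwich[where e = "e / 4" and H = "\<lambda>p. 4 * K * norm (p - (s, u))"])
    show "bounded_linear (\<lambda>p. dseries A a c (\<lambda>w. a w * b w) s u * fst p + dseries A a c (\<lambda>w. c w * b w) s u * snd p)"
      by (intro bounded_linear_add bounded_linear_mult_right[THEN bounded_linear_compose] bounded_linear_fst bounded_linear_snd)
    have "((\<lambda>p. 4 * K * norm (p - (s, u))) \<longlongrightarrow> 4 * K * norm ((s, u) - (s, u))) (at (s, u))"
      by (intro tendsto_intros)
    then show "((\<lambda>p. 4 * K * norm (p - (s, u))) \<longlongrightarrow> 0) (at (s, u))" by simp
  next
    fix p :: "real \<times> real" assume p: "p \<noteq> (s, u)" "dist p (s, u) < e / 4"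
    define ds where "ds = fst p - s"
    define du where "du = snd p - u"
    define \<delta> where "\<delta> = \<bar>ds\<bar> + \<bar>du\<bar>"
    have "p - (s, u) = (ds, du)" by (cases p) (simp add: ds_def du_def)
    then have "\<bar>ds\<bar> \<le> norm (p - (s, u))" "\<bar>du\<bar> \<le> norm (p - (s, u))"
      using norm_fst_le[of ds du] norm_snd_le[of du ds] by auto
    then have \<delta>: "0 \<le> \<delta>" "\<delta> \<le> 2 * norm (p - (s, u))" "\<delta> \<le> e / 2"
      using p by (auto simp: \<delta>_def dist_norm)
    have exp_w: "exp (a w * fst p + c w * snd p) = exp (a w * s + c w * u) * exp (a w * ds + c w * du)" for w
      unfolding exp_add[symmetric] by (simp add: ds_def du_def algebra_simps)
    define g where "g w = f w p - f w (s, u) - (a w * b w * exp (a w * s + c w * u) * ds + c w * b w * exp (a w * s + c w * u) * du)" for w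
    have g_bound: "\<bar>g w\<bar> \<le> 16 / e\<^sup>2 * \<delta>\<^sup>2 * E w" if w: "w \<in> A" for w
    proof -
      define z where "z = a w * ds + c w * du"
      have z: "\<bar>z\<bar> \<le> a w * \<delta>" unfolding z_def \<delta>_def by (rule near[OF w])
      have "g w = b w * exp (a w * s + c w * u) * (exp z - 1 - z)"
        unfolding g_def f_def exp_w z_def by (simp add: algebra_simps)
      then have "\<bar>g w\<bar> = \<bar>b w\<bar> * exp (a w * s + c w * u) * \<bar>exp z - 1 - z\<bar>" by (simp add: abs_mult)
      also have "\<bar>exp z - 1 - z\<bar> \<le> z\<^sup>2 * exp \<bar>z\<bar>" by (rule exp_taylor_remainder)
      also have "\<dots> \<le> (a w * \<delta>)\<^sup>2 * exp (a w * e / 2)"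
      proof (intro mult_mono)
        show "z\<^sup>2 \<le> (a w * \<delta>)\<^sup>2" using z by (metis abs_ge_zero order_trans power2_abs power_mono)
        have "a w * \<delta> \<le> a w * (e / 2)" using \<delta> a[OF w] by (intro mult_left_mono) auto
        then show "exp \<bar>z\<bar> \<le> exp (a w * e / 2)" using z by simp
      qed auto
      also have "(a w * \<delta>)\<^sup>2 = (a w)\<^sup>2 * \<delta>\<^sup>2" by (simp add: power_mult_distrib)
      also have "(a w)\<^sup>2 \<le> 16 / e\<^sup>2 * exp (a w * e / 2)"
      proof -
        have "a w * e / 4 \<le> exp (a w * e / 4)" using exp_ge_add_one_self[of "a w * e / 4"] by linarith
        then have "(a w * e / 4)\<^sup>2 \<le> (exp (a w * e / 4))\<^sup>2" using a[OF w] e by (intro power_mono) auto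
        also have "\<dots> = exp (a w * e / 2)" unfolding exp_double[symmetric] by simp
        finally show ?thesis using e by (simp add: power_mult_distrib power_divide field_simps)
      qed
      finally have "\<bar>g w\<bar> \<le> \<bar>b w\<bar> * exp (a w * s + c w * u) * (16 / e\<^sup>2 * exp (a w * e / 2) * \<delta>\<^sup>2 * exp (a w * e / 2))"
        by (simp add: mult_left_mono mult_right_mono)
      also have "\<dots> = 16 / e\<^sup>2 * \<delta>\<^sup>2 * (\<bar>b w\<bar> * (exp (a w * s + c w * u) * (exp (a w * e / 2) * exp (a w * e / 2))))"
        by (simp add: mult_ac)
      also have "exp (a w * s + c w * u) * (exp (a w * e / 2) * exp (a w * e / 2)) = exp (a w * (s + e) + c w * u)"
        unfolding exp_add[symmetric] by (simp add: field_simps)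
      finally show ?thesis by (simp add: E_def)
    qed
    note s1 = summable_on_cmult_left[OF sa, of ds] and s2 = summable_on_cmult_left[OF sc, of du]
    have sK: "(\<lambda>w. 16 / e\<^sup>2 * \<delta>\<^sup>2 * E w) summable_on A" by (intro summable_on_cmult_right sE)
    have gn: "(\<lambda>w. norm (g w)) summable_on A"
      by (rule summable_on_comparison_test[OF sK]) (use g_bound in auto)
    have sg: "g summable_on A" by (rule summable_on_iff_abs_summable_on_real[THEN iffD2, OF gn])
    have eq: "dseries A a c b (fst p) (snd p) - dseries A a c b (fst (s, u)) (snd (s, u))
        - (dseries A a c (\<lambda>w. a w * b w) s u * fst (p - (s, u)) + dseries A a c (\<lambda>w. c w * b w) s u * snd (p - (s, u)))
        = infsum g A"
    proof -
      have "f w p = f w (s, u) + (a w * b w * exp (a w * s + c w * u) * ds + c w * b w * exp (a w * s + c w * u) * du) + g w" for w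
        by (simp add: g_def)
      then have "infsum (\<lambda>w. f w p) A = infsum (\<lambda>w. f w (s, u)) A
          + infsum (\<lambda>w. a w * b w * exp (a w * s + c w * u) * ds + c w * b w * exp (a w * s + c w * u) * du) A + infsum g A"
        using infsum_add[OF summable_on_add[OF sf0 summable_on_add[OF s1 s2]] sg] infsum_add[OF sf0 summable_on_add[OF s1 s2]]
        by simp
      also have "infsum (\<lambda>w. a w * b w * exp (a w * s + c w * u) * ds + c w * b w * exp (a w * s + c w * u) * du) A
        = infsum (\<lambda>w. a w * b w * exp (a w * s + c w * u)) A * ds + infsum (\<lambda>w. c w * b w * exp (a w * s + c w * u)) A * du"
        unfolding infsum_add[OF s1 s2] infsum_cmult_left[OF sa] infsum_cmult_left[OF sc] ..
      finally show ?thesis by (simp add: dseries_def f_def ds_def du_def)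
    qed
    from gn have "norm (infsum g A) \<le> infsum (\<lambda>w. norm (g w)) A" by (rule norm_infsum_bound)
    also have "\<dots> \<le> infsum (\<lambda>w. 16 / e\<^sup>2 * \<delta>\<^sup>2 * E w) A"
      by (rule infsum_mono[OF gn sK]) (use g_bound in auto)
    also have "\<dots> = 16 / e\<^sup>2 * \<delta>\<^sup>2 * infsum E A" by (rule infsum_cmult_right[OF sE])
    also have "\<dots> = \<delta>\<^sup>2 * K" by (simp add: K_def)
    also have "\<dots> \<le> (2 * norm (p - (s, u)))\<^sup>2 * K"
      using \<delta> infsum_nonneg[of A E, OF E_nonneg] e by (intro mult_right_mono power_mono) (auto simp: K_def)
    finally have "norm (infsum g A) \<le> 4 * K * norm (p - (s, u)) * norm (p - (s, u))"
      by (simp add: power2_eq_square mult_ac)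
    then show "norm (dseries A a c b (fst p) (snd p) - dseries A a c b (fst (s, u)) (snd (s, u))
        - (dseries A a c (\<lambda>w. a w * b w) s u * fst (p - (s, u)) + dseries A a c (\<lambda>w. c w * b w) s u * snd (p - (s, u)))) / norm (p - (s, u))
        \<le> 4 * K * norm (p - (s, u))"
      unfolding eq using p(1) by (simp add: divide_le_eq)
  qed (use e in auto)
qed

text \<open>The implicit function theorem when the curve is already known to be Lipschitz: the
linearisation of \<open>F\<close> along the curve then has error \<open>o (|z - u|)\<close>.\<close>

lemma implicit_curve_derivative:
  fixes \<phi> :: "real \<Rightarrow> real"
  assumes F: "((\<lambda>p. F (fst p) (snd p)) has_derivative (\<lambda>p. a * fst p + b * snd p)) (at (\<phi> u, u))"
    and "a \<noteq> 0" and const: "\<And>z. F (\<phi> z) z = c" and lip: "\<And>z. \<bar>\<phi> z - \<phi> u\<bar> \<le> \<bar>z - u\<bar>"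
  shows "(\<phi> has_real_derivative - b / a) (at u)"
  unfolding has_field_derivative_iff
proof (rule LIM_I)
  fix e :: real assume "e > 0"
  define e' where "e' = e * \<bar>a\<bar> / 4"
  have "e' > 0" using \<open>e > 0\<close> \<open>a \<noteq> 0\<close> by (simp add: e'_def)
  from F[unfolded has_derivative_at_alt, THEN conjunct2, rule_format, OF this]
  obtain d where "d > 0" and d: "\<And>p. norm (p - (\<phi> u, u)) < d \<Longrightarrow>
      norm (F (fst p) (snd p) - F (fst (\<phi> u, u)) (snd (\<phi> u, u)) - (a * fst (p - (\<phi> u, u)) + b * snd (p - (\<phi> u, u)))) \<le> e' * norm (p - (\<phi> u, u))"
    by blast
  show "\<exists>s>0. \<forall>z. z \<noteq> u \<and> norm (z - u) < s \<longrightarrow> norm ((\<phi> z - \<phi> u) / (z - u) - - b / a) < e"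
  proof (intro exI[of _ "d / 2"] conjI allI impI)
    fix z assume z: "z \<noteq> u \<and> norm (z - u) < d / 2"
    have np: "norm ((\<phi> z, z) - (\<phi> u, u)) \<le> 2 * \<bar>z - u\<bar>"
    proof -
      have "norm ((\<phi> z, z) - (\<phi> u, u)) \<le> norm (\<phi> z - \<phi> u) + norm (z - u)"
        using norm_triangle_ineq[of "(\<phi> z - \<phi> u, 0)" "(0, z - u)"] by simp
      then show ?thesis using lip[of z] by simp
    qed
    have "\<bar>a * (\<phi> z - \<phi> u) + b * (z - u)\<bar> \<le> e' * norm ((\<phi> z, z) - (\<phi> u, u))"
    proof -
      have "norm ((\<phi> z, z) - (\<phi> u, u)) < d" by (rule le_less_trans[OF np]) (use z in simp)
      from d[OF this] show ?thesis
        by (simp only: const fst_conv snd_conv fst_diff snd_diff diff_self diff_0 abs_minus_cancel real_norm_def)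
    qed
    also have "\<dots> \<le> e' * (2 * \<bar>z - u\<bar>)" using np \<open>e' > 0\<close> by (intro mult_left_mono) auto
    also have "\<dots> < e * \<bar>a\<bar> * \<bar>z - u\<bar>" using z \<open>e > 0\<close> \<open>a \<noteq> 0\<close> by (simp add: e'_def)
    finally have *: "\<bar>a * (\<phi> z - \<phi> u) + b * (z - u)\<bar> < e * (\<bar>a\<bar> * \<bar>z - u\<bar>)" by simp
    have "(\<phi> z - \<phi> u) / (z - u) - - b / a = (a * (\<phi> z - \<phi> u) + b * (z - u)) / (a * (z - u))"
      using z \<open>a \<noteq> 0\<close> by (simp add: field_simps)
    then have "norm ((\<phi> z - \<phi> u) / (z - u) - - b / a) = \<bar>a * (\<phi> z - \<phi> u) + b * (z - u)\<bar> / (\<bar>a\<bar> * \<bar>z - u\<bar>)"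
      by (simp only: real_norm_def abs_divide abs_mult)
    also have "\<dots> < e" using * z \<open>a \<noteq> 0\<close> by (subst pos_divide_less_eq) auto
    finally show "norm ((\<phi> z - \<phi> u) / (z - u) - - b / a) < e" .
  qed (use \<open>d > 0\<close> in auto)
qed

section \<open>The Perron root of a weighted two-step rule\<close>

locale weighted_rule =
  fixes R :: rule and x :: real
  assumes aper: "aperiodic R" and unbounded: "vertically_unbounded R" and x_pos: "0 < x"
begin

definition wt :: "real \<Rightarrow> real \<Rightarrow> step \<Rightarrow> real" where
  "wt s u j = x powi step_x j * exp (s + real_of_int (step_y j) * u)"

definition M :: "real \<Rightarrow> real \<Rightarrow> step \<Rightarrow> step \<Rightarrow> real" where
  "M s u i j = of_bool (R i j) * wt s u j"

lemma wt_pos: "wt s u j > 0"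
  unfolding wt_def by (intro mult_pos_pos zero_less_power_int x_pos exp_gt_zero)

lemma M_nonneg: "0 \<le> M s u i j" using wt_pos[of s u j] by (simp add: M_def)

lemma M_pos: "R i j \<Longrightarrow> 0 < M s u i j" using wt_pos[of s u j] by (simp add: M_def)

lemma wt_shift: "wt s u j = exp (s - s') * wt s' u j"
  by (simp add: wt_def exp_diff exp_add)

lemma M_shift: "M s u i j = exp (s - s') * M s' u i j"
  by (simp add: M_def wt_shift[of s u j s'])

text \<open>A positive entry of a power of the transfer matrix means that the relation has a path of that length.\<close>

lemma relpowp_all: obtains k where "k \<ge> 1" "\<And>i j. (R ^^ k) i j"
proof -
  have *: "((\<lambda>M. M ** transfer_matrix R) ^^ k) (mat 1) $ i $ j > 0 \<Longrightarrow> (R ^^ k) i j" for k i j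
  proof (induction k arbitrary: j)
    case 0
    then show ?case by (simp add: mat_def split: if_splits)
  next
    case (Suc k)
    then have "(\<Sum>l\<in>UNIV. ((\<lambda>M. M ** transfer_matrix R) ^^ k) (mat 1) $ i $ l * transfer_matrix R $ l $ j) > 0"
      by (simp add: matrix_matrix_mult_def)
    then have "(\<Sum>l\<in>UNIV. ((\<lambda>M. M ** transfer_matrix R) ^^ k) (mat 1) $ i $ l * transfer_matrix R $ l $ j) \<noteq> 0"
      by (rule gr_implies_not0)
    then obtain l where "((\<lambda>M. M ** transfer_matrix R) ^^ k) (mat 1) $ i $ l * transfer_matrix R $ l $ j \<noteq> 0"
      by (rule sum.not_neutral_contains_not_neutral)
    then have "((\<lambda>M. M ** transfer_matrix R) ^^ k) (mat 1) $ i $ l > 0" "R l j"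
      by (auto simp: transfer_matrix_def of_bool_def split: if_splits)
    then show ?case using Suc.IH by auto
  qed
  obtain k where "k \<ge> 1" "\<forall>i j. ((\<lambda>M. M ** transfer_matrix R) ^^ k) (mat 1) $ i $ j > 0"
    using aper unfolding aperiodic_def by (elim exE conjE)
  then show ?thesis using that[of k] * by simp
qed

definition perron_data :: "real \<Rightarrow> real \<times> (step \<Rightarrow> real) \<times> (step \<Rightarrow> real) \<Rightarrow> bool" where
  "perron_data u = (\<lambda>(s, v, l). (\<forall>i. v i > 0) \<and> (\<forall>i. l i > 0)
     \<and> (\<forall>i. (\<Sum>j\<in>UNIV. M s u i j * v j) = v i) \<and> (\<forall>j. (\<Sum>i\<in>UNIV. l i * M s u i j) = l j))"

text \<open>The logarithm of \<open>rho\<close> as a function of \<open>u = ln y\<close> (see \<open>rho_exp\<close>), with the right and left eigenvectors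
\<open>v\<close> and \<open>l\<close> of the matrix at this point. They are determined up to positive factors, which cancel in the results.\<close>

definition lnrho :: "real \<Rightarrow> real" where "lnrho u = fst (SOME p. perron_data u p)"
definition v :: "real \<Rightarrow> step \<Rightarrow> real" where "v u = fst (snd (SOME p. perron_data u p))"
definition l :: "real \<Rightarrow> step \<Rightarrow> real" where "l u = snd (snd (SOME p. perron_data u p))"

lemma perron_data: "perron_data u (lnrho u, v u, l u)"
proof -
  obtain k where k: "k \<ge> 1" "\<And>i j. (R ^^ k) i j" using relpowp_all by blast
  obtain c v l where c: "c > 0" and vl: "\<And>i. v i > 0" "\<And>i. l i > 0"
    "\<And>i. (\<Sum>j\<in>UNIV. M 0 u i j * v j) = c * v i" "\<And>j. (\<Sum>i\<in>UNIV. l i * M 0 u i j) = c * l j"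
    using perron_eigenvectors[of "M 0 u" R k, OF M_nonneg M_pos k(2,1)] by blast
  have M: "M (- ln c) u i j = M 0 u i j / c" for i j
    using M_shift[of "- ln c" u i j 0] c by (simp add: exp_minus divide_inverse)
  have "perron_data u (- ln c, v, l)"
    using c vl by (simp add: perron_data_def M sum_divide_distrib[symmetric])
  then have "perron_data u (SOME p. perron_data u p)" by (rule someI)
  then show ?thesis by (simp add: lnrho_def v_def l_def)
qed

lemma v_pos: "v u i > 0" and l_pos: "l u i > 0"
  and M_v: "(\<Sum>j\<in>UNIV. M (lnrho u) u i j * v u j) = v u i"
  and l_M: "(\<Sum>i\<in>UNIV. l u i * M (lnrho u) u i j) = l u j"
  using perron_data[of u] by (auto simp: perron_data_def)

lemma l_M_apply: "(\<Sum>i\<in>UNIV. l u i * (\<Sum>j\<in>UNIV. M s u i j * e j)) = exp (s - lnrho u) * (\<Sum>j\<in>UNIV. l u j * e j)"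
proof -
  have "(\<Sum>i\<in>UNIV. l u i * (\<Sum>j\<in>UNIV. M s u i j * e j)) = (\<Sum>i\<in>UNIV. \<Sum>j\<in>UNIV. exp (s - lnrho u) * (l u i * M (lnrho u) u i j * e j))"
    unfolding sum_distrib_left M_shift[of s u _ _ "lnrho u"] by (simp add: mult_ac)
  also have "\<dots> = (\<Sum>j\<in>UNIV. exp (s - lnrho u) * ((\<Sum>i\<in>UNIV. l u i * M (lnrho u) u i j) * e j))"
    unfolding sum_distrib_right sum_distrib_left by (rule sum.swap)
  finally show ?thesis unfolding l_M by (simp add: sum_distrib_left)
qed

text \<open>Pairing with the left eigenvector: the matrix at \<open>s\<close> multiplies \<open>l u\<close> by \<open>exp (s - lnrho u)\<close>.\<close>

lemma lnrho_ge_subsolution: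
  assumes e: "\<And>i. e i > 0" and sub: "\<And>i. (\<Sum>j\<in>UNIV. M s u i j * e j) \<le> e i"
  shows "s \<le> lnrho u"
proof -
  have "exp (s - lnrho u) * (\<Sum>j\<in>UNIV. l u j * e j) \<le> (\<Sum>i\<in>UNIV. l u i * e i)"
    unfolding l_M_apply[symmetric] using sub l_pos by (intro sum_mono mult_left_mono) (auto intro: less_imp_le)
  moreover have "(\<Sum>i\<in>UNIV. l u i * e i) > 0" using e l_pos by (intro sum_pos) auto
  ultimately have "exp (s - lnrho u) \<le> 1" by simp
  then show ?thesis by simp
qed

text \<open>A step changes the height by at most 1, so a change of \<open>u\<close> by \<open>d\<close> can be compensated by lowering
\<open>s\<close> by \<open>|d|\<close>; the old eigenvector then is a subsolution.\<close>

lemma lnrho_lipschitz: "\<bar>lnrho u' - lnrho u\<bar> \<le> \<bar>u' - u\<bar>"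
proof -
  have "lnrho u - \<bar>u' - u\<bar> \<le> lnrho u'" for u u'
  proof (rule lnrho_ge_subsolution[of "v u"])
    fix i
    have "M (lnrho u - \<bar>u' - u\<bar>) u' i j \<le> M (lnrho u) u i j" for j
    proof -
      have "\<bar>real_of_int (step_y j) * (u' - u)\<bar> \<le> 1 * \<bar>u' - u\<bar>"
        unfolding abs_mult by (intro mult_right_mono) (cases j, auto)
      then have "of_int (step_y j) * u' - \<bar>u' - u\<bar> \<le> of_int (step_y j) * u" by (simp add: algebra_simps)
      then show ?thesis using x_pos by (auto simp: M_def wt_def intro!: mult_left_mono)
    qed
    then have "(\<Sum>j\<in>UNIV. M (lnrho u - \<bar>u' - u\<bar>) u' i j * v u j) \<le> (\<Sum>j\<in>UNIV. M (lnrho u) u i j * v u j)"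
      using v_pos by (intro sum_mono mult_right_mono) (auto intro: less_imp_le)
    then show "(\<Sum>j\<in>UNIV. M (lnrho u - \<bar>u' - u\<bar>) u' i j * v u j) \<le> v u i" by (simp add: M_v)
  qed (rule v_pos)
  from this[of u u'] this[of u' u] show ?thesis by linarith
qed

lemma young_exp: "0 < a \<Longrightarrow> 0 < b \<Longrightarrow> 0 \<le> q \<Longrightarrow> q \<le> 1 \<Longrightarrow> exp ((1 - q) * ln a + q * ln b) \<le> (1 - q) * a + q * b" for a b q :: real
  using convex_onD[OF exp_convex, of q "ln a" "ln b"] by simp

text \<open>Kingman's argument: the weighted geometric mean of two eigenvectors is a subsolution at the
interpolated parameters, by the inequality of the weighted means applied to transition probabilities.\<close>

lemma lnrho_concave: "convex_on UNIV (\<lambda>u. - lnrho u)"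
proof (rule convex_onI)
  fix q u1 u2 :: real assume q: "0 < q" "q < 1"
  define e where "e j = exp ((1 - q) * ln (v u1 j) + q * ln (v u2 j))" for j
  define s where "s = (1 - q) * lnrho u1 + q * lnrho u2"
  define u where "u = (1 - q) * u1 + q * u2"
  have "s \<le> lnrho u"
  proof (rule lnrho_ge_subsolution[of e])
    fix i
    have termwise: "M s u i j * e j \<le> e i * ((1 - q) * (M (lnrho u1) u1 i j * v u1 j / v u1 i) + q * (M (lnrho u2) u2 i j * v u2 j / v u2 i))" for j
    proof (cases "R i j")
      case True
      define a where "a = M (lnrho u1) u1 i j * v u1 j / v u1 i"
      define b where "b = M (lnrho u2) u2 i j * v u2 j / v u2 i"
      have pos: "a > 0" "b > 0" using M_pos[OF True] v_pos by (auto simp: a_def b_def)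
      have lnM: "ln (M s u i j) = ln (x powi step_x j) + (s + real_of_int (step_y j) * u)" for s u
        using True x_pos by (simp add: M_def wt_def ln_mult zero_less_power_int)
      have nz: "M s u i j \<noteq> 0" "v u k \<noteq> 0" for s u k
        using M_pos[OF True, of s u] v_pos[of u k] by auto
      have lna: "ln a = ln (M (lnrho u1) u1 i j) + ln (v u1 j) - ln (v u1 i)"
        by (simp add: a_def ln_div ln_mult nz M_pos[OF True] v_pos)
      have lnb: "ln b = ln (M (lnrho u2) u2 i j) + ln (v u2 j) - ln (v u2 i)"
        by (simp add: b_def ln_div ln_mult nz M_pos[OF True] v_pos)
      have "M s u i j * e j = exp (ln (M s u i j)) * e j" using M_pos[OF True] by simp
      also have "\<dots> = e i * exp ((1 - q) * ln a + q * ln b)"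
        unfolding e_def exp_add[symmetric] lna lnb lnM s_def u_def by (simp add: algebra_simps)
      also have "\<dots> \<le> e i * ((1 - q) * a + q * b)"
        using young_exp[OF pos, of q] q by (intro mult_left_mono) (auto simp: e_def)
      finally show ?thesis by (simp add: a_def b_def)
    qed (use v_pos in \<open>simp add: M_def\<close>)
    have "(\<Sum>j\<in>UNIV. M s u i j * e j) \<le> (\<Sum>j\<in>UNIV. e i * ((1 - q) * (M (lnrho u1) u1 i j * v u1 j / v u1 i) + q * (M (lnrho u2) u2 i j * v u2 j / v u2 i)))"
      by (intro sum_mono termwise)
    also have "\<dots> = e i * ((1 - q) * ((\<Sum>j\<in>UNIV. M (lnrho u1) u1 i j * v u1 j) / v u1 i) + q * ((\<Sum>j\<in>UNIV. M (lnrho u2) u2 i j * v u2 j) / v u2 i))"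
      unfolding sum_distrib_left[symmetric] sum.distrib sum_divide_distrib[symmetric] ..
    also have "\<dots> = e i" unfolding M_v using v_pos[of u1 i] v_pos[of u2 i] by simp
    finally show "(\<Sum>j\<in>UNIV. M s u i j * e j) \<le> e i" .
  qed (simp add: e_def)
  then show "- lnrho ((1 - q) *\<^sub>R u1 + q *\<^sub>R u2) \<le> (1 - q) * - lnrho u1 + q * - lnrho u2"
    by (simp add: s_def u_def)
qed auto

definition ww :: "real \<Rightarrow> real \<Rightarrow> walk \<Rightarrow> real" where
  "ww s u w = x powi end_x w * exp (real (length w) * s + real_of_int (end_y w) * u)"

lemma ww_pos: "ww s u w > 0" unfolding ww_def by (intro mult_pos_pos zero_less_power_int x_pos exp_gt_zero)

lemma ww_Nil [simp]: "ww s u [] = 1" by (simp add: ww_def end_x_def end_y_def)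

lemma ww_Cons: "ww s u (j # w) = wt s u j * ww s u w"
  using x_pos by (simp add: ww_def wt_def end_x_def end_y_def power_int_add exp_add[symmetric] algebra_simps)

lemma gen_fun_exp: "gen_fun A (exp s) x (exp u) = infsum (ww s u) A"
  unfolding gen_fun_def
  by (intro infsum_cong) (simp add: ww_def exp_of_nat_mult[symmetric] exp_add exp_power_int)

text \<open>Iteration of \<open>M v = v\<close> along one path.\<close>

lemma ww_walk_le: "w \<noteq> [] \<Longrightarrow> successively R (i # w) \<Longrightarrow> ww (lnrho u) u w * v u (last w) \<le> v u i"
proof (induction w arbitrary: i)
  case (Cons j w)
  have Rij: "R i j" using Cons.prems by simp
  have step: "wt (lnrho u) u j * v u j \<le> v u i"
  proof -
    have "M (lnrho u) u i j * v u j \<le> (\<Sum>j\<in>UNIV. M (lnrho u) u i j * v u j)"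
      by (rule member_le_sum) (use M_nonneg v_pos[THEN less_imp_le] in auto)
    then have "M (lnrho u) u i j * v u j \<le> v u i" by (simp only: M_v)
    then show ?thesis using Rij by (simp add: M_def)
  qed
  show ?case
  proof (cases "w = []")
    case True
    then show ?thesis using step by (simp add: ww_Cons)
  next
    case False
    then have "ww (lnrho u) u w * v u (last w) \<le> v u j" using Cons by simp
    then have "wt (lnrho u) u j * (ww (lnrho u) u w * v u (last w)) \<le> wt (lnrho u) u j * v u j"
      using wt_pos[of "lnrho u" u j] by (intro mult_left_mono) auto
    then show ?thesis using step False by (simp add: ww_Cons mult.assoc)
  qed
qed simp

text \<open>A closed walk has weight at most 1 on the critical curve.\<close>

lemma lnrho_le_linear:
  assumes w: "w \<noteq> []" "successively R (i # w)" "last w = i"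
  shows "real (length w) * lnrho u + real_of_int (end_y w) * u + real_of_int (end_x w) * ln x \<le> 0"
proof -
  have "ww (lnrho u) u w \<le> 1" using ww_walk_le[OF w(1,2), of u] v_pos[of u i] w(3) by simp
  then have "exp (real_of_int (end_x w) * ln x + (real (length w) * lnrho u + real_of_int (end_y w) * u)) \<le> exp 0"
    using x_pos by (simp add: ww_def exp_add power_int_def exp_of_nat_mult exp_minus power_inverse flip: exp_power_int)
  then show ?thesis by simp
qed

text \<open>The segment between two equal steps of a walk, without the first of them, is a closed walk.\<close>

lemma walk_between:
  assumes w: "w \<in> walks R" "a < b" "b < length w" "w ! a = i" "w ! b = i"
    and none: "\<And>k. a < k \<Longrightarrow> k < b \<Longrightarrow> w ! k \<noteq> j" and "i \<noteq> j"
  obtains c where "c \<noteq> []" "successively R (i # c)" "last c = i" "j \<notin> set c"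
proof -
  define c where "c = take (b - a) (drop (Suc a) w)"
  have len: "length c = b - a" using w by (simp add: c_def)
  have nth: "c ! k = w ! (Suc a + k)" if "k < b - a" for k using that w by (simp add: c_def)
  have "i # c = take (Suc (b - a)) (drop a w)"
    using w Cons_nth_drop_Suc[of a w] by (metis c_def less_trans take_Suc_Cons)
  moreover have "successively R (take (Suc (b - a)) (drop a w))"
  proof -
    have "successively R (take a w @ take (Suc (b - a)) (drop a w) @ drop (Suc (b - a)) (drop a w))"
      unfolding append_take_drop_id using w by (simp add: walks_def)
    then show ?thesis unfolding successively_append_iff by blast
  qed
  ultimately have "successively R (i # c)" by simp
  moreover have "c \<noteq> []" using len w by auto
  moreover have "last c = i" using w len nth[of "b - a - 1"] \<open>c \<noteq> []\<close> by (simp add: last_conv_nth)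
  moreover have "j \<notin> set c"
  proof
    assume "j \<in> set c"
    then obtain k where k: "k < b - a" "c ! k = j" by (auto simp: in_set_conv_nth len)
    then have "Suc a + k < b \<or> Suc a + k = b" by linarith
    then show False using none[of "Suc a + k"] nth[OF k(1)] k w(5) \<open>i \<noteq> j\<close> by auto
  qed
  ultimately show ?thesis using that by blast
qed

lemma end_y_count: "end_y w = int (count_list w North) - int (count_list w South)"
proof (induction w)
  case (Cons j w)
  then show ?case by (cases j) (auto simp: end_y_def)
qed (simp add: end_y_def)

text \<open>A rule that is not north-bound has a closed walk of negative height, one that is not south-bound
has a closed walk of positive height. Each of them bounds \<open>lnrho\<close> on one side by a linear function.\<close>

lemma lnrho_to_minus_infinity:
  obtains a b c d where "a > 0" "c > 0" "\<And>u. lnrho u \<le> a * u + b" "\<And>u. lnrho u \<le> - c * u + d"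
proof -
  have bound: "\<exists>b. \<forall>u. lnrho u \<le> - (real_of_int (end_y w) / length w) * u + b" if "w \<noteq> []" "successively R (i # w)" "last w = i" for w i
  proof (intro exI allI)
    fix u
    show "lnrho u \<le> - (real_of_int (end_y w) / length w) * u + - (real_of_int (end_x w) * ln x) / length w"
      using lnrho_le_linear[OF that, of u] that(1) by (simp add: field_simps)
  qed
  obtain w1 where w1: "w1 \<noteq> []" "successively R (South # w1)" "last w1 = South" "North \<notin> set w1"
  proof -
    obtain w i j where "w \<in> walks R" "i < j" "j < length w" "w ! i = South" "w ! j = South" "\<And>k. i < k \<Longrightarrow> k < j \<Longrightarrow> w ! k \<noteq> North"
      using unbounded unfolding vertically_unbounded_def north_bound_def by blast
    from walk_between[OF this] that show ?thesis by blast
  qed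
  obtain w2 where w2: "w2 \<noteq> []" "successively R (North # w2)" "last w2 = North" "South \<notin> set w2"
  proof -
    obtain w i j where "w \<in> walks R" "i < j" "j < length w" "w ! i = North" "w ! j = North" "\<And>k. i < k \<Longrightarrow> k < j \<Longrightarrow> w ! k \<noteq> South"
      using unbounded unfolding vertically_unbounded_def south_bound_def by blast
    from walk_between[OF this] that show ?thesis by blast
  qed
  have "count_list w1 South > 0" "count_list w2 North > 0"
    using w1 w2 by (metis count_list_0_iff gr0I last_in_set)+
  then have y: "end_y w1 < 0" "end_y w2 > 0"
    using w1(4) w2(4) by (auto simp: end_y_count count_list_0_iff)
  obtain b where b: "\<And>u. lnrho u \<le> - (real_of_int (end_y w1) / length w1) * u + b" using bound[OF w1(1-3)] by blast
  obtain d where d: "\<And>u. lnrho u \<le> - (real_of_int (end_y w2) / length w2) * u + d" using bound[OF w2(1-3)] by blast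
  have "- (real_of_int (end_y w1) / length w1) > 0" "real_of_int (end_y w2) / length w2 > 0"
    using y w1(1) w2(1) by (auto simp: divide_neg_pos)
  then show ?thesis using that b d by blast
qed

section \<open>First-passage generating functions\<close>

text \<open>The walks that start with \<open>j\<close> and end at their first \<open>\<theta>\<close>. The first step is included, also if it is
\<open>\<theta>\<close> itself; \<open>B\<close>, \<open>C\<close> and \<open>D\<close> are sums over such classes.\<close>

definition passage :: "step \<Rightarrow> step \<Rightarrow> walk set" where
  "passage \<theta> j = {w \<in> walks R. hd w = j \<and> first_return \<theta> w}"

lemma passage_self: "passage \<theta> \<theta> = {[\<theta>]}"
proof (intro equalityI subsetI)
  fix w assume w: "w \<in> passage \<theta> \<theta>"
  then obtain w' where w': "w = \<theta> # w'" by (cases w) (auto simp: passage_def walks_def)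
  then have "\<theta> \<notin> set w'" using w by (simp add: passage_def first_return_def count_list_0_iff)
  then have "w' = []" using w w' last_in_set[of w'] by (auto simp: passage_def first_return_def split: if_splits)
  then show "w \<in> {[\<theta>]}" using w' by simp
qed (auto simp: passage_def walks_def first_return_def)

lemma passage_Cons:
  assumes "j \<noteq> \<theta>"
  shows "passage \<theta> j = (#) j ` (\<Union>i\<in>{i. R j i}. passage \<theta> i)"
proof (intro equalityI subsetI)
  fix w assume w: "w \<in> passage \<theta> j"
  then obtain w' where w': "w = j # w'" by (cases w) (auto simp: passage_def walks_def)
  have "w' \<noteq> []" using w w' assms by (auto simp: passage_def first_return_def)
  then have "w' \<in> passage \<theta> (hd w')" "R j (hd w')"
    using w w' assms by (auto simp: passage_def walks_def first_return_def successively_Cons)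
  then show "w \<in> (#) j ` (\<Union>i\<in>{i. R j i}. passage \<theta> i)" using w' by blast
qed (use assms in \<open>auto simp: passage_def walks_def first_return_def successively_Cons\<close>)

lemma passage_disjoint: "i \<noteq> j \<Longrightarrow> passage \<theta> i \<inter> passage \<theta> j = {}" by (auto simp: passage_def)

lemma passage_nonempty: "w \<in> passage \<theta> j \<Longrightarrow> w \<noteq> []" by (auto simp: passage_def walks_def)

lemma finite_bounded_length: "finite {w :: walk. w \<in> A \<and> length w \<le> n}"
  by (rule finite_subset[OF _ finite_lists_length_le[of "UNIV :: step set" n]]) auto

text \<open>A nonnegative supersolution of the one-step equations bounds the finite truncations of their
minimal solution, by induction on the length.\<close>

lemma sum_passage_le:
  assumes e: "\<And>j. 0 \<le> e j"
    and super: "\<And>j. j \<noteq> \<theta> \<Longrightarrow> (\<Sum>i\<in>UNIV. M s u j i * (if i = \<theta> then 1 else e i)) \<le> e j"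
  shows "(\<Sum>w | w \<in> passage \<theta> j \<and> length w \<le> n. ww s u w) \<le> wt s u j * (if j = \<theta> then 1 else e j)"
proof (induction n arbitrary: j)
  case 0
  have "{w. w \<in> passage \<theta> j \<and> length w \<le> 0} = {}" using passage_nonempty by auto
  then show ?case using e[of j] wt_pos[of s u j] by (simp only: sum.empty) auto
next
  case (Suc n)
  show ?case
  proof (cases "j = \<theta>")
    case True
    have "{w. w \<in> passage \<theta> j \<and> length w \<le> Suc n} = {[\<theta>]}" using True by (auto simp: passage_self)
    then show ?thesis using True by (simp add: ww_Cons)
  next
    case False
    have eq: "{w. w \<in> passage \<theta> j \<and> length w \<le> Suc n} = (#) j ` (\<Union>i\<in>{i. R j i}. {w. w \<in> passage \<theta> i \<and> length w \<le> n})"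
      unfolding passage_Cons[OF False] by (auto intro!: imageI)
    have "(\<Sum>w | w \<in> passage \<theta> j \<and> length w \<le> Suc n. ww s u w) = (\<Sum>w\<in>(\<Union>i\<in>{i. R j i}. {w. w \<in> passage \<theta> i \<and> length w \<le> n}). wt s u j * ww s u w)"
      unfolding eq by (subst sum.reindex) (auto simp: ww_Cons)
    also have "\<dots> = (\<Sum>i | R j i. \<Sum>w | w \<in> passage \<theta> i \<and> length w \<le> n. wt s u j * ww s u w)"
      by (rule sum.UNION_disjoint) (use passage_disjoint in \<open>auto simp: finite_bounded_length\<close>)
    also have "\<dots> = wt s u j * (\<Sum>i | R j i. \<Sum>w | w \<in> passage \<theta> i \<and> length w \<le> n. ww s u w)"
      by (simp add: sum_distrib_left)
    also have "\<dots> \<le> wt s u j * (\<Sum>i | R j i. wt s u i * (if i = \<theta> then 1 else e i))"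
      using wt_pos[of s u j] by (intro mult_left_mono sum_mono Suc.IH) auto
    also have "(\<Sum>i | R j i. wt s u i * (if i = \<theta> then 1 else e i)) = (\<Sum>i\<in>UNIV. M s u j i * (if i = \<theta> then 1 else e i))"
      by (rule sum.mono_neutral_cong_left) (auto simp: M_def)
    also have "wt s u j * \<dots> \<le> wt s u j * e j"
      using wt_pos[of s u j] super[OF False] by (intro mult_left_mono) auto
    finally show ?thesis using False by simp
  qed
qed

lemma passage_supersolution:
  assumes e: "\<And>j. 0 \<le> e j"
    and super: "\<And>j. j \<noteq> \<theta> \<Longrightarrow> (\<Sum>i\<in>UNIV. M s u j i * (if i = \<theta> then 1 else e i)) \<le> e j"
  shows "ww s u summable_on passage \<theta> j" "infsum (ww s u) (passage \<theta> j) \<le> wt s u j * (if j = \<theta> then 1 else e j)"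
proof -
  have bd: "sum (ww s u) F \<le> wt s u j * (if j = \<theta> then 1 else e j)" if "finite F" "F \<subseteq> passage \<theta> j" for F
  proof -
    define n where "n = Max (insert 0 (length ` F))"
    have "sum (ww s u) F \<le> (\<Sum>w | w \<in> passage \<theta> j \<and> length w \<le> n. ww s u w)"
    proof (rule sum_mono2)
      show "finite {w. w \<in> passage \<theta> j \<and> length w \<le> n}" by (rule finite_bounded_length)
      show "F \<subseteq> {w. w \<in> passage \<theta> j \<and> length w \<le> n}" using that by (auto simp: n_def)
    qed (use ww_pos[THEN less_imp_le] in auto)
    also have "\<dots> \<le> wt s u j * (if j = \<theta> then 1 else e j)" by (rule sum_passage_le[OF e super])
    finally show ?thesis .
  qed
  show sm: "ww s u summable_on passage \<theta> j"
    by (rule nonneg_bdd_above_summable_on)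
       (use bd ww_pos[THEN less_imp_le] in \<open>auto intro!: bdd_aboveI[of _ "wt s u j * (if j = \<theta> then 1 else e j)"]\<close>)
  show "infsum (ww s u) (passage \<theta> j) \<le> wt s u j * (if j = \<theta> then 1 else e j)"
    by (rule infsum_le_finite_sums[OF sm bd])
qed

text \<open>A passage weight without its first step. The value 1 at \<open>\<theta>\<close>, where nothing remains to be walked, makes
\<open>infsum_passage\<close> and \<open>infsum_successors\<close> hold for all \<open>j\<close>.\<close>

definition hit :: "step \<Rightarrow> real \<Rightarrow> real \<Rightarrow> step \<Rightarrow> real" where
  "hit \<theta> s u j = (if j = \<theta> then 1 else infsum (ww s u) (\<Union>i\<in>{i. R j i}. passage \<theta> i))"

lemma infsum_UN_passage:
  assumes "\<And>j. ww s u summable_on passage \<theta> j"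
  shows "ww s u summable_on (\<Union>i\<in>I. passage \<theta> i)"
    "infsum (ww s u) (\<Union>i\<in>I. passage \<theta> i) = (\<Sum>i\<in>I. infsum (ww s u) (passage \<theta> i))"
proof -
  have fin: "finite I" by (rule finite_subset[of _ UNIV]) auto
  then show "ww s u summable_on (\<Union>i\<in>I. passage \<theta> i)"
  proof (induction I)
    case (insert i I)
    then show ?case using summable_on_union[OF assms[of i]] by simp
  qed simp
  show "infsum (ww s u) (\<Union>i\<in>I. passage \<theta> i) = (\<Sum>i\<in>I. infsum (ww s u) (passage \<theta> i))"
    by (rule sum_infsum[symmetric]) (use fin assms passage_disjoint in auto)
qed

lemma infsum_passage:
  assumes "\<And>j. ww s u summable_on passage \<theta> j"
  shows "infsum (ww s u) (passage \<theta> j) = wt s u j * hit \<theta> s u j"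
proof (cases "j = \<theta>")
  case False
  have "infsum (ww s u) (passage \<theta> j) = infsum (\<lambda>w. wt s u j * ww s u w) (\<Union>i\<in>{i. R j i}. passage \<theta> i)"
    unfolding passage_Cons[OF False] by (subst infsum_reindex) (auto simp: o_def ww_Cons)
  also have "\<dots> = wt s u j * infsum (ww s u) (\<Union>i\<in>{i. R j i}. passage \<theta> i)"
    by (rule infsum_cmult_right[OF infsum_UN_passage(1)[OF assms]])
  finally show ?thesis using False by (simp add: hit_def)
qed (simp add: passage_self hit_def ww_Cons)

lemma infsum_successors:
  assumes "\<And>j. ww s u summable_on passage \<theta> j"
  shows "infsum (ww s u) (\<Union>i\<in>{i. R j i}. passage \<theta> i) = (\<Sum>i\<in>UNIV. M s u j i * hit \<theta> s u i)"
proof -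
  have "infsum (ww s u) (\<Union>i\<in>{i. R j i}. passage \<theta> i) = (\<Sum>i | R j i. wt s u i * hit \<theta> s u i)"
    unfolding infsum_UN_passage(2)[OF assms] infsum_passage[OF assms] ..
  also have "\<dots> = (\<Sum>i\<in>UNIV. M s u j i * hit \<theta> s u i)"
    by (rule sum.mono_neutral_cong_left) (auto simp: M_def)
  finally show ?thesis .
qed

lemma v_super: "(\<Sum>i\<in>UNIV. M (lnrho u) u j i * (if i = \<theta> then 1 else v u i / v u \<theta>)) = v u j / v u \<theta>"
proof -
  have "(\<Sum>i\<in>UNIV. M (lnrho u) u j i * (if i = \<theta> then 1 else v u i / v u \<theta>)) = (\<Sum>i\<in>UNIV. M (lnrho u) u j i * v u i / v u \<theta>)"
    using v_pos[of u \<theta>] by (intro sum.cong) auto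
  then show ?thesis by (simp add: sum_divide_distrib[symmetric] M_v)
qed

lemma passage_summable_lnrho: "ww (lnrho u) u summable_on passage \<theta> j"
  by (rule passage_supersolution(1)[of "\<lambda>i. v u i / v u \<theta>"]) (auto simp: v_super v_pos less_imp_le)

text \<open>On the critical curve the entries \<open>v u j / v u \<theta>\<close> solve the same equations as the passage weights. Their
difference is nonnegative and vanishes at \<open>\<theta>\<close>; pairing with the left eigenvector shows that it is an
eigenvector, and a nonzero nonnegative eigenvector has no zero entry. This is the recurrence of a finite
irreducible chain.\<close>

lemma hit_lnrho: "hit \<theta> (lnrho u) u j = v u j / v u \<theta>"
proof -
  \<comment> \<open>The defect: the probability of never reaching \<open>\<theta>\<close>, up to the factor \<open>v u j / v u \<theta>\<close>.\<close>
  define z where "z j = v u j / v u \<theta> - hit \<theta> (lnrho u) u j" for j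
  have le: "wt (lnrho u) u j * hit \<theta> (lnrho u) u j \<le> wt (lnrho u) u j * (if j = \<theta> then 1 else v u j / v u \<theta>)" for j
    unfolding infsum_passage[OF passage_summable_lnrho, symmetric]
    by (rule passage_supersolution(2)) (auto simp: v_super v_pos less_imp_le)
  have z_nonneg: "0 \<le> z j" for j
    using le[of j, unfolded mult_le_cancel_left_pos[OF wt_pos]] v_pos[of u \<theta>] by (cases "j = \<theta>") (auto simp: z_def hit_def)
  have z_\<theta>: "z \<theta> = 0" using v_pos[of u \<theta>] by (simp add: z_def hit_def)
  have Mz: "(\<Sum>i\<in>UNIV. M (lnrho u) u j i * z i) = v u j / v u \<theta> - infsum (ww (lnrho u) u) (\<Union>i\<in>{i. R j i}. passage \<theta> i)" for j
  proof -
    have "(\<Sum>i\<in>UNIV. M (lnrho u) u j i * z i) = (\<Sum>i\<in>UNIV. M (lnrho u) u j i * v u i) / v u \<theta> - (\<Sum>i\<in>UNIV. M (lnrho u) u j i * hit \<theta> (lnrho u) u i)"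
      by (simp add: z_def right_diff_distrib sum_subtractf sum_divide_distrib)
    then show ?thesis by (simp add: M_v infsum_successors[OF passage_summable_lnrho])
  qed
  have Mz_other: "(\<Sum>i\<in>UNIV. M (lnrho u) u j i * z i) = z j" if "j \<noteq> \<theta>" for j
    unfolding Mz using that by (simp add: z_def hit_def)
  have "(\<Sum>j\<in>UNIV. l u j * ((\<Sum>i\<in>UNIV. M (lnrho u) u j i * z i) - z j)) = 0"
    using l_M_apply[of u "lnrho u" z] by (simp add: right_diff_distrib sum_subtractf)
  moreover have "(\<Sum>j\<in>UNIV. l u j * ((\<Sum>i\<in>UNIV. M (lnrho u) u j i * z i) - z j))
     = (\<Sum>j\<in>{\<theta>}. l u j * ((\<Sum>i\<in>UNIV. M (lnrho u) u j i * z i) - z j))"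
    by (rule sum.mono_neutral_right) (auto simp: Mz_other)
  ultimately have "(\<Sum>i\<in>UNIV. M (lnrho u) u \<theta> i * z i) = z \<theta>"
    using l_pos[of u \<theta>] by simp
  then have eig: "(\<Sum>i\<in>UNIV. M (lnrho u) u j i * z i) = 1 * z j" for j
    using Mz_other[of j] by (cases "j = \<theta>") auto
  have "z j = 0" for j
  proof (rule ccontr)
    assume "z j \<noteq> 0"
    with z_nonneg[of j] have "z j > 0" by simp
    obtain k where k: "k \<ge> 1" "\<And>i j. (R ^^ k) i j" using relpowp_all by blast
    have "z \<theta> > 0"
      by (rule nonneg_eigenvector_pos(2)[of "M (lnrho u) u" R k z j 1, OF M_nonneg M_pos k(2,1) z_nonneg \<open>z j > 0\<close> eig])
    then show False using z_\<theta> by simp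
  qed
  then show ?thesis by (simp add: z_def)
qed

text \<open>The class of walks enumerated by \<open>B\<close>.\<close>

definition return_walks :: "step \<Rightarrow> walk set" where
  "return_walks \<theta> = {w \<in> walks R. R \<theta> (hd w) \<and> first_return \<theta> w}"

definition passages :: "step \<Rightarrow> walk set" where "passages \<theta> = {w \<in> walks R. first_return \<theta> w}"

lemma return_walks_eq: "return_walks \<theta> = (\<Union>i\<in>{i. R \<theta> i}. passage \<theta> i)"
  by (auto simp: return_walks_def passage_def)

lemma passages_eq: "passages \<theta> = (\<Union>i\<in>UNIV. passage \<theta> i)" by (auto simp: passages_def passage_def)

lemma B_exp: "B R \<theta> (exp s) x (exp u) = infsum (ww s u) (return_walks \<theta>)"
  by (simp add: B_def gen_fun_exp return_walks_def)

lemma return_lnrho: "infsum (ww (lnrho u) u) (return_walks \<theta>) = 1"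
  unfolding return_walks_eq infsum_successors[OF passage_summable_lnrho] hit_lnrho times_divide_eq_right sum_divide_distrib[symmetric] M_v
  using v_pos[of u \<theta>] by simp

text \<open>A passage walk uses \<open>\<theta>\<close> only once. So halve the weight of all steps into \<open>\<theta>\<close>: the Perron eigenvector of the
new matrix still gives a solution of the passage equations, and its critical value of \<open>s\<close> is strictly larger.\<close>

lemma summable_beyond: obtains \<epsilon> where "\<epsilon> > 0" "ww (lnrho u + \<epsilon>) u summable_on passages \<theta>"
proof -
  define \<beta> where "\<beta> i = (if i = \<theta> then 1 / 2 else 1 :: real)" for i
  define N where "N i j = M 0 u i j * \<beta> j" for i j
  have N: "\<And>i j. 0 \<le> N i j" "\<And>i j. R i j \<Longrightarrow> N i j > 0"
    using M_nonneg M_pos by (auto simp: N_def \<beta>_def)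
  obtain k where k: "k \<ge> 1" "\<And>i j. (R ^^ k) i j" using relpowp_all by blast
  obtain c w where c: "c > 0" and w: "\<And>i. w i > 0" "\<And>i. (\<Sum>j\<in>UNIV. N i j * w j) = c * w i"
    using perron_right_eigenvector[of N R k, OF N k(2,1)] by blast
  define s where "s = - ln c"
  have Ms: "M s u i j = M 0 u i j / c" for i j
    using M_shift[of s u i j 0] c by (simp add: s_def exp_minus divide_inverse)
  have eig: "(\<Sum>j\<in>UNIV. M s u i j * (\<beta> j * w j)) = w i" for i
    using w(2)[of i] c unfolding N_def Ms by (simp add: sum_divide_distrib[symmetric] mult.assoc)
  have "exp (s - lnrho u) * (\<Sum>j\<in>UNIV. l u j * (\<beta> j * w j)) = (\<Sum>i\<in>UNIV. l u i * w i)"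
    unfolding l_M_apply[symmetric] eig ..
  also have "(\<Sum>i\<in>UNIV. l u i * w i) > (\<Sum>j\<in>UNIV. l u j * (\<beta> j * w j))"
  proof (rule sum_strict_mono_ex1)
    show "\<exists>j\<in>UNIV. l u j * (\<beta> j * w j) < l u j * w j"
      using l_pos[of u \<theta>] w(1)[of \<theta>] by (intro bexI[of _ \<theta>]) (auto simp: \<beta>_def)
  qed (use l_pos[THEN less_imp_le] w(1)[THEN less_imp_le] in \<open>auto simp: \<beta>_def intro!: mult_left_mono\<close>)
  finally have "1 * (\<Sum>j\<in>UNIV. l u j * (\<beta> j * w j)) < exp (s - lnrho u) * (\<Sum>j\<in>UNIV. l u j * (\<beta> j * w j))" by simp
  moreover have "(\<Sum>j\<in>UNIV. l u j * (\<beta> j * w j)) > 0"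
    using l_pos w(1) by (intro sum_pos) (auto simp: \<beta>_def)
  ultimately have "1 < exp (s - lnrho u)" by (simp only: mult_less_cancel_right_pos)
  then have pos: "s - lnrho u > 0" by simp
  have super: "(\<Sum>i\<in>UNIV. M s u j i * (if i = \<theta> then 1 else 2 * w i / w \<theta>)) \<le> 2 * w j / w \<theta>" for j
  proof -
    have "(\<Sum>i\<in>UNIV. M s u j i * (if i = \<theta> then 1 else 2 * w i / w \<theta>)) = (\<Sum>i\<in>UNIV. 2 / w \<theta> * (M s u j i * (\<beta> i * w i)))"
      using w(1)[of \<theta>] by (intro sum.cong) (auto simp: \<beta>_def)
    also have "\<dots> = 2 / w \<theta> * w j" unfolding sum_distrib_left[symmetric] eig ..
    finally show ?thesis by simp
  qed
  have "ww s u summable_on passage \<theta> j" for j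
    by (rule passage_supersolution(1)[of "\<lambda>i. 2 * w i / w \<theta>"])
       (use super w(1) in \<open>auto intro!: divide_nonneg_nonneg less_imp_le\<close>)
  then have "ww s u summable_on passages \<theta>" unfolding passages_eq by (rule infsum_UN_passage(1))
  then show ?thesis using that[of "s - lnrho u"] pos by simp
qed

text \<open>Each return walk has length at least 1, so below the critical value \<open>B\<close> is smaller
than 1.\<close>

lemma lnrho_le_return_solution:
  assumes "infsum (ww s u) (return_walks \<theta>) = 1"
  shows "lnrho u \<le> s"
proof (rule ccontr)
  assume "\<not> lnrho u \<le> s"
  then have s: "s < lnrho u" by simp
  have le: "ww s u w \<le> exp (s - lnrho u) * ww (lnrho u) u w" if "w \<in> return_walks \<theta>" for w
  proof -
    have "length w \<ge> 1" using that by (cases w) (auto simp: return_walks_def walks_def)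
    then have "(real (length w) - 1) * s \<le> (real (length w) - 1) * lnrho u" using s by (intro mult_left_mono) auto
    then have "real (length w) * s + end_y w * u \<le> (s - lnrho u) + (real (length w) * lnrho u + end_y w * u)"
      by (simp add: algebra_simps)
    then show ?thesis using x_pos
      by (simp add: ww_def mult.left_commute[of "exp (s - lnrho u)"] exp_add[symmetric] mult_left_mono)
  qed
  have sm: "ww (lnrho u) u summable_on return_walks \<theta>"
    unfolding return_walks_eq by (rule infsum_UN_passage(1)[OF passage_summable_lnrho])
  have sm': "(\<lambda>w. exp (s - lnrho u) * ww (lnrho u) u w) summable_on return_walks \<theta>"
    by (rule summable_on_cmult_right[OF sm])
  have "infsum (ww s u) (return_walks \<theta>) \<le> infsum (\<lambda>w. exp (s - lnrho u) * ww (lnrho u) u w) (return_walks \<theta>)"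
    by (rule infsum_mono[OF summable_on_comparison_test[OF sm' le] sm' le]) (auto intro: less_imp_le[OF ww_pos])
  also have "\<dots> = exp (s - lnrho u)" by (simp add: infsum_cmult_right[OF sm] return_lnrho)
  also have "\<dots> < 1" using s by simp
  finally show False using assms by simp
qed

lemma rho_exp: "rho R x (exp u) = exp (lnrho u)"
  unfolding rho_def
proof (rule the_equality)
  have least: "exp (lnrho u) \<le> t" if "0 < t" "B R \<theta> t x (exp u) = 1" for t \<theta>
  proof -
    have "B R \<theta> (exp (ln t)) x (exp u) = 1" using that by simp
    then have "lnrho u \<le> ln t" unfolding B_exp by (rule lnrho_le_return_solution)
    then show ?thesis using that by (metis exp_le_cancel_iff exp_ln)
  qed
  have sol: "B R \<theta> (exp (lnrho u)) x (exp u) = 1" for \<theta>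
    by (simp add: B_exp return_lnrho)
  show "\<forall>\<theta>. 0 < exp (lnrho u) \<and> B R \<theta> (exp (lnrho u)) x (exp u) = 1 \<and> (\<forall>t. 0 < t \<and> B R \<theta> t x (exp u) = 1 \<longrightarrow> exp (lnrho u) \<le> t)"
    using least sol by auto
  show "r = exp (lnrho u)" if r: "\<forall>\<theta>. 0 < r \<and> B R \<theta> r x (exp u) = 1 \<and> (\<forall>t. 0 < t \<and> B R \<theta> t x (exp u) = 1 \<longrightarrow> r \<le> t)" for r
  proof (rule antisym)
    show "r \<le> exp (lnrho u)" using r sol by auto
    show "exp (lnrho u) \<le> r" using r least by blast
  qed
qed

section \<open>The critical curve and its maximum\<close>

definition ax :: "walk \<Rightarrow> real" where "ax w = x powi end_x w"
definition len :: "walk \<Rightarrow> real" where "len w = real (length w)"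
definition ht :: "walk \<Rightarrow> real" where "ht w = real_of_int (end_y w)"

text \<open>The generating function of the class \<open>A\<close> with an additional factor \<open>b w\<close>. The choices \<open>b = len\<close> and \<open>b = ht\<close> give
its partial derivatives in \<open>s\<close> and \<open>u\<close>.\<close>

definition gf :: "walk set \<Rightarrow> (walk \<Rightarrow> real) \<Rightarrow> real \<Rightarrow> real \<Rightarrow> real" where
  "gf A b = dseries A len ht (\<lambda>w. b w * ax w)"

lemma ww_eq: "ww s u w = ax w * exp (len w * s + ht w * u)"
  by (simp add: ww_def ax_def len_def ht_def)

lemma gf_infsum: "gf A b s u = infsum (\<lambda>w. b w * ww s u w) A"
  by (simp add: gf_def dseries_def ww_eq mult.assoc)

lemma gen_fun_gf: "gen_fun A (exp s) x (exp u) = gf A (\<lambda>w. 1) s u"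
  by (simp add: gen_fun_exp gf_infsum)

lemma ax_pos: "ax w > 0" by (simp add: ax_def zero_less_power_int x_pos)

lemma abs_ht_le: "\<bar>ht w\<bar> \<le> len w"
proof (induction w)
  case (Cons j w)
  have "\<bar>real_of_int (step_y j)\<bar> \<le> 1" by (cases j) auto
  then show ?case using Cons by (simp add: ht_def len_def end_y_def)
qed (simp add: ht_def len_def end_y_def)

lemma len_nonneg: "0 \<le> len w" by (simp add: len_def)

definition gconv :: "walk set \<Rightarrow> (walk \<Rightarrow> real) \<Rightarrow> real \<Rightarrow> real \<Rightarrow> bool" where
  "gconv A b = dconv A len ht (\<lambda>w. b w * ax w)"

lemma gconv_mult: "gconv A b s u \<Longrightarrow> (\<And>w. w \<in> A \<Longrightarrow> \<bar>g w\<bar> \<le> len w) \<Longrightarrow> gconv A (\<lambda>w. g w * b w) s u"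
  using dconv_mult[of A len ht "\<lambda>w. b w * ax w" s u g] by (simp add: gconv_def mult.assoc)

lemma gconv_len: "gconv A b s u \<Longrightarrow> gconv A (\<lambda>w. len w * b w) s u"
  by (rule gconv_mult) (use len_nonneg in auto)

lemma gconv_ht: "gconv A b s u \<Longrightarrow> gconv A (\<lambda>w. ht w * b w) s u"
  by (rule gconv_mult) (use abs_ht_le in auto)

lemma gconv_summable: "gconv A b s u \<Longrightarrow> (\<lambda>w. b w * ww s u w) summable_on A"
  using dconv_summable[of A len ht "\<lambda>w. b w * ax w" s u] len_nonneg by (simp add: gconv_def ww_eq mult.assoc)

lemma gconv_passages:
  assumes "A \<subseteq> passages \<theta>" shows "gconv A (\<lambda>w. 1) (lnrho u) u"
proof -
  obtain \<epsilon> where \<epsilon>: "\<epsilon> > 0" "ww (lnrho u + \<epsilon>) u summable_on passages \<theta>" using summable_beyond by blast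
  have "ww (lnrho u + \<epsilon>) u summable_on A" by (rule summable_on_subset_banach[OF \<epsilon>(2) assms])
  then have "(\<lambda>w. \<bar>1 * ax w\<bar> * exp (len w * (lnrho u + \<epsilon>) + ht w * u)) summable_on A"
    using ax_pos[THEN less_imp_le] by (simp add: ww_eq[abs_def] abs_of_nonneg)
  then show ?thesis unfolding gconv_def dconv_def using \<epsilon>(1) by blast
qed

lemma gf_has_derivative:
  assumes "gconv A b s u"
  shows "((\<lambda>p. gf A b (fst p) (snd p)) has_derivative
    (\<lambda>p. gf A (\<lambda>w. len w * b w) s u * fst p + gf A (\<lambda>w. ht w * b w) s u * snd p)) (at (s, u))"
  using dseries_has_derivative[OF assms[unfolded gconv_def] abs_ht_le] by (simp add: gf_def mult.assoc)

lemma gf_chain: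
  assumes "gconv A b (f z) (g z)" "(f has_real_derivative f') (at z)" "(g has_real_derivative g') (at z)"
  shows "((\<lambda>z. gf A b (f z) (g z)) has_real_derivative
    gf A (\<lambda>w. len w * b w) (f z) (g z) * f' + gf A (\<lambda>w. ht w * b w) (f z) (g z) * g') (at z)"
proof -
  have "((\<lambda>z. (f z, g z)) has_derivative (\<lambda>h. (f' * h, g' * h))) (at z)"
    using assms(2,3)[unfolded has_field_derivative_def] by (rule has_derivative_Pair)
  from has_derivative_compose[OF this gf_has_derivative[OF assms(1)]]
  have "((\<lambda>z. gf A b (f z) (g z)) has_derivative
     (\<lambda>h. gf A (\<lambda>w. len w * b w) (f z) (g z) * (f' * h) + gf A (\<lambda>w. ht w * b w) (f z) (g z) * (g' * h))) (at z)"
    by (simp only: fst_conv snd_conv)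
  then show ?thesis
    unfolding has_field_derivative_def
    by (rule has_derivative_eq_rhs) (simp add: fun_eq_iff algebra_simps)
qed

lemma gen_fun_derivative_t:
  assumes "gconv A (\<lambda>w. 1) s u"
  shows "((\<lambda>t. gen_fun A t x (exp u)) has_real_derivative gf A len s u / exp s) (at (exp s))"
proof -
  have "((\<lambda>t. gf A (\<lambda>w. 1) (ln t) u) has_real_derivative gf A len s u / exp s) (at (exp s))"
    using gf_chain[OF _ DERIV_ln_divide DERIV_const, of A "\<lambda>w. 1" "exp s" u] assms by simp
  then show ?thesis
  proof (rule has_field_derivative_transform_within_open[of _ _ _ "{0<..}"])
    show "gf A (\<lambda>w. 1) (ln t) u = gen_fun A t x (exp u)" if "t \<in> {0<..}" for t
      using gen_fun_gf[of A "ln t" u] that by simp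
  qed auto
qed

lemma gen_fun_derivative_y:
  assumes "gconv A (\<lambda>w. 1) s u"
  shows "((\<lambda>y. gen_fun A (exp s) x y) has_real_derivative gf A ht s u / exp u) (at (exp u))"
proof -
  have "((\<lambda>y. gf A (\<lambda>w. 1) s (ln y)) has_real_derivative gf A ht s u / exp u) (at (exp u))"
    using gf_chain[OF _ DERIV_const DERIV_ln_divide, of A "\<lambda>w. 1" s "exp u"] assms by simp
  then show ?thesis
  proof (rule has_field_derivative_transform_within_open[of _ _ _ "{0<..}"])
    show "gf A (\<lambda>w. 1) s (ln y) = gen_fun A (exp s) x y" if "y \<in> {0<..}" for y
      using gen_fun_gf[of A s "ln y"] that by simp
  qed auto
qed

lemma return_walks_passages: "return_walks \<theta> \<subseteq> passages \<theta>" by (auto simp: return_walks_def passages_def)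

lemma gf_return: "gf (return_walks \<theta>) (\<lambda>w. 1) (lnrho u) u = 1"
  by (simp add: gf_infsum return_lnrho)

text \<open>\<open>B = 1\<close> on the critical curve, and each return walk has length at least 1.\<close>

lemma gf_return_len_pos: "gf (return_walks \<theta>) len (lnrho u) u > 0"
proof -
  note c = gconv_passages[OF return_walks_passages[of \<theta>], of u]
  have "gf (return_walks \<theta>) (\<lambda>w. 1) (lnrho u) u \<le> gf (return_walks \<theta>) len (lnrho u) u"
    unfolding gf_infsum
  proof (rule infsum_mono[OF gconv_summable[OF c]])
    show "(\<lambda>w. len w * ww (lnrho u) u w) summable_on return_walks \<theta>"
      using gconv_summable[OF gconv_len[OF c]] by simp
    fix w assume "w \<in> return_walks \<theta>"
    then have "1 \<le> len w" by (cases w) (auto simp: return_walks_def walks_def len_def)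
    then show "1 * ww (lnrho u) u w \<le> len w * ww (lnrho u) u w"
      using ww_pos[of "lnrho u" u w] by (intro mult_right_mono) auto
  qed
  then show ?thesis by (simp add: gf_return)
qed

text \<open>The derivative of \<open>lnrho\<close>, from implicit differentiation of \<open>B = 1\<close>. Its value does not depend on
\<open>\<theta>\<close>, but the formula does.\<close>

definition slope :: "step \<Rightarrow> real \<Rightarrow> real" where
  "slope \<theta> u = - gf (return_walks \<theta>) ht (lnrho u) u / gf (return_walks \<theta>) len (lnrho u) u"

lemma lnrho_derivative: "(lnrho has_real_derivative slope \<theta> u) (at u)"
  unfolding slope_def
proof (rule implicit_curve_derivative[where F = "gf (return_walks \<theta>) (\<lambda>w. 1)" and c = 1])
  show "((\<lambda>p. gf (return_walks \<theta>) (\<lambda>w. 1) (fst p) (snd p)) has_derivative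
      (\<lambda>p. gf (return_walks \<theta>) len (lnrho u) u * fst p + gf (return_walks \<theta>) ht (lnrho u) u * snd p)) (at (lnrho u, u))"
    using gf_has_derivative[OF gconv_passages[OF return_walks_passages[of \<theta>], of u]] by simp
qed (use gf_return_len_pos[of \<theta> u] gf_return lnrho_lipschitz in auto)

lemma gf_curve_derivative:
  assumes "gconv A b (lnrho u) u"
  shows "((\<lambda>z. gf A b (lnrho z) z) has_real_derivative
    gf A (\<lambda>w. len w * b w) (lnrho u) u * slope \<theta> u + gf A (\<lambda>w. ht w * b w) (lnrho u) u) (at u)"
  using gf_chain[OF assms lnrho_derivative DERIV_ident] by simp

text \<open>If all return walks had height 0, then \<open>B\<close> would not depend on \<open>u\<close> and \<open>lnrho\<close> would be
constant, but it is unbounded below.\<close>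

lemma gf_return_ht2_pos: "gf (return_walks \<theta>) (\<lambda>w. ht w * ht w) (lnrho u) u > 0"
proof (rule ccontr)
  assume "\<not> ?thesis"
  then have le: "infsum (\<lambda>w. ht w * ht w * ww (lnrho u) u w) (return_walks \<theta>) \<le> 0" by (simp add: gf_infsum)
  have ht0: "ht w = 0" if "w \<in> return_walks \<theta>" for w
  proof -
    have "ht w * ht w * ww (lnrho u) u w = 0"
    proof (rule nonneg_infsum_le_0D[OF le _ _ that])
      show "(\<lambda>w. ht w * ht w * ww (lnrho u) u w) summable_on return_walks \<theta>"
        using gconv_summable[OF gconv_ht[OF gconv_ht[OF gconv_passages[OF return_walks_passages[of \<theta>], of u]]]] by (simp add: mult.assoc)
    qed (use ww_pos[THEN less_imp_le] in auto)
    then show ?thesis using ww_pos[of "lnrho u" u w] by simp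
  qed
  have "lnrho 0 \<le> lnrho z" for z
  proof (rule lnrho_le_return_solution)
    have "infsum (ww (lnrho z) 0) (return_walks \<theta>) = infsum (ww (lnrho z) z) (return_walks \<theta>)"
      by (rule infsum_cong) (simp add: ww_eq ht0)
    then show "infsum (ww (lnrho z) 0) (return_walks \<theta>) = 1" by (simp add: return_lnrho)
  qed
  moreover obtain a b c d where ab: "a > 0" "\<And>u. lnrho u \<le> a * u + b"
    using lnrho_to_minus_infinity by metis
  ultimately have "lnrho 0 \<le> a * ((lnrho 0 - b - 1) / a) + b" by (metis order_trans)
  then show False using ab(1) by simp
qed

text \<open>Minus the second derivative of \<open>lnrho\<close> at a critical point.\<close>

definition curv :: "step \<Rightarrow> real \<Rightarrow> real" where
  "curv \<theta> u = gf (return_walks \<theta>) (\<lambda>w. ht w * ht w) (lnrho u) u / gf (return_walks \<theta>) len (lnrho u) u"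

lemma curv_pos: "curv \<theta> u > 0"
  using gf_return_ht2_pos gf_return_len_pos by (simp add: curv_def)

text \<open>At a critical point the curve is horizontal, so only the second derivative of \<open>B\<close> in \<open>u\<close> survives.\<close>

lemma slope_derivative:
  assumes crit: "slope \<theta> u = 0"
  shows "(slope \<theta> has_real_derivative - curv \<theta> u) (at u)"
proof -
  note c = gconv_passages[OF return_walks_passages[of \<theta>], of u]
  have 0: "gf (return_walks \<theta>) ht (lnrho u) u = 0"
    using crit gf_return_len_pos[of \<theta> u] by (simp add: slope_def)
  have 1: "((\<lambda>z. gf (return_walks \<theta>) ht (lnrho z) z) has_real_derivative gf (return_walks \<theta>) (\<lambda>w. ht w * ht w) (lnrho u) u) (at u)"
    using gf_curve_derivative[OF gconv_ht[OF c], of \<theta>] by (simp add: crit)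
  have 2: "((\<lambda>z. gf (return_walks \<theta>) len (lnrho z) z) has_real_derivative gf (return_walks \<theta>) (\<lambda>w. ht w * len w) (lnrho u) u) (at u)"
    using gf_curve_derivative[OF gconv_len[OF c], of \<theta>] by (simp add: crit)
  have nz: "gf (return_walks \<theta>) len (lnrho u) u \<noteq> 0" using gf_return_len_pos[of \<theta> u] by simp
  show ?thesis
    unfolding slope_def[abs_def] curv_def
    using DERIV_divide[OF DERIV_minus[OF 1] 2 nz] nz by (simp add: 0)
qed

lemma lnrho_le_critical: 
  assumes "slope \<theta> um = 0" shows "lnrho u \<le> lnrho um"
proof -
  have "((\<lambda>u. - lnrho u) has_real_derivative 0) (at um)"
    using DERIV_minus[OF lnrho_derivative[of \<theta> um]] assms by simp
  from convex_on_imp_above_tangent[OF lnrho_concave _ _ _ this, of u] show ?thesis by simp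
qed

lemma slope_zero_if_max:
  assumes "\<And>u. lnrho u \<le> lnrho um" shows "slope \<theta> um = 0"
  by (rule DERIV_local_max[OF lnrho_derivative, of 1]) (use assms in auto)

text \<open>By concavity every critical point is a global maximum, and \<open>lnrho\<close> is constant between two of
them; but the slope is strictly decreasing at each critical point.\<close>

lemma critical_unique:
  assumes "slope \<theta> u1 = 0" "slope \<theta> u2 = 0" shows "u1 = u2"
proof -
  have no: "\<not> a < b" if "slope \<theta> a = 0" "slope \<theta> b = 0" for a b
  proof
    assume "a < b"
    obtain d where d: "d > 0" "\<And>h. 0 < h \<Longrightarrow> h < d \<Longrightarrow> slope \<theta> (a + h) < slope \<theta> a"
    proof -
      have "\<exists>d>0. \<forall>h>0. h < d \<longrightarrow> slope \<theta> a > slope \<theta> (a + h)"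
        by (rule DERIV_neg_dec_right[OF slope_derivative]) (use \<open>slope \<theta> a = 0\<close> curv_pos[of \<theta> a] in auto)
      then show ?thesis using that by blast
    qed
    \<comment> \<open>A point between the two, so close to \<open>a\<close> that the slope is already negative there.\<close>
    define h where "h = min (d / 2) ((b - a) / 2)"
    have "h \<le> (b - a) / 2" unfolding h_def by (rule min.cobounded2)
    then have h: "0 < h" "h < d" "a + h \<le> b" using d \<open>a < b\<close> by (simp_all add: h_def)
    define q where "q = h / (b - a)"
    have q: "0 \<le> q" "q \<le> 1" using h \<open>a < b\<close> by (auto simp: q_def)
    have "q * (b - a) = h" using \<open>a < b\<close> by (simp add: q_def)
    then have eq: "(1 - q) * a + q * b = a + h" by (simp add: algebra_simps)
    have max: "lnrho u \<le> lnrho a" "lnrho u \<le> lnrho b" for u using lnrho_le_critical that by auto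
    then have "lnrho a = lnrho b" by (intro antisym) auto
    moreover have "- lnrho (a + h) \<le> (1 - q) * - lnrho a + q * - lnrho b"
      using convex_onD[OF lnrho_concave q, of a b] eq by simp
    ultimately have "lnrho a \<le> lnrho (a + h)" by (simp add: algebra_simps)
    then have "slope \<theta> (a + h) = 0" by (intro slope_zero_if_max) (use max order_trans in blast)
    then show False using d(2)[of h] h that by simp
  qed
  show ?thesis using no[of u1 u2] no[of u2 u1] assms by linarith
qed

lemma critical_exists: "\<exists>um. \<forall>\<theta>. slope \<theta> um = 0"
proof -
  obtain a b c d where bd: "a > 0" "c > 0" "\<And>u. lnrho u \<le> a * u + b" "\<And>u. lnrho u \<le> - c * u + d"
    using lnrho_to_minus_infinity by metis
  define L where "L = \<bar>(lnrho 0 - b) / a\<bar> + \<bar>(d - lnrho 0) / c\<bar>"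
  have "L \<ge> 0" unfolding L_def by (intro add_nonneg_nonneg abs_ge_zero)
  have "continuous_on {-L..L} lnrho"
    by (rule DERIV_continuous_on) (use lnrho_derivative has_field_derivative_at_within in blast)
  then obtain um where um: "um \<in> {-L..L}" "\<And>u. u \<in> {-L..L} \<Longrightarrow> lnrho u \<le> lnrho um"
    using continuous_attains_sup[of "{-L..L}" lnrho] \<open>L \<ge> 0\<close> by auto
  have "lnrho u \<le> lnrho um" for u
  proof (cases "u \<in> {-L..L}")
    case False
    have "lnrho u \<le> lnrho 0"
    proof (cases "u < - L")
      case True
      then have "u \<le> (lnrho 0 - b) / a" unfolding L_def by linarith
      then have "a * u + b \<le> lnrho 0" using bd(1) by (simp add: field_simps)
      then show ?thesis using bd(3)[of u] by linarith
    next
      assume "\<not> u < - L"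
      then have "u > L" using False by auto
      then have "u \<ge> (d - lnrho 0) / c" unfolding L_def by linarith
      then have "- c * u + d \<le> lnrho 0" using bd(2) by (simp add: field_simps)
      then show ?thesis using bd(4)[of u] by linarith
    qed
    also have "lnrho 0 \<le> lnrho um" by (rule um(2)) (use \<open>L \<ge> 0\<close> in simp)
    finally show ?thesis .
  qed (use um in auto)
  then show ?thesis using slope_zero_if_max by blast
qed

definition u0 :: real where "u0 = (SOME u. \<forall>\<theta>. slope \<theta> u = 0)"

lemma slope_u0: "slope \<theta> u0 = 0"
  unfolding u0_def using someI_ex[OF critical_exists] by blast

lemma lnrho_less_u0: "u < u0 \<Longrightarrow> lnrho u < lnrho u0"
proof (rule ccontr)
  assume "u < u0" "\<not> lnrho u < lnrho u0"
  then have "lnrho u0 \<le> lnrho u" by simp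
  then have "lnrho z \<le> lnrho u" for z using lnrho_le_critical[OF slope_u0, of z] by linarith
  then have "slope South u = 0" by (rule slope_zero_if_max)
  then show False using critical_unique[OF slope_u0, of South u] \<open>u < u0\<close> by simp
qed

lemma rho_derivative: "0 < y \<Longrightarrow> (rho R x has_real_derivative exp (lnrho (ln y)) * (slope \<theta> (ln y) / y)) (at y)"
proof -
  assume y: "0 < y"
  have "((\<lambda>y. exp (lnrho (ln y))) has_real_derivative exp (lnrho (ln y)) * (slope \<theta> (ln y) * (1 / y))) (at y)"
    by (intro DERIV_fun_exp DERIV_chain2[OF lnrho_derivative] DERIV_ln_divide y)
  then have "((\<lambda>y. exp (lnrho (ln y))) has_real_derivative exp (lnrho (ln y)) * (slope \<theta> (ln y) / y)) (at y)" by simp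
  then show ?thesis
  proof (rule has_field_derivative_transform_within_open[of _ _ _ "{0<..}"])
    show "exp (lnrho (ln z)) = rho R x z" if "z \<in> {0<..}" for z
      using rho_exp[of "ln z"] that by simp
  qed (use y in auto)
qed

lemma tau_eq: "tau R x = exp u0"
  unfolding tau_def
proof (rule the_equality)
  show "0 < exp u0 \<and> (rho R x has_real_derivative 0) (at (exp u0))"
    using rho_derivative[of "exp u0" South] by (simp add: slope_u0)
  fix y assume y: "0 < y \<and> (rho R x has_real_derivative 0) (at y)"
  then have "exp (lnrho (ln y)) * (slope South (ln y) / y) = 0"
    using DERIV_unique[OF rho_derivative[of y South]] by blast
  then have "slope South (ln y) = 0" using y by simp
  then have "ln y = u0" using critical_unique slope_u0 by blast
  then show "y = exp u0" using y exp_ln[of y] by simp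
qed

lemma kappa_eq: "kappa R x = exp (lnrho u0)" by (simp add: kappa_def tau_eq rho_exp)

text \<open>Since \<open>mu = exp (- lnrho (ln y))\<close> and the slope vanishes at the critical point, the change of variables
contributes only the factor \<open>1 / tau^2\<close>.\<close>

lemma kappa_mu_yy: "kappa R x * mu_yy R x (tau R x) = curv \<theta> u0 / (exp u0)\<^sup>2"
proof -
  have mu: "mu R x y = exp (- lnrho (ln y))" if "y > 0" for y
    using rho_exp[of "ln y"] that by (simp add: mu_def exp_minus divide_inverse)
  have d1: "(mu R x has_real_derivative exp (- lnrho (ln y)) * (- slope \<theta> (ln y) / y)) (at y)" if y: "y > 0" for y
  proof -
    have "((\<lambda>y. exp (- lnrho (ln y))) has_real_derivative exp (- lnrho (ln y)) * (- (slope \<theta> (ln y) * (1 / y)))) (at y)"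
      by (intro DERIV_fun_exp DERIV_minus DERIV_chain2[OF lnrho_derivative] DERIV_ln_divide y)
    then have "((\<lambda>y. exp (- lnrho (ln y))) has_real_derivative exp (- lnrho (ln y)) * (- slope \<theta> (ln y) / y)) (at y)" by simp
    then show ?thesis
      by (rule has_field_derivative_transform_within_open[of _ _ _ "{0<..}"]) (use y mu in auto)
  qed
  define \<tau> where "\<tau> = exp u0"
  have \<tau>: "\<tau> > 0" "ln \<tau> = u0" by (auto simp: \<tau>_def)
  have e1: "((\<lambda>y. slope \<theta> (ln y)) has_real_derivative - curv \<theta> u0 * (1 / \<tau>)) (at \<tau>)"
    by (rule DERIV_chain2[OF _ DERIV_ln_divide[OF \<tau>(1)]]) (simp add: \<tau>(2) slope_derivative[OF slope_u0])
  have e2: "((\<lambda>y. exp (- lnrho (ln y)) / y) has_real_derivative (exp (- lnrho (ln \<tau>)) * (- (slope \<theta> (ln \<tau>) * (1 / \<tau>))) * \<tau> - exp (- lnrho (ln \<tau>)) * 1) / (\<tau> * \<tau>)) (at \<tau>)"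
    by (intro DERIV_divide DERIV_fun_exp DERIV_minus DERIV_chain2[OF lnrho_derivative] DERIV_ln_divide DERIV_ident) (use \<tau> in auto)
  have "((\<lambda>y. - slope \<theta> (ln y) * (exp (- lnrho (ln y)) / y)) has_real_derivative curv \<theta> u0 / \<tau> * (exp (- lnrho u0) / \<tau>)) (at \<tau>)"
    using DERIV_mult[OF DERIV_minus[OF e1] e2] by (simp add: \<tau>(2) slope_u0)
  then have "((\<lambda>y. exp (- lnrho (ln y)) * (- slope \<theta> (ln y) / y)) has_real_derivative curv \<theta> u0 * exp (- lnrho u0) / \<tau>\<^sup>2) (at \<tau>)"
    by (simp add: mult_ac power2_eq_square)
  then have "(deriv (mu R x) has_real_derivative curv \<theta> u0 * exp (- lnrho u0) / \<tau>\<^sup>2) (at \<tau>)"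
  proof (rule has_field_derivative_transform_within_open[of _ _ _ "{0<..}"])
    show "exp (- lnrho (ln y)) * (- slope \<theta> (ln y) / y) = deriv (mu R x) y" if "y \<in> {0<..}" for y
      using DERIV_imp_deriv[OF d1[of y]] that by simp
  qed (use \<tau> in auto)
  then have "deriv (deriv (mu R x)) \<tau> = curv \<theta> u0 * exp (- lnrho u0) / \<tau>\<^sup>2" by (rule DERIV_imp_deriv)
  then have "mu_yy R x (tau R x) = curv \<theta> u0 * exp (- lnrho u0) / \<tau>\<^sup>2"
    by (simp add: mu_yy_def tau_eq \<tau>_def numeral_2_eq_2)
  then show ?thesis by (simp add: kappa_eq \<tau>_def exp_minus)
qed

text \<open>The source of the square root: \<open>1 - rho / kappa\<close> is quadratic in \<open>u0 - u\<close>, whereas \<open>f u0 - f u\<close> is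
linear.\<close>

lemma sqrt_gap_asymptotic:
  assumes f: "(f has_real_derivative f') (at u0)"
  shows "((\<lambda>u. (f u0 - f u) / sqrt (1 - exp (lnrho u - lnrho u0))) \<longlongrightarrow> f' * sqrt (2 / curv \<theta> u0)) (at_left u0)"
proof -
  have gap: "((\<lambda>u. (1 - exp (lnrho u - lnrho u0)) / (u - u0)\<^sup>2) \<longlongrightarrow> curv \<theta> u0 / 2) (at_left u0)"
  proof (rule lhopital_left[where f' = "\<lambda>u. - (exp (lnrho u - lnrho u0) * slope \<theta> u)" and g' = "\<lambda>u. 2 * (u - u0)"])
    have lnrho_cont: "(lnrho \<longlongrightarrow> lnrho u0) (at u0)" using DERIV_isCont[OF lnrho_derivative[of \<theta>]] by (simp add: isCont_def)
    then have lnrho_cont': "(lnrho \<longlongrightarrow> lnrho u0) (at_left u0)" by (rule tendsto_within_subset) auto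
    have "((\<lambda>u. 1 - exp (lnrho u - lnrho u0)) \<longlongrightarrow> 1 - exp (lnrho u0 - lnrho u0)) (at_left u0)"
      by (intro tendsto_intros lnrho_cont')
    then show "((\<lambda>u. 1 - exp (lnrho u - lnrho u0)) \<longlongrightarrow> 0) (at_left u0)" by simp
    have "((\<lambda>u. (u - u0)\<^sup>2) \<longlongrightarrow> (u0 - u0)\<^sup>2) (at_left u0)" by (intro tendsto_intros)
    then show "((\<lambda>u. (u - u0)\<^sup>2) \<longlongrightarrow> 0) (at_left u0)" by simp
    show "eventually (\<lambda>u. (u - u0)\<^sup>2 \<noteq> 0) (at_left u0)" "eventually (\<lambda>u. 2 * (u - u0) \<noteq> 0) (at_left u0)"
      by (auto simp: eventually_at_filter)
    show "eventually (\<lambda>u. ((\<lambda>u. 1 - exp (lnrho u - lnrho u0)) has_real_derivative - (exp (lnrho u - lnrho u0) * slope \<theta> u)) (at u)) (at_left u0)"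
    proof (intro always_eventually allI)
      fix u
      show "((\<lambda>u. 1 - exp (lnrho u - lnrho u0)) has_real_derivative - (exp (lnrho u - lnrho u0) * slope \<theta> u)) (at u)"
        by (auto intro!: derivative_eq_intros lnrho_derivative[of \<theta>])
    qed
    show "eventually (\<lambda>u. ((\<lambda>u. (u - u0)\<^sup>2) has_real_derivative 2 * (u - u0)) (at u)) (at_left u0)"
      by (intro always_eventually allI) (auto intro!: derivative_eq_intros)
    have "((\<lambda>u. (slope \<theta> u - slope \<theta> u0) / (u - u0)) \<longlongrightarrow> - curv \<theta> u0) (at_left u0)"
      using slope_derivative[OF slope_u0] unfolding has_field_derivative_iff by (rule tendsto_within_subset) auto
    then have "((\<lambda>u. - (exp (lnrho u - lnrho u0) / 2) * ((slope \<theta> u - slope \<theta> u0) / (u - u0))) \<longlongrightarrow> - (exp (lnrho u0 - lnrho u0) / 2) * - curv \<theta> u0) (at_left u0)"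
      by (intro tendsto_intros lnrho_cont') auto
    then show "((\<lambda>u. - (exp (lnrho u - lnrho u0) * slope \<theta> u) / (2 * (u - u0))) \<longlongrightarrow> curv \<theta> u0 / 2) (at_left u0)"
      by (simp add: slope_u0)
  qed
  have quot: "((\<lambda>u. (f u - f u0) / (u - u0)) \<longlongrightarrow> f') (at_left u0)"
    using f unfolding has_field_derivative_iff by (rule tendsto_within_subset) auto
  have "((\<lambda>u. (f u - f u0) / (u - u0) / sqrt ((1 - exp (lnrho u - lnrho u0)) / (u - u0)\<^sup>2)) \<longlongrightarrow> f' / sqrt (curv \<theta> u0 / 2)) (at_left u0)"
    by (intro tendsto_intros quot gap) (use curv_pos[of \<theta> u0] in simp)
  moreover have "f' / sqrt (curv \<theta> u0 / 2) = f' * sqrt (2 / curv \<theta> u0)"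
    using curv_pos[of \<theta> u0] by (simp add: real_sqrt_divide)
  moreover have "eventually (\<lambda>u. (f u - f u0) / (u - u0) / sqrt ((1 - exp (lnrho u - lnrho u0)) / (u - u0)\<^sup>2)
      = (f u0 - f u) / sqrt (1 - exp (lnrho u - lnrho u0))) (at_left u0)"
    unfolding eventually_at_filter
  proof (intro always_eventually allI impI)
    fix u :: real assume u: "u \<noteq> u0" "u \<in> {..<u0}"
    then have "lnrho u < lnrho u0" by (auto intro: lnrho_less_u0)
    then have pos: "sqrt (1 - exp (lnrho u - lnrho u0)) > 0" by simp
    have "sqrt ((1 - exp (lnrho u - lnrho u0)) / (u - u0)\<^sup>2) = sqrt (1 - exp (lnrho u - lnrho u0)) / (u0 - u)"
      using u by (simp add: real_sqrt_divide)
    then show "(f u - f u0) / (u - u0) / sqrt ((1 - exp (lnrho u - lnrho u0)) / (u - u0)\<^sup>2) = (f u0 - f u) / sqrt (1 - exp (lnrho u - lnrho u0))"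
      using u pos by (simp add: divide_simps) (simp add: algebra_simps)
  qed
  ultimately show ?thesis by (simp add: Lim_transform_eventually)
qed

section \<open>Half-plane walks: mass and excursions\<close>

definition half_set :: "nat \<Rightarrow> step \<Rightarrow> walk set" where
  "half_set m i = {w \<in> half_walks R i. length w = m}"

definition half_wt :: "real \<Rightarrow> nat \<Rightarrow> step \<Rightarrow> real" where
  "half_wt u m i = half_coeff R i x (exp u) m"

text \<open>The total weight of the half-plane walks of length \<open>m\<close> that end on the axis and may continue with a south step.
Their height is 0, so the weight does not depend on \<open>u\<close>.\<close>

definition exc_wt :: "nat \<Rightarrow> real" where
  "exc_wt m = (\<Sum>i | R i South. \<Sum>w | w \<in> half_set m i \<and> end_y w = 0. ax w)"

lemma finite_half_set: "finite (half_set m i)"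
  by (rule finite_subset[OF _ finite_lists_length_eq[of "UNIV :: step set" m]]) (auto simp: half_set_def)

lemma half_set_disjoint: "w \<in> half_set m i \<Longrightarrow> w \<in> half_set m j \<Longrightarrow> i = j"
  by (auto simp: half_set_def half_walks_def)

lemma half_set_end_y_nonneg: "w \<in> half_set m i \<Longrightarrow> 0 \<le> end_y w"
  by (auto simp: half_set_def half_walks_def dest: spec[of _ "length w"])

lemma half_wt_eq: "half_wt u m i = (\<Sum>w\<in>half_set m i. ww 0 u w)"
  unfolding half_wt_def half_coeff_def half_set_def by (intro sum.cong) (simp_all add: ww_def exp_power_int)

lemma half_wt_nonneg: "0 \<le> half_wt u m i" unfolding half_wt_eq by (intro sum_nonneg less_imp_le ww_pos)

lemma exc_wt_nonneg: "0 \<le> exc_wt m" unfolding exc_wt_def by (intro sum_nonneg less_imp_le ax_pos)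

text \<open>Half-plane walks have nonnegative height.\<close>

lemma half_wt_mono: "u \<le> u' \<Longrightarrow> half_wt u m i \<le> half_wt u' m i"
  unfolding half_wt_eq using x_pos
  by (intro sum_mono) (auto simp: ww_def intro!: mult_left_mono half_set_end_y_nonneg)

lemma ww_snoc: "ww s u (w @ [j]) = ww s u w * wt s u j"
  by (induction w) (simp_all add: ww_Cons)

lemma half_wt_0: "half_wt u 0 i = 0"
proof -
  have "half_set 0 i = {}" by (auto simp: half_set_def half_walks_def walks_def)
  then show ?thesis by (simp add: half_wt_eq)
qed

text \<open>For \<open>m = 0\<close> this fails, because the first step of a walk has no predecessor.\<close>

lemma half_set_snoc:
  assumes "m \<ge> 1"
  shows "half_set (Suc m) j = (\<lambda>w. w @ [j]) ` (\<Union>i\<in>{i. R i j}. {w \<in> half_set m i. 0 \<le> end_y w + step_y j})"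
proof (intro equalityI subsetI)
  fix w assume w: "w \<in> half_set (Suc m) j"
  then have len: "length w = Suc m" and half: "w \<in> walks R" "last w = j" "\<And>k. k \<le> length w \<Longrightarrow> 0 \<le> end_y (take k w)"
    by (auto simp: half_set_def half_walks_def)
  define w' where "w' = butlast w"
  have w': "w = w' @ [j]" using half len by (metis append_butlast_last_id list.size(3) nat.distinct(1) w'_def)
  have "w' \<noteq> []" "length w' = m" using len assms by (auto simp: w')
  have "successively R w'" "R (last w') j"
    using half(1) \<open>w' \<noteq> []\<close> by (auto simp: w' walks_def successively_append_iff)
  moreover have "0 \<le> end_y (take k w')" if "k \<le> length w'" for k using half(3)[of k] that by (simp add: w')
  moreover have "0 \<le> end_y w' + step_y j" using half(3)[of "length w"] by (simp add: w' end_y_def)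
  ultimately show "w \<in> (\<lambda>w. w @ [j]) ` (\<Union>i\<in>{i. R i j}. {w \<in> half_set m i. 0 \<le> end_y w + step_y j})"
    using \<open>w' \<noteq> []\<close> \<open>length w' = m\<close> unfolding w'
    by (intro imageI UN_I[of "last w'"]) (auto simp: half_set_def half_walks_def walks_def)
next
  fix w assume "w \<in> (\<lambda>w. w @ [j]) ` (\<Union>i\<in>{i. R i j}. {w \<in> half_set m i. 0 \<le> end_y w + step_y j})"
  then obtain w' i where w': "w = w' @ [j]" "R i j" "w' \<in> half_set m i" "0 \<le> end_y w' + step_y j" by auto
  have "0 \<le> end_y (take k w)" if "k \<le> length w" for k
  proof (cases "k \<le> length w'")
    case False
    then have "take k w = w" using that by (simp add: w')
    then show ?thesis using w' by (simp add: end_y_def)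
  qed (use w' in \<open>auto simp: half_set_def half_walks_def\<close>)
  then show "w \<in> half_set (Suc m) j"
    using w' by (auto simp: half_set_def half_walks_def walks_def successively_append_iff)
qed

lemma half_wt_1: "half_wt u 1 j = (if j = South then 0 else wt 0 u j)"
proof -
  have eq: "half_set 1 j = (if j = South then {} else {[j]})"
  proof (intro equalityI subsetI)
    fix w assume w: "w \<in> half_set 1 j"
    then have "w = [j]" by (auto simp: half_set_def half_walks_def length_Suc_conv)
    moreover have "j \<noteq> South" using half_set_end_y_nonneg[OF w] \<open>w = [j]\<close> by (auto simp: end_y_def)
    ultimately show "w \<in> (if j = South then {} else {[j]})" by simp
  next
    fix w assume "w \<in> (if j = South then {} else {[j]})"
    then have w: "w = [j]" "j \<noteq> South" by (auto split: if_splits)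
    have "0 \<le> end_y (take k [j])" for k using w(2) by (cases k; cases j) (auto simp: end_y_def)
    then show "w \<in> half_set 1 j" by (simp add: w half_set_def half_walks_def walks_def)
  qed
  show ?thesis unfolding half_wt_eq eq by (simp add: ww_Cons)
qed

text \<open>All one-step extensions are counted, except for the south steps taken from the axis.\<close>

lemma half_wt_Suc:
  assumes "m \<ge> 1"
  shows "half_wt u (Suc m) j = (\<Sum>i\<in>UNIV. half_wt u m i * M 0 u i j) - of_bool (j = South) * exp (- u) * exc_wt m"
proof -
  define A where "A i = {w \<in> half_set m i. 0 \<le> end_y w + step_y j}" for i
  have fin: "finite (A i)" for i using finite_half_set by (simp add: A_def)
  have "half_wt u (Suc m) j = (\<Sum>w\<in>(\<Union>i\<in>{i. R i j}. A i). ww 0 u w * wt 0 u j)"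
    unfolding half_wt_eq half_set_snoc[OF assms] A_def[symmetric]
    by (subst sum.reindex) (auto simp: ww_snoc inj_on_def)
  also have "\<dots> = (\<Sum>i | R i j. \<Sum>w\<in>A i. ww 0 u w * wt 0 u j)"
    by (rule sum.UNION_disjoint) (use fin in \<open>auto simp: A_def dest: half_set_disjoint\<close>)
  finally have 1: "half_wt u (Suc m) j = (\<Sum>i | R i j. \<Sum>w\<in>A i. ww 0 u w * wt 0 u j)" .
  have 2: "(\<Sum>i\<in>UNIV. half_wt u m i * M 0 u i j) = (\<Sum>i | R i j. \<Sum>w\<in>half_set m i. ww 0 u w * wt 0 u j)"
    unfolding half_wt_eq sum_distrib_right by (rule sum.mono_neutral_cong_right) (auto simp: M_def)
  show ?thesis
  proof (cases "j = South")
    case False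
    then have "A i = half_set m i" for i
      using half_set_end_y_nonneg[of _ m i] by (cases j) (auto simp: A_def add_nonneg_nonneg)
    then show ?thesis using False by (simp add: 1 2)
  next
    case True
    have "(\<Sum>w\<in>half_set m i. ww 0 u w * wt 0 u j) = (\<Sum>w\<in>A i. ww 0 u w * wt 0 u j) + (\<Sum>w | w \<in> half_set m i \<and> end_y w = 0. exp (- u) * ax w)" for i
    proof -
      have un: "half_set m i = A i \<union> {w. w \<in> half_set m i \<and> end_y w = 0}"
        using half_set_end_y_nonneg[of _ m i] True by (auto simp: A_def) (metis linorder_not_less nless_le zle_diff1_eq diff_ge_0_iff_ge int_one_le_iff_zero_less order_le_less)
      have dis: "A i \<inter> {w. w \<in> half_set m i \<and> end_y w = 0} = {}" using True by (auto simp: A_def)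
      have "(\<Sum>w\<in>half_set m i. ww 0 u w * wt 0 u j) = (\<Sum>w\<in>A i. ww 0 u w * wt 0 u j) + (\<Sum>w | w \<in> half_set m i \<and> end_y w = 0. ww 0 u w * wt 0 u j)"
        by (subst un, rule sum.union_disjoint) (use fin finite_half_set dis in auto)
      also have "(\<Sum>w | w \<in> half_set m i \<and> end_y w = 0. ww 0 u w * wt 0 u j) = (\<Sum>w | w \<in> half_set m i \<and> end_y w = 0. exp (- u) * ax w)"
        by (rule sum.cong) (auto simp: ww_def ax_def wt_def True)
      finally show ?thesis .
    qed
    then show ?thesis
      unfolding 1 2 using True by (simp add: sum.distrib exc_wt_def sum_distrib_left)
  qed
qed

text \<open>With the weight \<open>v u\<close> on the last step and the factor \<open>rho^m\<close>, one-step extension of half-plane walks becomes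
the Markov chain \<open>trans u\<close> with a loss at the axis.\<close>

definition surv :: "real \<Rightarrow> nat \<Rightarrow> step \<Rightarrow> real" where
  "surv u m i = exp (lnrho u) ^ m * half_wt u m i * v u i"

definition mass :: "real \<Rightarrow> nat \<Rightarrow> real" where "mass u m = (\<Sum>i\<in>UNIV. surv u m i)"

text \<open>The weight of the south step that leaves the half-plane, together with the eigenvector entry of the
step.\<close>

definition exit_wt :: "real \<Rightarrow> real" where "exit_wt u = wt (lnrho u) u South * v u South"

lemma exit_wt_pos: "exit_wt u > 0" by (simp add: exit_wt_def wt_pos v_pos)

definition trans :: "real \<Rightarrow> step \<Rightarrow> step \<Rightarrow> real" where
  "trans u i j = M (lnrho u) u i j * v u j / v u i"

lemma trans_nonneg: "0 \<le> trans u i j"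
  using M_nonneg v_pos[THEN less_imp_le] by (simp add: trans_def)

lemma trans_pos: "R i j \<Longrightarrow> 0 < trans u i j"
  using M_pos v_pos by (simp add: trans_def)

lemma trans_stochastic: "(\<Sum>j\<in>UNIV. trans u i j) = 1"
  unfolding trans_def sum_divide_distrib[symmetric] M_v using v_pos[of u i] by simp

lemma surv_nonneg: "0 \<le> surv u m i"
  using half_wt_nonneg v_pos[THEN less_imp_le] by (simp add: surv_def)

lemma mass_nonneg: "0 \<le> mass u m" by (simp add: mass_def sum_nonneg surv_nonneg)

lemma surv_Suc:
  assumes "m \<ge> 1"
  shows "surv u (Suc m) j = row_apply (trans u) (surv u m) j - of_bool (j = South) * (exit_wt u * exc_wt m * exp (lnrho u) ^ m)"
proof -
  have "surv u (Suc m) j = exp (lnrho u) ^ Suc m * (\<Sum>i\<in>UNIV. half_wt u m i * M 0 u i j) * v u j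
      - of_bool (j = South) * exp (lnrho u) ^ Suc m * exp (- u) * exc_wt m * v u j"
    by (simp add: surv_def half_wt_Suc[OF assms] right_diff_distrib left_diff_distrib mult_ac)
  also have "exp (lnrho u) ^ Suc m * (\<Sum>i\<in>UNIV. half_wt u m i * M 0 u i j) * v u j = row_apply (trans u) (surv u m) j"
    unfolding row_apply_def sum_distrib_left sum_distrib_right
  proof (rule sum.cong)
    fix i
    show "exp (lnrho u) ^ Suc m * (half_wt u m i * M 0 u i j) * v u j = surv u m i * trans u i j"
      using v_pos[of u i] M_shift[of "lnrho u" u i j 0] by (simp add: surv_def trans_def)
  qed simp
  also have "of_bool (j = South) * exp (lnrho u) ^ Suc m * exp (- u) * exc_wt m * v u j = of_bool (j = South) * (exit_wt u * exc_wt m * exp (lnrho u) ^ m)"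
    by (simp add: exit_wt_def wt_def exp_diff exp_minus divide_inverse)
  finally show ?thesis .
qed

lemma mass_Suc:
  assumes "m \<ge> 1"
  shows "mass u (Suc m) = mass u m - exit_wt u * exc_wt m * exp (lnrho u) ^ m"
proof -
  have "mass u (Suc m) = sum (row_apply (trans u) (surv u m)) UNIV - (\<Sum>j\<in>UNIV. of_bool (j = South) * (exit_wt u * exc_wt m * exp (lnrho u) ^ m))"
    unfolding mass_def surv_Suc[OF assms] sum_subtractf ..
  also have "(\<Sum>j\<in>UNIV. of_bool (j = South) * (exit_wt u * exc_wt m * exp (lnrho u) ^ m)) = (\<Sum>j\<in>{South}. exit_wt u * exc_wt m * exp (lnrho u) ^ m)"
    by (rule sum.mono_neutral_cong_right) auto
  finally show ?thesis by (simp add: sum_row_apply[OF trans_stochastic] mass_def)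
qed

text \<open>A half-plane walk of length 1 is a step other than south.\<close>

lemma mass_1: "mass u 1 = (\<Sum>j\<in>- {South}. wt (lnrho u) u j * v u j)"
proof -
  have "surv u 1 j = (if j = South then 0 else wt (lnrho u) u j * v u j)" for j
    using wt_shift[of "lnrho u" u j 0] by (simp add: surv_def half_wt_1[simplified])
  then show ?thesis
    unfolding mass_def by (intro sum.mono_neutral_cong_right) auto
qed

lemma decseq_mass: "decseq (\<lambda>n. mass u (Suc n))"
proof (rule decseq_SucI)
  fix n
  have "0 \<le> exit_wt u * exc_wt (Suc n) * exp (lnrho u) ^ Suc n"
    using exit_wt_pos[of u] exc_wt_nonneg by simp
  then show "mass u (Suc (Suc n)) \<le> mass u (Suc n)" using mass_Suc[of "Suc n" u] by simp
qed

lemma surv_le_mass: "surv u m i \<le> mass u m"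
  unfolding mass_def by (rule member_le_sum) (use surv_nonneg in auto)

text \<open>Half-plane weights increase with \<open>u\<close>. Comparison with \<open>u0\<close>, where the mass is bounded, gives geometric
decay with ratio \<open>exp (lnrho u - lnrho u0)\<close>.\<close>

lemma mass_tendsto_0:
  assumes "u < u0"
  shows "(\<lambda>n. mass u (Suc n)) \<longlonglongrightarrow> 0"
proof -
  define q where "q = exp (lnrho u - lnrho u0)"
  have q: "0 \<le> q" "q < 1" using lnrho_less_u0[OF assms] by (auto simp: q_def)
  define K where "K = (\<Sum>i\<in>UNIV. mass u0 1 * (v u i / v u0 i))"
  have bound: "mass u (Suc n) \<le> q ^ Suc n * K" for n
  proof -
    have "surv u (Suc n) i \<le> q ^ Suc n * (mass u0 1 * (v u i / v u0 i))" for i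
    proof -
      have "surv u (Suc n) i \<le> exp (lnrho u) ^ Suc n * half_wt u0 (Suc n) i * v u i"
        unfolding surv_def using assms v_pos[of u i] by (intro mult_right_mono mult_left_mono half_wt_mono) auto
      also have "\<dots> = q ^ Suc n * (surv u0 (Suc n) i * (v u i / v u0 i))"
        using v_pos[of u0 i] by (simp add: surv_def q_def exp_diff power_divide)
      also have "\<dots> \<le> q ^ Suc n * (mass u0 1 * (v u i / v u0 i))"
      proof (intro mult_left_mono mult_right_mono)
        show "surv u0 (Suc n) i \<le> mass u0 1"
          using surv_le_mass[of u0 "Suc n" i] decseqD[OF decseq_mass, of 0 n u0] by simp
      qed (use q v_pos[of u i] v_pos[of u0 i] in auto)
      finally show ?thesis .
    qed
    then show ?thesis unfolding mass_def K_def sum_distrib_left by (intro sum_mono)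
  qed
  have "(\<lambda>n. q ^ Suc n * K) \<longlonglongrightarrow> 0 * K"
    by (rule tendsto_mult_right[OF LIMSEQ_Suc[OF LIMSEQ_realpow_zero[OF q]]])
  then have "(\<lambda>n. q ^ Suc n * K) \<longlonglongrightarrow> 0" by simp
  show ?thesis
  proof (rule real_tendsto_sandwich[OF _ _ tendsto_const \<open>(\<lambda>n. q ^ Suc n * K) \<longlonglongrightarrow> 0\<close>])
    show "eventually (\<lambda>n. 0 \<le> mass u (Suc n)) sequentially" by (simp add: mass_nonneg)
    show "eventually (\<lambda>n. mass u (Suc n) \<le> q ^ Suc n * K) sequentially"
      using bound by (rule always_eventually[OF allI])
  qed
qed

text \<open>The excursion series at the point \<open>t = exp (lnrho u)\<close> of the critical curve, as a quotient (see
\<open>excursion_sums\<close>). It equals \<open>C / D\<close> at this point, for every \<open>\<theta>\<close>; this is what the kernel method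
obtains by annihilating the kernel \<open>1 - B\<close>.\<close>

definition exc_gf :: "real \<Rightarrow> real" where "exc_gf u = mass u 1 / exit_wt u"

text \<open>The losses of mass telescope, and no mass is left in the limit.\<close>

lemma excursion_sums:
  assumes "u < u0"
  shows "(\<lambda>n. exc_wt (Suc n) * exp (lnrho u) ^ Suc n) sums exc_gf u"
proof -
  have "(\<lambda>n. mass u (Suc n) - mass u (Suc (Suc n))) sums (mass u (Suc 0) - 0)"
    by (rule telescope_sums'[OF mass_tendsto_0[OF assms]])
  then have "(\<lambda>n. (exit_wt u * exc_wt (Suc n) * exp (lnrho u) ^ Suc n) / exit_wt u) sums ((mass u (Suc 0) - 0) / exit_wt u)"
    using mass_Suc[of "Suc _" u] by (intro sums_divide) simp
  then show ?thesis using exit_wt_pos[of u] by (simp add: exc_gf_def mult.assoc)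
qed

text \<open>The series of the mass at \<open>u0\<close> is linear in the excursion series, and the latter is known at
\<open>t = exp (lnrho u)\<close> for \<open>u < u0\<close>.\<close>

lemma mass_generating_function:
  assumes "u < u0"
  defines "r \<equiv> exp (lnrho u - lnrho u0)"
  shows "(1 - r) * (\<Sum>n. mass u0 (Suc n) * r ^ n) = exit_wt u0 * (exc_gf u0 - exc_gf u)"
proof -
  define a where "a n = mass u0 (Suc n)" for n
  have r: "0 < r" "r < 1" using lnrho_less_u0[OF assms(1)] by (auto simp: r_def)
  have a_le: "\<bar>a n\<bar> \<le> a 0" for n
    using decseqD[OF decseq_mass, of 0 n u0] mass_nonneg by (simp add: a_def)
  have s: "summable (\<lambda>n. a n * r ^ n)"
    by (rule summable_bounded_power_real[OF a_le]) (use r in simp)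
  have d: "(a n - a (Suc n)) * r ^ Suc n = exit_wt u0 * (exc_wt (Suc n) * exp (lnrho u) ^ Suc n)" for n
  proof -
    have "exp (lnrho u0) ^ Suc n * r ^ Suc n = exp (lnrho u) ^ Suc n"
      unfolding power_mult_distrib[symmetric] by (simp add: r_def exp_diff)
    then show ?thesis using mass_Suc[of "Suc n" u0] by (simp add: a_def mult.assoc)
  qed
  have "(\<lambda>n. (a n - a (Suc n)) * r ^ Suc n) sums (exit_wt u0 * exc_gf u)"
    unfolding d by (rule sums_mult[OF excursion_sums[OF assms(1)]])
  moreover have "(\<lambda>n. (a n - a (Suc n)) * r ^ Suc n) sums (r * (\<Sum>n. a n * r ^ n) - ((\<Sum>n. a n * r ^ n) - a 0))"
  proof -
    have "(\<lambda>n. r * (a n * r ^ n)) sums (r * (\<Sum>n. a n * r ^ n))" by (rule sums_mult[OF summable_sums[OF s]])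
    moreover have "(\<lambda>n. a (Suc n) * r ^ Suc n) sums ((\<Sum>n. a n * r ^ n) - a 0)"
      using sums_split_initial_segment[OF summable_sums[OF s], of 1] by simp
    ultimately have "(\<lambda>n. r * (a n * r ^ n) - a (Suc n) * r ^ Suc n) sums (r * (\<Sum>n. a n * r ^ n) - ((\<Sum>n. a n * r ^ n) - a 0))"
      by (rule sums_diff)
    then show ?thesis by (simp add: algebra_simps)
  qed
  ultimately have "exit_wt u0 * exc_gf u = r * (\<Sum>n. a n * r ^ n) - ((\<Sum>n. a n * r ^ n) - a 0)" by (rule sums_unique2)
  moreover have "a 0 = exit_wt u0 * exc_gf u0" using exit_wt_pos[of u0] by (simp add: exc_gf_def a_def)
  ultimately show ?thesis by (simp add: a_def algebra_simps)
qed

text \<open>As \<open>u\<close> increases to \<open>u0\<close>, the ratio \<open>exp (lnrho u - lnrho u0)\<close> takes all values close to 1, by the intermediate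
value theorem.\<close>

lemma at_left_parametrization:
  fixes f :: "real \<Rightarrow> real"
  assumes "((\<lambda>u. f (exp (lnrho u - lnrho u0))) \<longlongrightarrow> L) (at_left u0)"
  shows "(f \<longlongrightarrow> L) (at_left 1)"
proof (rule tendstoI)
  fix e :: real assume "e > 0"
  from tendstoD[OF assms this] obtain b where b: "b < u0" "\<And>u. b < u \<Longrightarrow> u < u0 \<Longrightarrow> dist (f (exp (lnrho u - lnrho u0))) L < e"
    unfolding eventually_at_left_field by auto
  have "exp (lnrho b - lnrho u0) < 1" using lnrho_less_u0[OF b(1)] by simp
  moreover have "dist (f r) L < e" if r: "exp (lnrho b - lnrho u0) < r" "r < 1" for r
  proof -
    have "r > 0" using r(1) exp_gt_zero[of "lnrho b - lnrho u0"] by linarith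
    then have lnr: "lnrho b < lnrho u0 + ln r" "lnrho u0 + ln r < lnrho u0"
      using r ln_less_cancel_iff[of "exp (lnrho b - lnrho u0)" r] by auto
    have "\<exists>u\<ge>b. u \<le> u0 \<and> lnrho u = lnrho u0 + ln r"
    proof (rule IVT)
      show "\<forall>u. b \<le> u \<and> u \<le> u0 \<longrightarrow> isCont lnrho u" using DERIV_isCont[OF lnrho_derivative] by blast
    qed (use lnr b in auto)
    then obtain u where u: "b \<le> u" "u \<le> u0" "lnrho u = lnrho u0 + ln r" by blast
    have "u \<noteq> b" "u \<noteq> u0" using u lnr by auto
    then have "dist (f (exp (lnrho u - lnrho u0))) L < e" using b(2)[of u] u by simp
    then show ?thesis using u \<open>r > 0\<close> by simp
  qed
  ultimately show "eventually (\<lambda>r. dist (f r) L < e) (at_left 1)"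
    unfolding eventually_at_left_field by blast
qed

lemma mass_abelian:
  assumes "(exc_gf has_real_derivative q') (at u0)"
  shows "((\<lambda>r. sqrt (1 - r) * (\<Sum>n. mass u0 (Suc n) * r ^ n)) \<longlongrightarrow> exit_wt u0 * (q' * sqrt (2 / curv \<theta> u0))) (at_left 1)"
proof (rule at_left_parametrization)
  have "((\<lambda>u. exit_wt u0 * ((exc_gf u0 - exc_gf u) / sqrt (1 - exp (lnrho u - lnrho u0)))) \<longlongrightarrow> exit_wt u0 * (q' * sqrt (2 / curv \<theta> u0))) (at_left u0)"
    by (intro tendsto_intros sqrt_gap_asymptotic assms)
  moreover have "eventually (\<lambda>u. exit_wt u0 * ((exc_gf u0 - exc_gf u) / sqrt (1 - exp (lnrho u - lnrho u0)))
    = sqrt (1 - exp (lnrho u - lnrho u0)) * (\<Sum>n. mass u0 (Suc n) * exp (lnrho u - lnrho u0) ^ n)) (at_left u0)"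
    unfolding eventually_at_filter
  proof (intro always_eventually allI impI)
    fix u assume "u \<in> {..<u0}"
    then have u: "u < u0" by simp
    define p where "p = sqrt (1 - exp (lnrho u - lnrho u0))"
    have p: "p > 0" "p * p = 1 - exp (lnrho u - lnrho u0)" using lnrho_less_u0[OF u] by (auto simp: p_def)
    have "p * p * (\<Sum>n. mass u0 (Suc n) * exp (lnrho u - lnrho u0) ^ n) = exit_wt u0 * (exc_gf u0 - exc_gf u)"
      using mass_generating_function[OF u] p(2) by simp
    then show "exit_wt u0 * ((exc_gf u0 - exc_gf u) / sqrt (1 - exp (lnrho u - lnrho u0))) = sqrt (1 - exp (lnrho u - lnrho u0)) * (\<Sum>n. mass u0 (Suc n) * exp (lnrho u - lnrho u0) ^ n)"
      using p(1) unfolding p_def[symmetric] by (simp add: field_simps)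
  qed
  ultimately show "((\<lambda>u. sqrt (1 - exp (lnrho u - lnrho u0)) * (\<Sum>n. mass u0 (Suc n) * exp (lnrho u - lnrho u0) ^ n)) \<longlongrightarrow> exit_wt u0 * (q' * sqrt (2 / curv \<theta> u0))) (at_left u0)"
    by (rule Lim_transform_eventually)
qed

section \<open>Last steps, constants and the asymptotics\<close>

lemma gf_derivative_s:
  "gconv A b s u \<Longrightarrow> ((\<lambda>s. gf A b s u) has_real_derivative gf A (\<lambda>w. len w * b w) s u) (at s)"
  using gf_chain[OF _ DERIV_ident DERIV_const, of A b s u] by simp

text \<open>Kac's formula. Pairing the passage equations with the left eigenvector gives
\<open>l \<theta> (1 - B) = (1 - exp (s - lnrho u)) X s\<close> near the critical value, where \<open>X\<close> is the pairing of \<open>l\<close> with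
\<open>hit\<close>; differentiation at \<open>s = lnrho u\<close> yields the mean length.\<close>

lemma mean_return_length:
  "gf (return_walks \<theta>) len (lnrho u) u = (\<Sum>j\<in>UNIV. l u j * v u j) / (l u \<theta> * v u \<theta>)"
proof -
  obtain \<epsilon> where \<epsilon>: "\<epsilon> > 0" "ww (lnrho u + \<epsilon>) u summable_on passages \<theta>" using summable_beyond by blast
  have summ: "ww s u summable_on passage \<theta> j" if "s < lnrho u + \<epsilon>" for s j
  proof (rule summable_on_comparison_test)
    show "ww (lnrho u + \<epsilon>) u summable_on passage \<theta> j"
      by (rule summable_on_subset_banach[OF \<epsilon>(2)]) (auto simp: passages_eq)
    show "ww s u w \<le> ww (lnrho u + \<epsilon>) u w" for w
      using that x_pos by (auto simp: ww_def intro!: mult_left_mono)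
  qed (use ww_pos[THEN less_imp_le] in auto)
  define X where "X s = (\<Sum>j\<in>UNIV. l u j * hit \<theta> s u j)" for s
  have id: "l u \<theta> * (1 - gf (return_walks \<theta>) (\<lambda>w. 1) s u) = (1 - exp (s - lnrho u)) * X s" if "s < lnrho u + \<epsilon>" for s
  proof -
    note sm = summ[OF that]
    have "exp (s - lnrho u) * X s = (\<Sum>j\<in>UNIV. l u j * (\<Sum>i\<in>UNIV. M s u j i * hit \<theta> s u i))"
      by (simp add: X_def l_M_apply)
    also have "\<dots> = (\<Sum>j\<in>UNIV. l u j * hit \<theta> s u j + (if j = \<theta> then l u \<theta> * (infsum (ww s u) (return_walks \<theta>) - 1) else 0))"
    proof (rule sum.cong)
      fix j
      show "l u j * (\<Sum>i\<in>UNIV. M s u j i * hit \<theta> s u i)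
          = l u j * hit \<theta> s u j + (if j = \<theta> then l u \<theta> * (infsum (ww s u) (return_walks \<theta>) - 1) else 0)"
        unfolding infsum_successors[OF sm, symmetric]
        by (auto simp: return_walks_eq hit_def algebra_simps)
    qed simp
    also have "\<dots> = X s + l u \<theta> * (infsum (ww s u) (return_walks \<theta>) - 1)"
      by (simp add: sum.distrib X_def)
    finally show ?thesis by (simp add: gf_infsum algebra_simps)
  qed
  have hit_D: "\<exists>D. ((\<lambda>s. hit \<theta> s u j) has_real_derivative D) (at (lnrho u))" for j
  proof (cases "j = \<theta>")
    case False
    have "(\<Union>i\<in>{i. R j i}. passage \<theta> i) \<subseteq> passages \<theta>" by (auto simp: passages_eq)
    from gf_derivative_s[OF gconv_passages[OF this]] show ?thesis
      using False by (auto simp: hit_def gf_infsum)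
  qed (auto simp: hit_def intro: exI[of _ 0])
  then obtain D where D: "\<And>j. ((\<lambda>s. hit \<theta> s u j) has_real_derivative D j) (at (lnrho u))" by metis
  have X_D: "(X has_real_derivative (\<Sum>j\<in>UNIV. l u j * D j)) (at (lnrho u))"
    unfolding X_def by (intro DERIV_sum DERIV_cmult D)
  have "((\<lambda>s. (1 - exp (s - lnrho u)) * X s) has_real_derivative (- exp (lnrho u - lnrho u)) * X (lnrho u) + (\<Sum>j\<in>UNIV. l u j * D j) * (1 - exp (lnrho u - lnrho u))) (at (lnrho u))"
    by (intro DERIV_mult X_D) (auto intro!: derivative_eq_intros)
  then have 1: "((\<lambda>s. (1 - exp (s - lnrho u)) * X s) has_real_derivative - X (lnrho u)) (at (lnrho u))" by simp
  have "((\<lambda>s. l u \<theta> * (1 - gf (return_walks \<theta>) (\<lambda>w. 1) s u)) has_real_derivative l u \<theta> * (0 - gf (return_walks \<theta>) len (lnrho u) u)) (at (lnrho u))"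
    using gf_derivative_s[OF gconv_passages[OF return_walks_passages[of \<theta>]]] by (intro DERIV_cmult DERIV_diff DERIV_const) simp
  then have "((\<lambda>s. (1 - exp (s - lnrho u)) * X s) has_real_derivative l u \<theta> * (0 - gf (return_walks \<theta>) len (lnrho u) u)) (at (lnrho u))"
    by (rule has_field_derivative_transform_within_open[of _ _ _ "{..<lnrho u + \<epsilon>}"]) (use \<epsilon> id in auto)
  from DERIV_unique[OF this 1] have "l u \<theta> * gf (return_walks \<theta>) len (lnrho u) u = X (lnrho u)" by simp
  also have "X (lnrho u) = (\<Sum>j\<in>UNIV. l u j * v u j) / v u \<theta>"
    by (simp add: X_def hit_lnrho sum_divide_distrib)
  finally have eq: "l u \<theta> * gf (return_walks \<theta>) len (lnrho u) u = (\<Sum>j\<in>UNIV. l u j * v u j) / v u \<theta>" .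
  have "gf (return_walks \<theta>) len (lnrho u) u = l u \<theta> * gf (return_walks \<theta>) len (lnrho u) u / l u \<theta>"
    using l_pos[of u \<theta>] by simp
  then show ?thesis unfolding eq by (simp only: divide_divide_eq_left mult.commute)
qed

text \<open>The invariant distribution of \<open>trans u0\<close>.\<close>

definition inv_law :: "step \<Rightarrow> real" where
  "inv_law j = l u0 j * v u0 j / (\<Sum>i\<in>UNIV. l u0 i * v u0 i)"

lemma sum_l_v_pos: "(\<Sum>i\<in>UNIV. l u i * v u i) > 0"
  using l_pos v_pos by (intro sum_pos) auto

lemma inv_law_pos: "inv_law j > 0"
  using l_pos v_pos sum_l_v_pos by (simp add: inv_law_def)

lemma sum_inv_law: "sum inv_law UNIV = 1"
  unfolding inv_law_def sum_divide_distrib[symmetric] using sum_l_v_pos[of u0] by simp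

lemma inv_law_invariant: "row_apply (trans u0) inv_law j = inv_law j"
proof -
  have "row_apply (trans u0) inv_law j = (\<Sum>i\<in>UNIV. l u0 i * M (lnrho u0) u0 i j * v u0 j / (\<Sum>i\<in>UNIV. l u0 i * v u0 i))"
    unfolding row_apply_def
  proof (rule sum.cong)
    fix i
    show "inv_law i * trans u0 i j = l u0 i * M (lnrho u0) u0 i j * v u0 j / (\<Sum>i\<in>UNIV. l u0 i * v u0 i)"
      using v_pos[of u0 i] by (simp add: inv_law_def trans_def)
  qed simp
  also have "\<dots> = (\<Sum>i\<in>UNIV. l u0 i * M (lnrho u0) u0 i j) * v u0 j / (\<Sum>i\<in>UNIV. l u0 i * v u0 i)"
    by (simp add: sum_divide_distrib sum_distrib_right)
  finally show ?thesis by (simp add: l_M inv_law_def)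
qed

lemma return_len_inv_law: "gf (return_walks \<theta>) len (lnrho u0) u0 = 1 / inv_law \<theta>"
  by (simp add: mean_return_length inv_law_def)

definition deviation :: "nat \<Rightarrow> step \<Rightarrow> real" where
  "deviation n j = surv u0 (Suc n) j - inv_law j * mass u0 (Suc n)"

text \<open>Relative to the invariant distribution, the loss at the axis is a perturbation whose size is the decrement of
the mass, so the results on perturbed chains apply.\<close>

lemma deviation_facts:
  shows "summable (\<lambda>n. l1 (deviation n))"
    and "(\<lambda>n. sqrt n * mass u0 (Suc n)) \<longlonglongrightarrow> c \<Longrightarrow> (\<lambda>n. sqrt n * l1 (deviation n)) \<longlonglongrightarrow> 0"
proof -
  obtain k where k: "k \<ge> 1" "\<And>i j. (R ^^ k) i j" using relpowp_all by blast
  define e where "e j = of_bool (j = South) - inv_law j" for j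
  have e: "l1 e \<le> 2"
  proof -
    have "l1 e \<le> (\<Sum>j\<in>UNIV. of_bool (j = South) + inv_law j)"
      unfolding l1_def e_def using inv_law_pos by (intro sum_mono) (auto simp: abs_if less_imp_le add_nonneg_nonneg)
    also have "\<dots> = 2" by (simp add: sum.distrib sum_inv_law of_bool_def)
    finally show ?thesis .
  qed
  have sum0: "sum (deviation n) UNIV = 0" for n
    by (simp add: deviation_def sum_subtractf sum_distrib_right[symmetric] sum_inv_law mass_def)
  have rec: "deviation (Suc n) j = row_apply (trans u0) (deviation n) j - (mass u0 (Suc n) - mass u0 (Suc (Suc n))) * e j" for n j
  proof -
    have "row_apply (trans u0) (deviation n) j = row_apply (trans u0) (surv u0 (Suc n)) j - mass u0 (Suc n) * row_apply (trans u0) inv_law j"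
      unfolding row_apply_def deviation_def left_diff_distrib sum_subtractf sum_distrib_left by (simp add: mult_ac)
    then have row: "row_apply (trans u0) (surv u0 (Suc n)) j = row_apply (trans u0) (deviation n) j + mass u0 (Suc n) * inv_law j"
      by (simp add: inv_law_invariant)
    have kd: "exit_wt u0 * exc_wt (Suc n) * exp (lnrho u0) ^ Suc n = mass u0 (Suc n) - mass u0 (Suc (Suc n))"
      using mass_Suc[of "Suc n" u0] by simp
    have "surv u0 (Suc (Suc n)) j = row_apply (trans u0) (surv u0 (Suc n)) j - of_bool (j = South) * (mass u0 (Suc n) - mass u0 (Suc (Suc n)))"
      unfolding kd[symmetric] by (rule surv_Suc) simp
    then show ?thesis unfolding row by (simp add: deviation_def e_def algebra_simps)
  qed
  note hyps = trans_nonneg[of u0] trans_pos[of _ _ u0] trans_stochastic[of u0] k(2,1) decseq_mass[of u0] mass_nonneg[of u0] e sum0 rec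
  show "summable (\<lambda>n. l1 (deviation n))"
    by (rule perturbed_chain_summable[of "trans u0" R k "\<lambda>n. mass u0 (Suc n)" e deviation]) (use hyps in auto)
  show "(\<lambda>n. sqrt n * l1 (deviation n)) \<longlonglongrightarrow> 0" if "(\<lambda>n. sqrt n * mass u0 (Suc n)) \<longlonglongrightarrow> c"
    by (rule perturbed_chain_negligible[of "trans u0" R k "\<lambda>n. mass u0 (Suc n)" e deviation c]) (use hyps that in auto)
qed

text \<open>The class of walks enumerated by \<open>C\<close>; that of \<open>D\<close> is \<open>passage \<theta> South\<close>.\<close>

definition non_south :: "step \<Rightarrow> walk set" where
  "non_south \<theta> = {w \<in> walks R. hd w \<noteq> South \<and> first_return \<theta> w}"

lemma non_south_eq: "non_south \<theta> = (\<Union>i\<in>- {South}. passage \<theta> i)" by (auto simp: non_south_def passage_def)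

lemma non_south_passages: "non_south \<theta> \<subseteq> passages \<theta>" by (auto simp: non_south_def passages_def)

lemma passage_passages: "passage \<theta> j \<subseteq> passages \<theta>" by (auto simp: passage_def passages_def)

lemma gf_non_south: "gf (non_south \<theta>) (\<lambda>w. 1) (lnrho u) u = mass u 1 / v u \<theta>"
proof -
  have "gf (non_south \<theta>) (\<lambda>w. 1) (lnrho u) u = (\<Sum>j\<in>- {South}. wt (lnrho u) u j * hit \<theta> (lnrho u) u j)"
    unfolding gf_infsum non_south_eq mult_1 infsum_UN_passage(2)[OF passage_summable_lnrho] infsum_passage[OF passage_summable_lnrho] ..
  then show ?thesis by (simp add: hit_lnrho mass_1[simplified] sum_divide_distrib)
qed

lemma gf_south: "gf (passage \<theta> South) (\<lambda>w. 1) (lnrho u) u = exit_wt u / v u \<theta>"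
  by (simp add: gf_infsum infsum_passage[OF passage_summable_lnrho] hit_lnrho exit_wt_def)

text \<open>At \<open>u0\<close> the critical curve is horizontal, so differentiation along it amounts to differentiation in
\<open>u\<close> at fixed \<open>s\<close>.\<close>

lemma exc_gf_derivative:
  fixes \<theta> :: step
  defines "c \<equiv> gf (non_south \<theta>) (\<lambda>w. 1) (lnrho u0) u0" and "c' \<equiv> gf (non_south \<theta>) ht (lnrho u0) u0"
    and "d \<equiv> gf (passage \<theta> South) (\<lambda>w. 1) (lnrho u0) u0" and "d' \<equiv> gf (passage \<theta> South) ht (lnrho u0) u0"
  shows "(exc_gf has_real_derivative (c' * d - c * d') / (d * d)) (at u0)"
proof -
  have exc_gf: "exc_gf = (\<lambda>u. gf (non_south \<theta>) (\<lambda>w. 1) (lnrho u) u / gf (passage \<theta> South) (\<lambda>w. 1) (lnrho u) u)"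
  proof
    fix u
    have "v u \<theta> \<noteq> 0" using v_pos[of u \<theta>] by simp
    then show "exc_gf u = gf (non_south \<theta>) (\<lambda>w. 1) (lnrho u) u / gf (passage \<theta> South) (\<lambda>w. 1) (lnrho u) u"
      by (simp add: gf_non_south gf_south exc_gf_def)
  qed
  have 1: "((\<lambda>u. gf (non_south \<theta>) (\<lambda>w. 1) (lnrho u) u) has_real_derivative c') (at u0)"
    using gf_curve_derivative[OF gconv_passages[OF non_south_passages], of \<theta> u0 \<theta>] by (simp add: slope_u0 c'_def)
  have 2: "((\<lambda>u. gf (passage \<theta> South) (\<lambda>w. 1) (lnrho u) u) has_real_derivative d') (at u0)"
    using gf_curve_derivative[OF gconv_passages[OF passage_passages], of \<theta> South u0 \<theta>] by (simp add: slope_u0 d'_def)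
  have "d \<noteq> 0" using exit_wt_pos[of u0] v_pos[of u0 \<theta>] by (simp add: d_def gf_south)
  then show ?thesis unfolding exc_gf using DERIV_divide[OF 1 2] by (simp add: c_def d_def)
qed

definition qslope :: real where "qslope = deriv exc_gf u0"

lemma qslope: "(exc_gf has_real_derivative qslope) (at u0)"
  unfolding qslope_def using DERIV_imp_deriv[OF exc_gf_derivative] exc_gf_derivative by metis

lemma qslope_eq:
  "qslope * gf (passage \<theta> South) (\<lambda>w. 1) (lnrho u0) u0 = gf (non_south \<theta>) ht (lnrho u0) u0
     - gf (passage \<theta> South) ht (lnrho u0) u0 * (gf (non_south \<theta>) (\<lambda>w. 1) (lnrho u0) u0 / gf (passage \<theta> South) (\<lambda>w. 1) (lnrho u0) u0)"
proof -
  have "gf (passage \<theta> South) (\<lambda>w. 1) (lnrho u0) u0 \<noteq> 0" using exit_wt_pos[of u0] v_pos[of u0 \<theta>] by (simp add: gf_south)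
  then show ?thesis
    unfolding DERIV_unique[OF qslope exc_gf_derivative[of \<theta>]] by (simp add: field_simps)
qed

text \<open>The excursion series does not depend on \<open>\<theta>\<close>, so take \<open>\<theta> = South\<close>, where \<open>D\<close> is the single south step. Then, up to a
positive factor, the derivative is a weighted sum over walks of their number of north steps, and some walk
leads from a north step to a south step.\<close>

lemma qslope_pos: "qslope > 0"
proof -
  define d where "d = gf (passage South South) (\<lambda>w. 1) (lnrho u0) u0"
  have "d > 0" using exit_wt_pos[of u0] v_pos[of u0 South] by (simp add: d_def gf_south)
  have d': "gf (passage South South) ht (lnrho u0) u0 = - d"
    by (simp add: d_def gf_infsum passage_self ht_def end_y_def)
  note c = gconv_passages[OF non_south_passages[of South], of u0]
  have s1: "ww (lnrho u0) u0 summable_on non_south South" using gconv_summable[OF c] by simp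
  have s2: "(\<lambda>w. ht w * ww (lnrho u0) u0 w) summable_on non_south South" using gconv_summable[OF gconv_ht[OF c]] by simp
  have eq: "qslope * d = infsum (\<lambda>w. ht w * ww (lnrho u0) u0 w + ww (lnrho u0) u0 w) (non_south South)"
  proof -
    have "qslope * d = gf (non_south South) ht (lnrho u0) u0 + gf (non_south South) (\<lambda>w. 1) (lnrho u0) u0"
      using qslope_eq[of South] \<open>d > 0\<close> unfolding d' d_def[symmetric] by simp
    then show ?thesis unfolding infsum_add[OF s2 s1] gf_infsum by simp
  qed
  have ge: "- 1 \<le> ht w" "hd w = North \<Longrightarrow> 0 \<le> ht w" if "w \<in> passages South" for w
  proof -
    have "ht w = real (count_list w North) - 1"
      using that by (simp add: ht_def end_y_count passages_def first_return_def)
    moreover have "hd w = North \<Longrightarrow> count_list w North \<ge> 1"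
      using that by (cases w) (auto simp: passages_def walks_def)
    ultimately show "- 1 \<le> ht w" "hd w = North \<Longrightarrow> 0 \<le> ht w" by auto
  qed
  have nonneg: "0 \<le> ht w * ww (lnrho u0) u0 w + ww (lnrho u0) u0 w" if "w \<in> non_south South" for w
  proof -
    have "0 \<le> (ht w + 1) * ww (lnrho u0) u0 w"
      using ge(1)[of w] subsetD[OF non_south_passages that] ww_pos[of "lnrho u0" u0 w] by (intro mult_nonneg_nonneg) auto
    then show ?thesis by (simp add: algebra_simps)
  qed
  have "infsum (ww (lnrho u0) u0) (passage South North) > 0"
    unfolding infsum_passage[OF passage_summable_lnrho] hit_lnrho by (simp add: wt_pos v_pos)
  then have "passage South North \<noteq> {}" by auto
  then obtain w where w: "w \<in> passage South North" by blast
  then have wn: "w \<in> non_south South" "0 \<le> ht w" using ge(2)[of w] by (auto simp: passage_def non_south_def passages_def)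
  have "qslope * d > 0"
  proof (rule ccontr)
    assume "\<not> ?thesis"
    then have "ht w * ww (lnrho u0) u0 w + ww (lnrho u0) u0 w = 0"
      unfolding eq by (intro nonneg_infsum_le_0D[OF _ summable_on_add[OF s2 s1] nonneg wn(1)]) auto
    then show False using wn(2) ww_pos[of "lnrho u0" u0 w] mult_nonneg_nonneg[of "ht w" "ww (lnrho u0) u0 w"] by linarith
  qed
  then show ?thesis using \<open>d > 0\<close> by (simp add: zero_less_mult_iff)
qed

text \<open>The constant in the singular behaviour of the mass series at \<open>u0\<close>.\<close>

definition amplitude :: real where "amplitude = exit_wt u0 * (qslope * sqrt (2 / curv South u0))"

lemma amplitude_pos: "amplitude > 0"
  using exit_wt_pos qslope_pos curv_pos by (simp add: amplitude_def)

lemma curv_eq: "curv \<theta> u0 = curv South u0"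
  using kappa_mu_yy[of \<theta>] kappa_mu_yy[of South] by simp

lemma B_return: "B R \<theta> = gen_fun (return_walks \<theta>)" by (simp add: B_def return_walks_def)
lemma C_non_south: "C R \<theta> = gen_fun (non_south \<theta>)" by (simp add: C_def non_south_def)
lemma D_south: "D R \<theta> = gen_fun (passage \<theta> South)" by (simp add: D_def passage_def)

text \<open>The formula for \<open>c0\<close> is the product of \<open>inv_law \<theta>\<close>, by Kac's formula, of the square root from the maximum
of \<open>lnrho\<close>, and of the derivative of \<open>C / D\<close> times \<open>D\<close>; here \<open>D = exit_wt u0 / v u0 \<theta>\<close>.\<close>

lemma c0_eq: "c0 R \<theta> x = inv_law \<theta> * amplitude / v u0 \<theta>"
proof -
  define d where "d = gf (passage \<theta> South) (\<lambda>w. 1) (lnrho u0) u0"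
  define \<tau> where "\<tau> = exp u0"
  have "\<tau> > 0" by (simp add: \<tau>_def)
  note dt = DERIV_imp_deriv[OF gen_fun_derivative_t[OF gconv_passages]] and dy = DERIV_imp_deriv[OF gen_fun_derivative_y[OF gconv_passages]]
  have "exp (lnrho u0) * deriv_t (B R \<theta>) (exp (lnrho u0)) x (exp u0) = 1 / inv_law \<theta>"
    unfolding deriv_t_def B_return dt[OF return_walks_passages] by (simp add: return_len_inv_law)
  moreover have "sqrt (2 / (curv \<theta> u0 / \<tau>\<^sup>2)) = \<tau> * sqrt (2 / curv South u0)"
  proof -
    have "2 / (curv \<theta> u0 / \<tau>\<^sup>2) = \<tau>\<^sup>2 * (2 / curv South u0)" by (simp add: curv_eq[of \<theta>])
    then show ?thesis using \<open>\<tau> > 0\<close> by (simp only: real_sqrt_mult) simp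
  qed
  moreover have "deriv_y (C R \<theta>) (exp (lnrho u0)) x (exp u0) - deriv_y (D R \<theta>) (exp (lnrho u0)) x (exp u0)
      * (C R \<theta> (exp (lnrho u0)) x (exp u0) / D R \<theta> (exp (lnrho u0)) x (exp u0)) = qslope * d / \<tau>"
    unfolding deriv_y_def C_non_south D_south dy[OF non_south_passages] dy[OF passage_passages] gen_fun_gf d_def qslope_eq[of \<theta>]
    by (simp add: \<tau>_def diff_divide_distrib)
  ultimately have "c0 R \<theta> x = \<tau> * sqrt (2 / curv South u0) * (1 / (1 / inv_law \<theta>)) * (qslope * d / \<tau>)"
    unfolding c0_def Let_def kappa_mu_yy[of \<theta>] unfolding tau_eq kappa_eq \<tau>_def[symmetric] by simp
  also have "\<dots> = inv_law \<theta> * (d * (qslope * sqrt (2 / curv South u0)))"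
    using \<open>\<tau> > 0\<close> by (simp add: mult_ac)
  also have "d = exit_wt u0 / v u0 \<theta>" by (simp add: d_def gf_south)
  finally show ?thesis by (simp add: amplitude_def mult_ac)
qed

lemma c0_pos: "c0 R \<theta> x > 0"
  using inv_law_pos amplitude_pos v_pos by (simp add: c0_eq)

lemma mass_asymptotic: "(\<lambda>n. sqrt n * mass u0 (Suc n)) \<longlonglongrightarrow> amplitude / sqrt pi"
  by (rule monotone_tauberian[OF decseq_mass mass_nonneg])
     (use mass_abelian[OF qslope, of South] in \<open>simp add: amplitude_def\<close>)

lemma surv_asymptotic: "(\<lambda>n. sqrt n * surv u0 (Suc n) \<theta>) \<longlonglongrightarrow> inv_law \<theta> * (amplitude / sqrt pi)"
proof -
  have "(\<lambda>n. sqrt n * deviation n \<theta>) \<longlonglongrightarrow> 0"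
  proof (rule Lim_null_comparison[OF _ deviation_facts(2)[OF mass_asymptotic]])
    show "eventually (\<lambda>n. norm (sqrt n * deviation n \<theta>) \<le> sqrt n * l1 (deviation n)) sequentially"
      using l1_component by (intro always_eventually allI) (auto simp: abs_mult intro!: mult_left_mono)
  qed
  from tendsto_add[OF this tendsto_mult_left[OF mass_asymptotic, of "inv_law \<theta>"]] show ?thesis
    by (simp add: deviation_def algebra_simps)
qed

text \<open>The deviation from the invariant distribution is summable, hence bounded in the disc, and disappears after
multiplication by \<open>(1 - z)^(1/2)\<close>.\<close>

lemma surv_disc:
  "((\<lambda>z. (\<Sum>n. of_real (surv u0 (Suc n) \<theta>) * z ^ n) * (1 - z) powr (1/2)) \<longlongrightarrow> (of_real (inv_law \<theta> * amplitude) :: complex)) (at 1 within ball 0 1)"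
proof -
  have A: "((\<lambda>z. (\<Sum>n. of_real (mass u0 (Suc n)) * z ^ n) * (1 - z) powr (1/2)) \<longlongrightarrow> (of_real amplitude :: complex)) (at 1 within ball 0 1)"
    by (rule monotone_abelian_disc[OF decseq_mass mass_nonneg mass_asymptotic])
  have ev: "eventually (\<lambda>z::complex. norm z < 1 \<and> z \<noteq> 1) (at 1 within ball 0 1)"
    by (auto simp: eventually_at_filter intro: always_eventually)
  have res_bd: "\<bar>deviation n \<theta>\<bar> \<le> l1 (deviation n)" for n by (rule l1_component)
  have srb: "summable (\<lambda>n. \<bar>deviation n \<theta>\<bar>)"
    by (rule summable_comparison_test[OF _ deviation_facts(1)]) (use res_bd in auto)
  have Bd: "((\<lambda>z. (\<Sum>n. of_real (deviation n \<theta>) * z ^ n) * (1 - z) powr (1/2)) \<longlongrightarrow> (0 :: complex)) (at 1 within ball 0 1)"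
  proof (rule Lim_null_comparison)
    have "((\<lambda>z::complex. (\<Sum>n. \<bar>deviation n \<theta>\<bar>) * sqrt (norm (1 - z))) \<longlongrightarrow> (\<Sum>n. \<bar>deviation n \<theta>\<bar>) * sqrt (norm (1 - 1 :: complex))) (at 1 within ball 0 1)"
      by (intro tendsto_intros)
    then show "((\<lambda>z::complex. (\<Sum>n. \<bar>deviation n \<theta>\<bar>) * sqrt (norm (1 - z))) \<longlongrightarrow> 0) (at 1 within ball 0 1)" by simp
    show "eventually (\<lambda>z::complex. norm ((\<Sum>n. of_real (deviation n \<theta>) * z ^ n) * (1 - z) powr (1/2)) \<le> (\<Sum>n. \<bar>deviation n \<theta>\<bar>) * sqrt (norm (1 - z))) (at 1 within ball 0 1)"
      using ev
    proof eventually_elim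
      case (elim z)
      have t: "norm (of_real (deviation n \<theta>) * z ^ n) \<le> \<bar>deviation n \<theta>\<bar>" for n
      proof -
        have "norm z ^ n \<le> 1" using elim by (intro power_le_one) auto
        then show ?thesis by (simp add: norm_mult norm_power mult_left_le)
      qed
      have "norm (\<Sum>n. of_real (deviation n \<theta>) * z ^ n) \<le> (\<Sum>n. \<bar>deviation n \<theta>\<bar>)" by (rule norm_suminf_le[OF t srb])
      moreover have "norm ((1 - z) powr (1/2)) = sqrt (norm (1 - z))"
        using elim by (simp add: norm_powr_real_powr' powr_half_sqrt)
      ultimately show ?case by (simp add: norm_mult mult_right_mono)
    qed
  qed
  have "((\<lambda>z. of_real (inv_law \<theta>) * ((\<Sum>n. of_real (mass u0 (Suc n)) * z ^ n) * (1 - z) powr (1/2))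
      + (\<Sum>n. of_real (deviation n \<theta>) * z ^ n) * (1 - z) powr (1/2)) \<longlongrightarrow> (of_real (inv_law \<theta>) * of_real amplitude + 0 :: complex)) (at 1 within ball 0 1)"
    by (intro tendsto_add tendsto_mult_left A Bd)
  moreover have "eventually (\<lambda>z. of_real (inv_law \<theta>) * ((\<Sum>n. of_real (mass u0 (Suc n)) * z ^ n) * (1 - z) powr (1/2))
      + (\<Sum>n. of_real (deviation n \<theta>) * z ^ n) * (1 - z) powr (1/2)
      = (\<Sum>n. of_real (surv u0 (Suc n) \<theta>) * z ^ n) * (1 - z) powr (1/2 :: complex)) (at 1 within ball 0 1)"
    using ev
  proof eventually_elim
    case (elim z)
    have s1: "summable (\<lambda>n. of_real (mass u0 (Suc n)) * z ^ n)"
      by (rule summable_bounded_power[OF decseq_nonneg_abs_le[OF decseq_mass mass_nonneg]]) (use elim in auto)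
    have s2: "summable (\<lambda>n. of_real (deviation n \<theta>) * z ^ n)"
    proof (rule summable_bounded_power)
      show "\<bar>deviation n \<theta>\<bar> \<le> (\<Sum>n. \<bar>deviation n \<theta>\<bar>)" for n
        using sum_le_suminf[OF srb, of "{n}"] by simp
    qed (use elim in auto)
    have "(\<Sum>n. of_real (surv u0 (Suc n) \<theta>) * z ^ n) = (\<Sum>n. of_real (inv_law \<theta>) * (of_real (mass u0 (Suc n)) * z ^ n) + of_real (deviation n \<theta>) * z ^ n)"
      by (simp add: deviation_def algebra_simps)
    also have "\<dots> = of_real (inv_law \<theta>) * (\<Sum>n. of_real (mass u0 (Suc n)) * z ^ n) + (\<Sum>n. of_real (deviation n \<theta>) * z ^ n)"
      using suminf_add[OF summable_mult[OF s1] s2] suminf_mult[OF s1] by simp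
    finally show ?case by (simp add: algebra_simps)
  qed
  ultimately show ?thesis by (simp add: Lim_transform_eventually)
qed

lemma half_coeff_surv: "half_coeff R \<theta> x (exp u0) (Suc n) = surv u0 (Suc n) \<theta> / v u0 \<theta> * (1 / exp (lnrho u0)) ^ Suc n"
  using v_pos[of u0 \<theta>] by (simp add: surv_def half_wt_def power_divide)

lemma half_coeff_0: "half_coeff R \<theta> x (exp u0) 0 = 0"
  using half_wt_0 by (simp add: half_wt_def)

lemma half_coeff_asymptotic:
  "half_coeff R \<theta> x (exp u0) \<sim>[at_top] (\<lambda>m. c0 R \<theta> x / sqrt (pi * real m) * (1 / exp (lnrho u0)) ^ m)"
proof (rule asymp_equivI')
  define c where "c = c0 R \<theta> x"
  have c: "c > 0" "c = inv_law \<theta> * amplitude / v u0 \<theta>" using c0_pos c0_eq by (auto simp: c_def)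
  have "(\<lambda>n. sqrt (Suc n) / sqrt n) \<longlonglongrightarrow> 1" by real_asymp
  from tendsto_mult[OF this surv_asymptotic]
  have "(\<lambda>n. sqrt (Suc n) / sqrt n * (sqrt n * surv u0 (Suc n) \<theta>)) \<longlonglongrightarrow> inv_law \<theta> * (amplitude / sqrt pi)" by simp
  moreover have "eventually (\<lambda>n. sqrt (Suc n) / sqrt n * (sqrt n * surv u0 (Suc n) \<theta>) = sqrt (Suc n) * surv u0 (Suc n) \<theta>) sequentially"
    using eventually_gt_at_top[of 0] by eventually_elim simp
  ultimately have "(\<lambda>n. sqrt (Suc n) * surv u0 (Suc n) \<theta>) \<longlonglongrightarrow> inv_law \<theta> * (amplitude / sqrt pi)"
    by (rule Lim_transform_eventually)
  then have "(\<lambda>n. sqrt (Suc n) * surv u0 (Suc n) \<theta> * (sqrt pi / (v u0 \<theta> * c))) \<longlonglongrightarrow> inv_law \<theta> * (amplitude / sqrt pi) * (sqrt pi / (v u0 \<theta> * c))"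
    by (rule tendsto_mult_right)
  moreover have "inv_law \<theta> * (amplitude / sqrt pi) * (sqrt pi / (v u0 \<theta> * c)) = 1"
    using v_pos[of u0 \<theta>] inv_law_pos[of \<theta>] amplitude_pos by (simp add: c(2))
  moreover have "sqrt (Suc n) * surv u0 (Suc n) \<theta> * (sqrt pi / (v u0 \<theta> * c))
      = half_coeff R \<theta> x (exp u0) (Suc n) / (c / sqrt (pi * real (Suc n)) * (1 / exp (lnrho u0)) ^ Suc n)" for n
    unfolding half_coeff_surv real_sqrt_mult using c(1) v_pos[of u0 \<theta>] by (simp add: field_simps del: of_nat_Suc power_Suc)
  ultimately have "(\<lambda>n. half_coeff R \<theta> x (exp u0) (Suc n) / (c / sqrt (pi * real (Suc n)) * (1 / exp (lnrho u0)) ^ Suc n)) \<longlonglongrightarrow> 1"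
    by (simp only:)
  then show "(\<lambda>m. half_coeff R \<theta> x (exp u0) m / (c0 R \<theta> x / sqrt (pi * real m) * (1 / exp (lnrho u0)) ^ m)) \<longlonglongrightarrow> 1"
    unfolding c_def by (rule LIMSEQ_imp_Suc)
qed

lemma half_coeff_conv_radius: "conv_radius (half_coeff R \<theta> x (exp u0)) = ereal (exp (lnrho u0))"
proof (rule conv_radius_ratio_limit_nonzero[OF refl])
  define s where "s n = surv u0 (Suc n) \<theta>" for n
  have s: "(\<lambda>n. sqrt n * s n) \<longlonglongrightarrow> inv_law \<theta> * (amplitude / sqrt pi)" and "inv_law \<theta> * (amplitude / sqrt pi) \<noteq> 0"
    using surv_asymptotic inv_law_pos[of \<theta>] amplitude_pos by (auto simp: s_def)
  then have "(\<lambda>n. (sqrt n * s n) / (sqrt (Suc n) * s (Suc n))) \<longlonglongrightarrow> 1"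
    using tendsto_divide[OF s LIMSEQ_Suc[OF s]] by simp
  moreover have "(\<lambda>n. sqrt (Suc n) / sqrt n) \<longlonglongrightarrow> 1" by real_asymp
  ultimately have "(\<lambda>n. exp (lnrho u0) * ((sqrt n * s n) / (sqrt (Suc n) * s (Suc n)) * (sqrt (Suc n) / sqrt n))) \<longlonglongrightarrow> exp (lnrho u0) * (1 * 1)"
    by (intro tendsto_mult tendsto_const)
  moreover have "eventually (\<lambda>n. exp (lnrho u0) * ((sqrt n * s n) / (sqrt (Suc n) * s (Suc n)) * (sqrt (Suc n) / sqrt n))
      = norm (half_coeff R \<theta> x (exp u0) (Suc n)) / norm (half_coeff R \<theta> x (exp u0) (Suc (Suc n)))) sequentially"
    using eventually_gt_at_top[of 0]
  proof eventually_elim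
    case (elim n)
    have "(p * a) / (q * b) * (q / p) = a / b" if "p > 0" "q > 0" for p q a b :: real
      using that by simp
    then have "(sqrt n * s n) / (sqrt (Suc n) * s (Suc n)) * (sqrt (Suc n) / sqrt n) = s n / s (Suc n)"
      using elim by simp
    moreover have "norm (half_coeff R \<theta> x (exp u0) (Suc n)) = s n / v u0 \<theta> * (1 / exp (lnrho u0)) ^ Suc n" for n
      using surv_nonneg[of u0 "Suc n" \<theta>] v_pos[of u0 \<theta>] by (simp add: half_coeff_surv s_def abs_mult)
    ultimately show ?case using v_pos[of u0 \<theta>] by simp
  qed
  ultimately have "(\<lambda>n. norm (half_coeff R \<theta> x (exp u0) (Suc n)) / norm (half_coeff R \<theta> x (exp u0) (Suc (Suc n)))) \<longlonglongrightarrow> exp (lnrho u0)"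
    by (simp only: mult_1_right Lim_transform_eventually)
  then show "(\<lambda>n. norm (half_coeff R \<theta> x (exp u0) n) / norm (half_coeff R \<theta> x (exp u0) (Suc n))) \<longlonglongrightarrow> exp (lnrho u0)"
    by (rule LIMSEQ_imp_Suc)
qed simp

lemma half_gf_asymptotic:
  "(\<lambda>t. H R \<theta> t x (exp u0)) \<sim>[at (of_real (exp (lnrho u0))) within ball 0 (exp (lnrho u0))]
     (\<lambda>t. of_real (c0 R \<theta> x) * (1 - t / of_real (exp (lnrho u0))) powr (-1/2))"
proof (rule asymp_equivI')
  define \<kappa> where "\<kappa> = exp (lnrho u0)"
  have \<kappa>: "\<kappa> > 0" by (simp add: \<kappa>_def)
  define c where "c = c0 R \<theta> x"
  have c: "c > 0" "c = inv_law \<theta> * amplitude / v u0 \<theta>" using c0_pos c0_eq by (auto simp: c_def)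
  define J where "J z = (\<Sum>n. of_real (surv u0 (Suc n) \<theta>) * z ^ n)" for z :: complex
  have scale: "filterlim (\<lambda>t. t / of_real \<kappa>) (at (1::complex) within ball 0 1) (at (of_real \<kappa>) within ball 0 \<kappa>)"
    unfolding filterlim_at
  proof (intro conjI)
    have "((\<lambda>t. t / of_real \<kappa>) \<longlongrightarrow> (of_real \<kappa> / of_real \<kappa> :: complex)) (at (of_real \<kappa>) within ball 0 \<kappa>)"
      using \<kappa> by (intro tendsto_intros) auto
    then show "((\<lambda>t. t / of_real \<kappa>) \<longlongrightarrow> (1 :: complex)) (at (of_real \<kappa>) within ball 0 \<kappa>)" using \<kappa> by simp
    show "eventually (\<lambda>t. t / of_real \<kappa> \<in> ball 0 1 \<and> t / of_real \<kappa> \<noteq> (1::complex)) (at (of_real \<kappa>) within ball 0 \<kappa>)"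
      unfolding eventually_at_filter using \<kappa> by (intro always_eventually) (auto simp: norm_divide)
  qed
  have "((\<lambda>z. z / of_real (v u0 \<theta> * c) * (J z * (1 - z) powr (1/2))) \<longlongrightarrow> 1 / of_real (v u0 \<theta> * c) * of_real (inv_law \<theta> * amplitude)) (at 1 within ball 0 1)"
    unfolding J_def using v_pos[of u0 \<theta>] c by (intro tendsto_intros surv_disc) auto
  moreover have "1 / of_real (v u0 \<theta> * c) * of_real (inv_law \<theta> * amplitude) = (1 :: complex)"
  proof -
    have "1 / (v u0 \<theta> * c) * (inv_law \<theta> * amplitude) = 1"
      using v_pos[of u0 \<theta>] inv_law_pos[of \<theta>] amplitude_pos by (simp add: c(2))
    then show ?thesis by (metis of_real_1 of_real_divide of_real_mult)
  qed
  ultimately have lim: "((\<lambda>z. z / of_real (v u0 \<theta> * c) * (J z * (1 - z) powr (1/2))) \<longlongrightarrow> 1) (at 1 within ball 0 1)" by simp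
  have "((\<lambda>t. t / of_real \<kappa> / of_real (v u0 \<theta> * c) * (J (t / of_real \<kappa>) * (1 - t / of_real \<kappa>) powr (1/2))) \<longlongrightarrow> 1) (at (of_real \<kappa>) within ball 0 \<kappa>)"
    by (rule filterlim_compose[OF lim scale])
  moreover have "eventually (\<lambda>t. t / of_real \<kappa> / of_real (v u0 \<theta> * c) * (J (t / of_real \<kappa>) * (1 - t / of_real \<kappa>) powr (1/2))
      = H R \<theta> t x (exp u0) / (of_real c * (1 - t / of_real \<kappa>) powr (-1/2))) (at (of_real \<kappa>) within ball 0 \<kappa>)"
    unfolding eventually_at_filter
  proof (intro always_eventually allI impI)
    fix t :: complex assume t: "t \<noteq> of_real \<kappa>" "t \<in> ball 0 \<kappa>"
    define z where "z = t / of_real \<kappa>"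
    have z: "norm z < 1" "z \<noteq> 1" using t \<kappa> by (auto simp: z_def norm_divide)
    have term_eq: "of_real (half_coeff R \<theta> x (exp u0) (Suc n)) * t ^ Suc n = z / of_real (v u0 \<theta>) * (of_real (surv u0 (Suc n) \<theta>) * z ^ n)" for n
    proof -
      have "t ^ Suc n = of_real \<kappa> ^ Suc n * z ^ Suc n" using \<kappa> by (simp add: z_def power_divide)
      then have "of_real (half_coeff R \<theta> x (exp u0) (Suc n)) * t ^ Suc n = of_real (half_coeff R \<theta> x (exp u0) (Suc n) * \<kappa> ^ Suc n) * z ^ Suc n"
        by simp
      also have "half_coeff R \<theta> x (exp u0) (Suc n) * \<kappa> ^ Suc n = surv u0 (Suc n) \<theta> / v u0 \<theta>"
        unfolding half_coeff_surv \<kappa>_def[symmetric] using \<kappa> by (simp add: power_divide del: power_Suc)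
      finally show ?thesis by simp
    qed
    have sJ: "summable (\<lambda>n. of_real (surv u0 (Suc n) \<theta>) * z ^ n)"
    proof (rule summable_bounded_power)
      show "\<bar>surv u0 (Suc n) \<theta>\<bar> \<le> mass u0 1" for n
        using surv_nonneg[of u0 "Suc n" \<theta>] surv_le_mass[of u0 "Suc n" \<theta>] decseqD[OF decseq_mass, of 0 n u0] by simp
    qed (use z in auto)
    have "(\<lambda>n. of_real (half_coeff R \<theta> x (exp u0) (Suc n)) * t ^ Suc n) sums (z / of_real (v u0 \<theta>) * J z)"
      unfolding term_eq J_def by (rule sums_mult[OF summable_sums[OF sJ]])
    then have "(\<lambda>n. of_real (half_coeff R \<theta> x (exp u0) n) * t ^ n) sums (z / of_real (v u0 \<theta>) * J z)"
      by (subst (asm) sums_Suc_iff) (simp add: half_coeff_0)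
    then have Ht: "H R \<theta> t x (exp u0) = z / of_real (v u0 \<theta>) * J z"
      unfolding H_def by (rule sums_unique[symmetric])
    have arrange: "a / (V * C) * (b * p) = a / V * b / (C * inverse p)" for a b p V C :: complex
      by (simp add: divide_inverse mult_ac)
    have neg: "(1 - z) powr (-1/2) = inverse ((1 - z) powr (1/2))"
      using powr_minus[of "1 - z" "1/2"] by simp
    show "t / of_real \<kappa> / of_real (v u0 \<theta> * c) * (J (t / of_real \<kappa>) * (1 - t / of_real \<kappa>) powr (1/2))
      = H R \<theta> t x (exp u0) / (of_real c * (1 - t / of_real \<kappa>) powr (-1/2))"
      unfolding z_def[symmetric] Ht neg of_real_mult by (rule arrange)
  qed
  ultimately show "((\<lambda>t. H R \<theta> t x (exp u0) / (of_real (c0 R \<theta> x) * (1 - t / of_real (exp (lnrho u0))) powr (-1/2))) \<longlongrightarrow> 1) (at (of_real (exp (lnrho u0))) within ball 0 (exp (lnrho u0)))"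
    unfolding c_def[symmetric] \<kappa>_def[symmetric] by (rule Lim_transform_eventually)
qed

text \<open>The drift is a positive multiple of the vanishing \<open>u\<close>-derivative of \<open>B\<close>.\<close>

lemma drift_zero: "drift_y R \<theta> x (exp u0) = 0"
proof -
  have "gf (return_walks \<theta>) ht (lnrho u0) u0 = 0"
    using slope_u0[of \<theta>] gf_return_len_pos[of \<theta> u0] by (simp add: slope_def)
  then have "deriv_y (B R \<theta>) (exp (lnrho u0)) x (exp u0) = 0"
    unfolding deriv_y_def B_return
    using DERIV_imp_deriv[OF gen_fun_derivative_y[OF gconv_passages[OF return_walks_passages[of \<theta>], of u0]]] by simp
  then show ?thesis by (simp add: drift_y_def rho_exp)
qed

end

theorem lemma15:
  fixes R :: rule and x y :: real
  assumes "aperiodic R" and "vertically_unbounded R"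
    and "0 < x" and "y = tau R x"
  shows "\<forall>\<theta>.
      drift_y R \<theta> x y = 0
    \<and> conv_radius (half_coeff R \<theta> x y) = ereal (rho R x y)
    \<and> (\<lambda>t. H R \<theta> t x y)
        \<sim>[at (of_real (rho R x y)) within ball 0 (rho R x y)]
        (\<lambda>t. of_real (c0 R \<theta> x) * (1 - t / of_real (rho R x y)) powr (-1/2))
    \<and> half_coeff R \<theta> x y
        \<sim>[at_top] (\<lambda>m. c0 R \<theta> x / sqrt (pi * real m) * (1 / kappa R x) ^ m)"
proof -
  interpret weighted_rule R x by unfold_locales (use assms in auto)
  have y: "y = exp u0" using assms(4) tau_eq by simp
  show ?thesis
    unfolding y rho_exp kappa_eq
    using drift_zero half_coeff_conv_radius half_gf_asymptotic half_coeff_asymptotic by blast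
qed

end
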